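(* Let $\mathscr{R}$ be the ring of entire functions in one complex variable $z$ of the form $\sum_{j=1}^n p_j\exp(q_j)$ with $n\geq 1$ and $p_j,q_j\in\mathbb{C}[z]$ for each $j$. Let $\mathscr{R}'$ be a subring of $\mathscr{R}$ containing the variable $z$. Then the ring $\mathbb{Z}$ (as a structure over the language $\{0,1,+,\times,=\}$) is positive existentially interpretable in the ring $\mathscr{R}'$ over the language $\mathscr{L}_z=\{0,1,z,+,\times,=\}$. In particular, the analogue of Hilbert's tenth problem for $\mathscr{R}'$ with coefficients in $\mathbb{Z}[z]$ has a negative answer.
   Context: Rings have a unit, and subrings contain it; thus $\mathbb{Z}[z]\subseteq\mathscr{R}'$. $\mathscr{R}'$ is viewed as an $\mathscr{L}_z$-structure in the obvious way, the constant symbol $z$ being interpreted as the function $z$. A positive existential formula is one built from atomic formulas using only conjunctions, disjunctions and existential quantifiers (no negations, no universal quantifiers). Formulas have no parameters other than the constant symbols of the language. An interpretation of a structure $(M_1,\mathscr{L}_1)$ in a structure $(M_2,\mathscr{L}_2)$ is a function $\theta:A\to M_1$, where $A\subseteq M_2^r$ for some $r\geq 1$, such that: (Int1) $\theta$ is surjective onto $M_1$; (Int2) $A$ is $\mathscr{L}_2$-definable in $M_2$; (Int3) for each symbol $s\in\mathscr{L}_1$ (including equality) with realization $s^{M_1}\subseteq M_1^k$ (constants and functions being identified with singletons and graphs), the pre-image of $s^{M_1}$ under the $k$-th cartesian power of $\theta$ is $\mathscr{L}_2$-definable in $M_2$. The interpretation is positive existential if the $\mathscr{L}_2$-formulas used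 in (Int2) and (Int3) are positive existential. The analogue of Hilbert's tenth problem for a ring $A$ with coefficients in a recursive subring $A_0$ asks for an algorithm which decides the solvability in $A$ of polynomial equations (in finitely many unknowns) with coefficients in $A_0$; a negative answer means that no such algorithm exists. *)

theory Defs
  imports
    "HOL-Computational_Algebra.Polynomial"
    "HOL-Library.Nat_Bijection"
    "HOL-Algebra.Subrings"
    "HOL-Algebra.IntRing"
begin

section \<open>Positive existential formulas and interpretations\<close>

text \<open>
  A language without relation symbols other than equality is given by a type \<open>'f\<close> of function
  symbols and an arity function \<open>ar :: 'f \<Rightarrow> nat\<close>; constant symbols have arity 0.
  Elements of \<open>M\<^sup>k\<close> are lists of length \<open>k\<close>, and only the values of \<open>interp M s\<close>
  on lists of length \<open>ar s\<close> are relevant.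
\<close>

record ('f, 'a) fo_structure =
  universe :: "'a set"
  interp :: "'f \<Rightarrow> 'a list \<Rightarrow> 'a"

datatype 'f fo_term =
    Var nat
  | App 'f "'f fo_term list"

datatype 'f pe_formula =
    Eq "'f fo_term" "'f fo_term"
  | Conj "'f pe_formula" "'f pe_formula"
  | Disj "'f pe_formula" "'f pe_formula"
  | Exists nat "'f pe_formula"

fun wf_term :: "('f \<Rightarrow> nat) \<Rightarrow> 'f fo_term \<Rightarrow> bool" where
  "wf_term ar (Var i) \<longleftrightarrow> True"
| "wf_term ar (App s ts) \<longleftrightarrow> length ts = ar s \<and> (\<forall>t\<in>set ts. wf_term ar t)"

fun wf_formula :: "('f \<Rightarrow> nat) \<Rightarrow> 'f pe_formula \<Rightarrow> bool" where
  "wf_formula ar (Eq t u) \<longleftrightarrow> wf_term ar t \<and> wf_term ar u"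
| "wf_formula ar (Conj \<phi> \<psi>) \<longleftrightarrow> wf_formula ar \<phi> \<and> wf_formula ar \<psi>"
| "wf_formula ar (Disj \<phi> \<psi>) \<longleftrightarrow> wf_formula ar \<phi> \<and> wf_formula ar \<psi>"
| "wf_formula ar (Exists i \<phi>) \<longleftrightarrow> wf_formula ar \<phi>"

fun term_vars :: "'f fo_term \<Rightarrow> nat set" where
  "term_vars (Var i) = {i}"
| "term_vars (App s ts) = (\<Union>t\<in>set ts. term_vars t)"

fun free_vars :: "'f pe_formula \<Rightarrow> nat set" where
  "free_vars (Eq t u) = term_vars t \<union> term_vars u"
| "free_vars (Conj \<phi> \<psi>) = free_vars \<phi> \<union> free_vars \<psi>"
| "free_vars (Disj \<phi> \<psi>) = free_vars \<phi> \<union> free_vars \<psi>"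
| "free_vars (Exists i \<phi>) = free_vars \<phi> - {i}"

fun eval_term :: "('f, 'a) fo_structure \<Rightarrow> (nat \<Rightarrow> 'a) \<Rightarrow> 'f fo_term \<Rightarrow> 'a" where
  "eval_term M e (Var i) = e i"
| "eval_term M e (App s ts) = interp M s (map (eval_term M e) ts)"

fun satisfies :: "('f, 'a) fo_structure \<Rightarrow> (nat \<Rightarrow> 'a) \<Rightarrow> 'f pe_formula \<Rightarrow> bool" where
  "satisfies M e (Eq t u) \<longleftrightarrow> eval_term M e t = eval_term M e u"
| "satisfies M e (Conj \<phi> \<psi>) \<longleftrightarrow> satisfies M e \<phi> \<and> satisfies M e \<psi>"
| "satisfies M e (Disj \<phi> \<psi>) \<longleftrightarrow> satisfies M e \<phi> \<or> satisfies M e \<psi>"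
| "satisfies M e (Exists i \<phi>) \<longleftrightarrow> (\<exists>a\<in>universe M. satisfies M (e(i := a)) \<phi>)"

definition tuples :: "nat \<Rightarrow> 'a set \<Rightarrow> 'a list set" where
  "tuples k M = {xs. length xs = k \<and> set xs \<subseteq> M}"

definition pe_definable ::
    "('f \<Rightarrow> nat) \<Rightarrow> ('f, 'a) fo_structure \<Rightarrow> nat \<Rightarrow> 'a list set \<Rightarrow> bool" where
  "pe_definable ar M k D \<longleftrightarrow>
     (\<exists>\<phi>. wf_formula ar \<phi> \<and> free_vars \<phi> \<subseteq> {..<k} \<and>
          D = {xs \<in> tuples k (universe M). satisfies M (\<lambda>i. xs ! i) \<phi>})"

definition eq_realization :: "('f, 'a) fo_structure \<Rightarrow> 'a list set" where
  "eq_realization M = {[a, a] | a. a \<in> universe M}"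

text \<open>The graph of a function symbol; for a constant symbol this is the singleton of its value.\<close>

definition realization :: "('f \<Rightarrow> nat) \<Rightarrow> ('f, 'a) fo_structure \<Rightarrow> 'f \<Rightarrow> 'a list set" where
  "realization ar M s = {as @ [interp M s as] | as. as \<in> tuples (ar s) (universe M)}"

text \<open>
  The pre-image of \<open>S \<subseteq> M\<^sub>1\<^sup>k\<close> under the \<open>k\<close>-th cartesian power of \<open>\<theta> : A \<rightarrow> M\<^sub>1\<close>, where
  \<open>A \<subseteq> M\<^sub>2\<^sup>r\<close>. By concatenation it is regarded as a subset of \<open>M\<^sub>2\<close> to the power \<open>k * r\<close>.
\<close>

definition power_preimage ::
    "('b list \<Rightarrow> 'a) \<Rightarrow> 'b list set \<Rightarrow> nat \<Rightarrow> 'a list set \<Rightarrow> 'b list set" where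
  "power_preimage \<theta> A k S = {concat xss | xss. xss \<in> tuples k A \<and> map \<theta> xss \<in> S}"

definition pe_interpretation ::
    "('f \<Rightarrow> nat) \<Rightarrow> ('f, 'a) fo_structure \<Rightarrow> ('g \<Rightarrow> nat) \<Rightarrow> ('g, 'b) fo_structure \<Rightarrow>
     nat \<Rightarrow> 'b list set \<Rightarrow> ('b list \<Rightarrow> 'a) \<Rightarrow> bool" where
  "pe_interpretation ar1 M1 ar2 M2 r A \<theta> \<longleftrightarrow>
     r \<ge> 1 \<and> A \<subseteq> tuples r (universe M2) \<and>
     \<theta> ` A = universe M1 \<and>
     pe_definable ar2 M2 r A \<and>
     pe_definable ar2 M2 (2 * r) (power_preimage \<theta> A 2 (eq_realization M1)) \<and>
     (\<forall>s. pe_definable ar2 M2 (Suc (ar1 s) * r)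
            (power_preimage \<theta> A (Suc (ar1 s)) (realization ar1 M1 s)))"

definition pe_interpretable ::
    "('f \<Rightarrow> nat) \<Rightarrow> ('f, 'a) fo_structure \<Rightarrow> ('g \<Rightarrow> nat) \<Rightarrow> ('g, 'b) fo_structure \<Rightarrow> bool" where
  "pe_interpretable ar1 M1 ar2 M2 \<longleftrightarrow> (\<exists>r A \<theta>. pe_interpretation ar1 M1 ar2 M2 r A \<theta>)"


section \<open>Rings as structures\<close>

datatype ring_sym = SZero | SOne | SPlus | STimes

fun ring_arity :: "ring_sym \<Rightarrow> nat" where
  "ring_arity SZero = 0"
| "ring_arity SOne = 0"
| "ring_arity SPlus = 2"
| "ring_arity STimes = 2"

fun ring_interp :: "('a, 'm) ring_scheme \<Rightarrow> ring_sym \<Rightarrow> 'a list \<Rightarrow> 'a" where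
  "ring_interp R SZero xs = \<zero>\<^bsub>R\<^esub>"
| "ring_interp R SOne xs = \<one>\<^bsub>R\<^esub>"
| "ring_interp R SPlus xs = xs ! 0 \<oplus>\<^bsub>R\<^esub> xs ! 1"
| "ring_interp R STimes xs = xs ! 0 \<otimes>\<^bsub>R\<^esub> xs ! 1"

definition ring_structure :: "('a, 'm) ring_scheme \<Rightarrow> (ring_sym, 'a) fo_structure" where
  "ring_structure R = \<lparr>universe = carrier R, interp = ring_interp R\<rparr>"

text \<open>The language of rings with one additional constant symbol \<open>SZ\<close>, for the variable \<open>z\<close>.\<close>

datatype lz_sym = SRing ring_sym | SZ

fun lz_arity :: "lz_sym \<Rightarrow> nat" where
  "lz_arity (SRing s) = ring_arity s"
| "lz_arity SZ = 0"

fun lz_interp :: "('a, 'm) ring_scheme \<Rightarrow> 'a \<Rightarrow> lz_sym \<Rightarrow> 'a list \<Rightarrow> 'a" where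
  "lz_interp R c (SRing s) xs = ring_interp R s xs"
| "lz_interp R c SZ xs = c"

definition lz_structure :: "('a, 'm) ring_scheme \<Rightarrow> 'a \<Rightarrow> (lz_sym, 'a) fo_structure" where
  "lz_structure R c = \<lparr>universe = carrier R, interp = lz_interp R c\<rparr>"


section \<open>The ring of exponential polynomials\<close>

definition exp_polys :: "(complex \<Rightarrow> complex) set" where
  "exp_polys = {f. \<exists>n\<ge>1. \<exists>p q :: nat \<Rightarrow> complex poly.
                   f = (\<lambda>z. \<Sum>j=1..n. poly (p j) z * exp (poly (q j) z))}"

definition exp_poly_ring :: "(complex \<Rightarrow> complex) ring" where
  "exp_poly_ring =
     \<lparr>carrier = exp_polys,
      mult = (\<lambda>f g z. f z * g z), one = (\<lambda>z. 1),
      zero = (\<lambda>z. 0), add = (\<lambda>f g z. f z + g z)\<rparr>"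

lemma exp_polysI:
  fixes p q :: "'i \<Rightarrow> complex poly"
  assumes "finite I" and "I \<noteq> {}"
    and f: "\<And>z. f z = (\<Sum>i\<in>I. poly (p i) z * exp (poly (q i) z))"
  shows "f \<in> exp_polys"
proof -
  obtain h where h: "bij_betw h {1..card I} I"
    using ex_bij_betw_nat_finite_1[OF \<open>finite I\<close>] by blast
  have "f = (\<lambda>z. \<Sum>j=1..card I. poly ((p \<circ> h) j) z * exp (poly ((q \<circ> h) j) z))"
    by (rule ext) (simp add: f flip: sum.reindex_bij_betw[OF h])
  moreover have "card I \<ge> 1"
    using assms by (simp add: Suc_leI card_gt_0_iff)
  ultimately show ?thesis
    unfolding exp_polys_def by blast
qed

lemma exp_polysE:
  assumes "f \<in> exp_polys"
  obtains n :: nat and p q :: "nat \<Rightarrow> complex poly"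
  where "n \<ge> 1" "f = (\<lambda>z. \<Sum>j=1..n. poly (p j) z * exp (poly (q j) z))"
  using assms unfolding exp_polys_def by blast

lemma exp_polys_add:
  assumes "f \<in> exp_polys" "g \<in> exp_polys"
  shows "(\<lambda>z. f z + g z) \<in> exp_polys"
proof -
  obtain n :: nat and p q where f: "n \<ge> 1" "f = (\<lambda>z. \<Sum>j=1..n. poly (p j) z * exp (poly (q j) z))"
    using assms(1) by (rule exp_polysE)
  obtain m :: nat and s t where g: "m \<ge> 1" "g = (\<lambda>z. \<Sum>j=1..m. poly (s j) z * exp (poly (t j) z))"
    using assms(2) by (rule exp_polysE)
  show ?thesis
  proof (rule exp_polysI[of "{1..n} <+> {1..m}" _ "case_sum p s" "case_sum q t"])
    show "{1..n} <+> {1..m} \<noteq> {}"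
      using f(1) by auto
  qed (simp_all add: f(2) g(2) sum.Plus)
qed

lemma exp_polys_mult:
  assumes "f \<in> exp_polys" "g \<in> exp_polys"
  shows "(\<lambda>z. f z * g z) \<in> exp_polys"
proof -
  obtain n :: nat and p q where f: "n \<ge> 1" "f = (\<lambda>z. \<Sum>j=1..n. poly (p j) z * exp (poly (q j) z))"
    using assms(1) by (rule exp_polysE)
  obtain m :: nat and s t where g: "m \<ge> 1" "g = (\<lambda>z. \<Sum>j=1..m. poly (s j) z * exp (poly (t j) z))"
    using assms(2) by (rule exp_polysE)
  show ?thesis
  proof (rule exp_polysI[of "{1..n} \<times> {1..m}" _ "\<lambda>(i, j). p i * s j" "\<lambda>(i, j). q i + t j"])
    show "{1..n} \<times> {1..m} \<noteq> {}"
      using f(1) g(1) by auto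
    show "f z * g z = (\<Sum>k\<in>{1..n} \<times> {1..m}. poly (case k of (i, j) \<Rightarrow> p i * s j) z *
            exp (poly (case k of (i, j) \<Rightarrow> q i + t j) z))" for z
      unfolding f(2) g(2) sum_product sum.cartesian_product
      by (rule sum.cong) (auto simp: exp_add)
  qed simp
qed

lemma cring_exp_poly_ring: "cring exp_poly_ring"
proof (rule cringI)
  have const: "(\<lambda>z. c) \<in> exp_polys" for c
    by (rule exp_polysI[of "{0::nat}" _ "\<lambda>_. [:c:]" "\<lambda>_. 0"]) auto
  have "\<exists>g\<in>exp_polys. (\<lambda>z. g z + f z) = (\<lambda>z. 0)" if "f \<in> exp_polys" for f
    using exp_polys_mult[OF const[of "- 1"] that] by (intro bexI) auto
  then show "abelian_group exp_poly_ring"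
    by (intro abelian_groupI) (auto simp: exp_poly_ring_def exp_polys_add const add_ac)
  show "Group.comm_monoid exp_poly_ring"
    by (rule comm_monoidI) (auto simp: exp_poly_ring_def exp_polys_mult const mult_ac)
qed (auto simp: exp_poly_ring_def algebra_simps)


section \<open>Recursive sets of natural numbers\<close>

text \<open>
  \<open>recursive n f\<close> says that \<open>f\<close>, restricted to lists of length \<open>n\<close>, is a total recursive function
  of \<open>n\<close> arguments: the least class of functions containing the initial functions and closed under
  composition, primitive recursion (on the first argument) and minimization of functions for which
  a zero always exists.
\<close>

inductive recursive :: "nat \<Rightarrow> (nat list \<Rightarrow> nat) \<Rightarrow> bool" where
  recursive_zero: "recursive n (\<lambda>xs. 0)"
| recursive_suc: "recursive 1 (\<lambda>xs. Suc (xs ! 0))"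
| recursive_proj: "i < n \<Longrightarrow> recursive n (\<lambda>xs. xs ! i)"
| recursive_comp: "recursive (length gs) f \<Longrightarrow> \<forall>g\<in>set gs. recursive n g \<Longrightarrow>
    recursive n (\<lambda>xs. f (map (\<lambda>g. g xs) gs))"
| recursive_prim: "recursive n f \<Longrightarrow> recursive (Suc (Suc n)) g \<Longrightarrow>
    recursive (Suc n) (\<lambda>xs. rec_nat (f (tl xs)) (\<lambda>k y. g (k # y # tl xs)) (hd xs))"
| recursive_min: "recursive (Suc n) f \<Longrightarrow> \<forall>xs. length xs = n \<longrightarrow> (\<exists>y. f (y # xs) = 0) \<Longrightarrow>
    recursive n (\<lambda>xs. LEAST y. f (y # xs) = 0)"

definition decidable :: "nat set \<Rightarrow> bool" where
  "decidable S \<longleftrightarrow> (\<exists>f. recursive 1 f \<and> (\<forall>n. f [n] = (if n \<in> S then 1 else 0)))"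


section \<open>Polynomial equations with coefficients in \<open>\<int>[z]\<close>\<close>

text \<open>
  A polynomial over \<open>\<int>[z]\<close> in unknowns \<open>x\<^sub>0, x\<^sub>1, \<dots>\<close> is given as a list of monomials.
  The pair \<open>([c\<^sub>0, c\<^sub>1, \<dots>], [e\<^sub>0, \<dots>, e\<^sub>k])\<close> stands for
  \<open>(c\<^sub>0 + c\<^sub>1 z + \<dots>) * x\<^sub>0 ^ e\<^sub>0 * \<dots> * x\<^sub>k ^ e\<^sub>k\<close>.
\<close>

type_synonym zz_mpoly = "(int list \<times> nat list) list"

definition eval_mpoly ::
    "(nat \<Rightarrow> complex \<Rightarrow> complex) \<Rightarrow> zz_mpoly \<Rightarrow> complex \<Rightarrow> complex" where
  "eval_mpoly x P z =
     (\<Sum>(cs, es)\<leftarrow>P. (\<Sum>i<length cs. of_int (cs ! i) * z ^ i) *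
                     (\<Prod>j<length es. x j z ^ (es ! j)))"

definition solvable_in :: "(complex \<Rightarrow> complex) set \<Rightarrow> zz_mpoly \<Rightarrow> bool" where
  "solvable_in R' P \<longleftrightarrow> (\<exists>x. (\<forall>j. x j \<in> R') \<and> eval_mpoly x P = (\<lambda>z. 0))"

definition code_mpoly :: "zz_mpoly \<Rightarrow> nat" where
  "code_mpoly P = list_encode
     (map (\<lambda>(cs, es). prod_encode (list_encode (map int_encode cs), list_encode es)) P)"

text \<open>The analogue of Hilbert's tenth problem for \<open>R'\<close> with coefficients in \<open>\<int>[z]\<close>.\<close>

definition hilbert10_decidable :: "(complex \<Rightarrow> complex) set \<Rightarrow> bool" where
  "hilbert10_decidable R' \<longleftrightarrow> decidable {code_mpoly P | P. solvable_in R' P}"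

lemma bij_code_mpoly: "bij code_mpoly"
proof -
  have bij_map: "bij (map f)" if "bij f" for f :: "'x \<Rightarrow> 'y"
    using that by (simp add: bij_def inj_mapI surj_def) (metis ex_map_conv)
  have le: "bij list_encode"
    by (simp add: bij_def inj_list_encode surj_list_encode)
  have "bij (list_encode \<circ> map int_encode)"
    by (intro bij_comp bij_map bij_int_encode le)
  then have "bij (map_prod (list_encode \<circ> map int_encode) list_encode)"
    using le by (simp add: bij_def map_prod_surj prod.inj_map)
  then have "bij (list_encode \<circ> map (prod_encode \<circ>
      map_prod (list_encode \<circ> map int_encode) list_encode))"
    by (intro bij_comp bij_map bij_prod_encode le)
  moreover have "code_mpoly = list_encode \<circ> map (prod_encode \<circ>
      map_prod (list_encode \<circ> map int_encode) list_encode)"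
    by (rule ext) (simp add: code_mpoly_def comp_def case_prod_unfold map_prod_def)
  ultimately show ?thesis
    by simp
qed

end

theory Submission
  imports Defs "HOL-Number_Theory.Cong" "HOL-Library.Function_Algebras"
begin

text \<open>
  Let \<open>w\<close> be a nonconstant polynomial. In the ring of exponential polynomials the Pell equation
  \<open>X\<^sup>2 - (w\<^sup>2 - 1) Y\<^sup>2 = 1\<close> has only the solutions \<open>(\<plusminus> X\<^sub>n(w), \<plusminus> Y\<^sub>n(w))\<close> with
  \<open>X\<^sub>n(w) + Y\<^sub>n(w) sqrt (w\<^sup>2 - 1) = (w + sqrt (w\<^sup>2 - 1))\<^sup>n\<close>: a solution is a polynomial because
  the leading exponent of \<open>X\<close> and \<open>Y\<close> cannot cancel, and polynomial solutions descend in degree.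
  Since \<open>Y\<^sub>n(1) = n\<close>, the integers are interpreted by the solutions \<open>Y\<close> for \<open>w = z\<close>, and their sum,
  product and equality by divisibility by \<open>z - 1\<close>.

  For the undecidability the Matiyasevich theorem is not needed. If \<open>V\<close> is a polynomial with \<open>V(1) = 1\<close>
  and \<open>V(0) = a\<close>, then \<open>Y\<^sub>n(V)\<close> has the value \<open>n\<close> at 1 and the exponentially growing value
  \<open>Y\<^sub>n(a)\<close> at 0, so every exponential Diophantine predicate is expressible in the ring. It remains to
  show, in the manner of Davis, Putnam and Robinson, that graphs of recursive functions are exponential
  Diophantine: a value is correct iff it lies in a finite set of statements each of which follows
  from others in the set by one of finitely many rules. This needs a single bounded universal
  quantifier in front of a polynomial predicate, which is removed by means of binomial coefficients.
  A diagonal argument concludes.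
\<close>

section \<open>The Pell equation\<close>

text \<open>Of the subring nothing is known but that it contains Z[z]. Hence the witnesses that the
  proof supplies must be polynomials with integer coefficients, while those that it receives may be
  any exponential polynomials. The Pell equation bridges the two, since its solutions in the large
  ring already lie in Z[z]. Divisibility by \<open>z\<close>, \<open>z - 1\<close> or
  \<open>4 z - 5\<close> always yields an equality of values at 0, 1 or 5/4; conversely, integer
  polynomials with equal values there differ by a multiple in Z[z].

  The Pell numbers \<open>X\<^sub>n(a)\<close>, \<open>Y\<^sub>n(a)\<close> do not give powers at
  once: they determine \<open>y ^ n\<close> only modulo \<open>2 a y - y^2 - 1\<close>, so a modulus
  beyond \<open>y ^ n\<close> is needed in advance. It is provided by the powers of 2, which come
  from the ring itself: at \<open>z = 5/4\<close> the unit \<open>z + sqrt (z^2 - 1)\<close> equals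
  2. This is why numbers are coded by polynomials with the same value at 0, 1 and 5/4.\<close>

fun pell_x pell_y :: "'a::comm_ring_1 \<Rightarrow> nat \<Rightarrow> 'a" where
  "pell_x w 0 = 1"
| "pell_x w (Suc n) = w * pell_x w n + (w * w - 1) * pell_y w n"
| "pell_y w 0 = 0"
| "pell_y w (Suc n) = pell_x w n + w * pell_y w n"

lemma pell_norm: "pell_x w n * pell_x w n = 1 + (w * w - 1) * (pell_y w n * pell_y w n)"
proof (induction n)
  case (Suc n)
  have "pell_x w (Suc n) * pell_x w (Suc n) - (w * w - 1) * (pell_y w (Suc n) * pell_y w (Suc n))
      = pell_x w n * pell_x w n - (w * w - 1) * (pell_y w n * pell_y w n)"
    by (simp add: algebra_simps)
  with Suc show ?case
    by (simp add: algebra_simps)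
qed simp

lemma pell_one: "pell_x (1::'a::comm_ring_1) n = 1" "pell_y (1::'a) n = of_nat n"
  by (induction n) auto

text \<open>Up to sign, the coefficient of the square root after multiplication by
  \<open>w - sqrt (w^2 - 1)\<close>, which undoes the step from \<open>n\<close> to
  \<open>Suc n\<close>.\<close>

lemma pell_back: "pell_x w (Suc n) - w * pell_y w (Suc n) = - pell_y w n"
  by (simp add: algebra_simps)

lemma pell_poly: "poly (pell_x w n) z = pell_x (poly w z) n" "poly (pell_y w n) z = pell_y (poly w z) n"
  by (induction n) auto

lemma pell_of_int:
  "of_int (pell_x w n) = (pell_x (of_int w) n :: 'a::comm_ring_1)"
  "of_int (pell_y w n) = (pell_y (of_int w) n :: 'a)"
  by (induction n) auto

text \<open>Modulo \<open>w - 1\<close> the recursion becomes the one with base 1, solved by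
  \<open>pell_one\<close>.\<close>

lemma py_dvd_diff: "w - 1 dvd pell_y w n - of_nat n"
proof -
  have "w - 1 dvd pell_x w n - 1 \<and> w - 1 dvd pell_y w n - of_nat n"
  proof (induction n)
    case (Suc n)
    have "pell_x w (Suc n) - 1 = (w - 1) * (pell_x w n + (w + 1) * pell_y w n) + (pell_x w n - 1)"
      "pell_y w (Suc n) - of_nat (Suc n) = (pell_x w n - 1) + (w - 1) * pell_y w n + (pell_y w n - of_nat n)"
      by (simp_all add: algebra_simps)
    with Suc show ?case
      by (metis dvd_add dvd_triv_left)
  qed simp
  then show ?thesis ..
qed

text \<open>Modulo \<open>2 * w * y - y * y - 1\<close> the element \<open>w - y\<close> is a square
  root of \<open>w * w - 1\<close>, and putting it in place of the root turns
  \<open>(w - sqrt (w^2 - 1)) ^ n\<close> into \<open>y ^ n\<close>.\<close>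

lemma pell_power_dvd:
  "2 * w * y - y * y - 1 dvd pell_x w n - (w - y) * pell_y w n - y ^ n"
proof (induction n)
  case (Suc n)
  have "pell_x w (Suc n) - (w - y) * pell_y w (Suc n) - y ^ Suc n
      = (2 * w * y - y * y - 1) * pell_y w n + y * (pell_x w n - (w - y) * pell_y w n - y ^ n)"
    by (simp add: algebra_simps)
  with Suc show ?case
    by (metis dvd_add dvd_triv_left dvd_mult)
qed simp

text \<open>Here the modulus of \<open>pell_power_dvd\<close> vanishes: \<open>w - y\<close> is a
  true square root of \<open>w * w - 1\<close>, and the conjugate units are \<open>y\<close> and
  \<open>inverse y\<close>.\<close>

lemma pell_rational:
  fixes w y :: "'a::field_char_0"
  assumes "y \<noteq> 0" and "2 * w = y + inverse y"
  shows "pell_x w n + (w - y) * pell_y w n = inverse y ^ n" "pell_x w n - (w - y) * pell_y w n = y ^ n"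
proof -
  have "y * inverse y = 1"
    using assms(1) by simp
  moreover have iy: "inverse y = 2 * w - y"
    using assms(2) by simp
  ultimately have u: "w * w - 1 = (w - y) * (w - y)"
    by (simp add: algebra_simps)
  show "pell_x w n - (w - y) * pell_y w n = y ^ n"
  proof (induction n)
    case (Suc n)
    have "pell_x w (Suc n) - (w - y) * pell_y w (Suc n) = y * (pell_x w n - (w - y) * pell_y w n)"
      by (simp add: u) (simp add: algebra_simps)
    with Suc show ?case
      by simp
  qed simp
  show "pell_x w n + (w - y) * pell_y w n = inverse y ^ n"
  proof (induction n)
    case (Suc n)
    have "pell_x w (Suc n) + (w - y) * pell_y w (Suc n) = inverse y * (pell_x w n + (w - y) * pell_y w n)"
      by (simp add: u iy) (simp add: algebra_simps)
    with Suc show ?case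
      by simp
  qed simp
qed

text \<open>Otherwise both factors have degree exactly \<open>degree b\<close>, but their difference
  is \<open>2 * w * b\<close>, of larger degree as \<open>w\<close> is not constant.\<close>

lemma degree_factors:
  fixes a b w :: "'a::field_char_0 poly"
  assumes "degree w \<ge> 1" "b \<noteq> 0" "(a - w * b) * (a + w * b) \<noteq> 0"
    and "degree ((a - w * b) * (a + w * b)) \<le> 2 * degree b"
  shows "degree (a - w * b) < degree b \<or> degree (a + w * b) < degree b"
proof (rule ccontr)
  assume not: "\<not> ?thesis"
  have "degree (a - w * b) + degree (a + w * b) \<le> 2 * degree b"
    using assms(3,4) by (auto simp: degree_mult_eq)
  with not have "degree (a - w * b) \<le> degree b" "degree (a + w * b) \<le> degree b"
    by linarith+
  then have "degree ((a + w * b) - (a - w * b)) \<le> degree b"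
    using degree_diff_le by blast
  also have "(a + w * b) - (a - w * b) = Polynomial.smult 2 (w * b)"
    by (simp add: numeral_poly algebra_simps flip: smult_add_left)
  finally have "degree (w * b) \<le> degree b"
    by simp
  moreover have "w \<noteq> 0"
    using assms(1) by auto
  ultimately show False
    using assms(1,2) by (simp add: degree_mult_eq)
qed

text \<open>The next two lemmas descend by multiplying \<open>X + Y sqrt (w\<^sup>2 - 1)\<close> with \<open>w \<mp> sqrt (w\<^sup>2 - 1)\<close>.\<close>

lemma pell_poly_zero:
  fixes a b w :: "'a::field_char_0 poly"
  assumes "degree w \<ge> 1" "a * a = (w * w - 1) * (b * b)"
  shows "a = 0 \<and> b = 0"
  using assms(2)
proof (induction "degree b" arbitrary: a b rule: less_induct)
  case less
  show ?case
  proof (cases "b = 0")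
    case False
    have p: "(a - w * b) * (a + w * b) = - (b * b)"
      using less.prems by (simp add: algebra_simps)
    with False assms(1) have "degree (a - w * b) < degree b \<or> degree (a + w * b) < degree b"
      by (intro degree_factors) (auto simp: degree_mult_eq)
    then obtain s :: "'a poly" where s: "s = 1 \<or> s = - 1" and d: "degree (a - s * w * b) < degree b"
      using that[of 1] that[of "- 1"] by auto
    have "s * s = 1"
      using s by auto
    have "(s * w * a - (w * w - 1) * b) * (s * w * a - (w * w - 1) * b)
        = (w * w - 1) * ((a - s * w * b) * (a - s * w * b))"
      using less.prems s by (auto simp: algebra_simps)
    from less.hyps[OF d this] have "a - s * w * b = 0"
      by blast
    then have "(a - w * b) * (a + w * b) = 0"
      using s by auto
    with p False show ?thesis
      by simp
  qed (use less.prems in simp)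
qed

lemma pell_poly_solutions:
  fixes a b w :: "'a::field_char_0 poly"
  assumes "degree w \<ge> 1" "a * a = 1 + (w * w - 1) * (b * b)"
  shows "\<exists>n. (a = pell_x w n \<or> a = - pell_x w n) \<and> (b = pell_y w n \<or> b = - pell_y w n)"
proof -
  have X: "a = pell_x w n \<or> a = - pell_x w n"
    if "a * a = 1 + (w * w - 1) * (b * b)" "b = pell_y w n \<or> b = - pell_y w n" for a b n
  proof -
    have "a * a = pell_x w n * pell_x w n"
      using that by (auto simp: pell_norm)
    then show ?thesis
      by (simp add: square_eq_iff)
  qed
  have "\<exists>n. b = pell_y w n \<or> b = - pell_y w n"
    using assms(2)
  proof (induction "degree b" arbitrary: a b rule: less_induct)
    case less
    have p: "(a - w * b) * (a + w * b) = 1 - b * b"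
      using less.prems by (simp add: algebra_simps)
    consider "b = 0" | "b * b = 1" | "b \<noteq> 0" "b * b \<noteq> 1"
      by blast
    then show ?case
    proof cases
      case 1
      then show ?thesis
        by (intro exI[of _ 0]) auto
    next
      \<comment> \<open>Here the product of the two factors is 0, so \<open>degree_factors\<close>
        does not apply.\<close>
      case 2
      then have "b = 1 \<or> b = - 1"
        by (simp add: square_eq_1_iff)
      then show ?thesis
        by (intro exI[of _ 1]) auto
    next
      case 3
      have "degree (1 - b * b) \<le> 2 * degree b"
        by (intro degree_diff_le) (auto simp: degree_mult_eq 3)
      with 3 p assms(1) have "degree (a - w * b) < degree b \<or> degree (a + w * b) < degree b"
        by (intro degree_factors) auto
      then obtain s :: "'a poly" where s: "s = 1 \<or> s = - 1" and d: "degree (a - s * w * b) < degree b"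
        using that[of 1] that[of "- 1"] by auto
      define a' b' where "a' = s * w * a - (w * w - 1) * b" and "b' = a - s * w * b"
      have N: "a' * a' = 1 + (w * w - 1) * (b' * b')"
        using less.prems s unfolding a'_def b'_def by (auto simp: algebra_simps)
      from less.hyps[OF d[folded b'_def] N] obtain n where n: "b' = pell_y w n \<or> b' = - pell_y w n"
        by blast
      from X[OF N n] have a': "a' = pell_x w n \<or> a' = - pell_x w n" .
      have "b = a' - s * w * b'"
        using s unfolding a'_def b'_def by (auto simp: algebra_simps)
      \<comment> \<open>Up to sign, undoing the descent leads from index \<open>n\<close> to
        \<open>n + 1\<close> if the signs agree; otherwise it leads to \<open>n - 1\<close>, or from
        0 to 1.\<close>
      then have "b = w * pell_y w n + pell_x w n \<or> b = - (w * pell_y w n + pell_x w n) \<or>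
          b = pell_x w n - w * pell_y w n \<or> b = - (pell_x w n - w * pell_y w n)"
        using n a' s by auto
      moreover have "\<exists>m. pell_x w n - w * pell_y w n = pell_y w m \<or> pell_x w n - w * pell_y w n = - pell_y w m"
      proof (cases n)
        case 0
        then show ?thesis
          by (intro exI[of _ 1]) simp
      next
        case (Suc m)
        then show ?thesis
          using pell_back by blast
      qed
      moreover have "w * pell_y w n + pell_x w n = pell_y w (Suc n)"
        by simp
      ultimately show ?thesis
        by (metis minus_minus)
    qed
  qed
  with X[OF assms(2)] show ?thesis
    by blast
qed

section \<open>Linear independence of exponentials over the polynomials\<close>

definition exsum :: "complex poly set \<Rightarrow> (complex poly \<Rightarrow> complex poly) \<Rightarrow> complex \<Rightarrow> complex" where
  "exsum I A z = (\<Sum>q\<in>I. poly (A q) z * exp (poly q z))"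

lemma higher_pderiv_eq_0:
  fixes p :: "complex poly"
  shows "degree p < n \<Longrightarrow> (pderiv ^^ n) p = 0"
proof (induction n arbitrary: p)
  case (Suc n)
  show ?case
  proof (cases "degree p = 0")
    case True
    then have "pderiv p = 0"
      by (simp add: pderiv_eq_0_iff)
    moreover have "(pderiv ^^ n) 0 = (0 :: complex poly)"
      by (induction n) auto
    ultimately show ?thesis
      by (simp add: funpow_swap1)
  next
    case False
    with Suc.prems have "degree (pderiv p) < n"
      by (simp add: degree_pderiv)
    from Suc.IH[OF this] show ?thesis
      by (simp add: funpow_swap1)
  qed
qed simp

text \<open>The left side is the coefficient in the derivative of \<open>p exp h\<close> with
  \<open>h' = r\<close>. For \<open>p \<noteq> 0\<close> it cannot vanish, because
  \<open>p * r\<close> has at least the degree of \<open>p\<close>, while \<open>pderiv p\<close> is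
  0 or of smaller degree.\<close>

lemma pderiv_add_mult_eq_0:
  fixes p r :: "complex poly"
  assumes "pderiv p + p * r = 0" "r \<noteq> 0"
  shows "p = 0"
proof (rule ccontr)
  assume "p \<noteq> 0"
  have "p * r = - pderiv p"
    using assms(1) by (simp add: add_eq_0_iff)
  then have "degree (p * r) = degree p - 1"
    by (simp add: degree_pderiv)
  then have "degree p = 0"
    using \<open>p \<noteq> 0\<close> assms(2) by (simp add: degree_mult_eq)
  then have "pderiv p = 0"
    by (simp add: pderiv_eq_0_iff)
  with assms \<open>p \<noteq> 0\<close> show False
    by simp
qed

text \<open>
  After division by one of the exponentials, repeated differentiation annihilates its coefficient
  but none of the others.
\<close>

lemma exp_independent:
  assumes "finite I" "\<forall>q\<in>I. poly q 0 = 0" "\<And>z. exsum I A z = 0"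
  shows "\<forall>q\<in>I. A q = 0"
  using assms
proof (induction I arbitrary: A rule: finite_induct)
  case (insert q0 I)
  \<comment> \<open>Differentiation of \<open>p exp (q - q0)\<close> acts on the coefficient
    \<open>p\<close> as \<open>T q\<close>.\<close>
  define T where "T q p = pderiv p + p * pderiv (q - q0)" for q p
  have base: "(\<Sum>q\<in>I. poly (A q) z * exp (poly (q - q0) z)) = - poly (A q0) z" for z
  proof -
    have "0 = exsum (insert q0 I) A z * exp (- poly q0 z)"
      by (simp only: insert.prems mult_zero_left)
    also have "\<dots> = (\<Sum>q\<in>I. poly (A q) z * exp (poly (q - q0) z)) + poly (A q0) z"
      using insert.hyps by (simp add: exsum_def distrib_right sum_distrib_right exp_diff exp_minus
          divide_inverse mult.assoc)
    finally show ?thesis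
      by (simp add: add_eq_0_iff2)
  qed
  have iter: "(\<Sum>q\<in>I. poly ((T q ^^ n) (A q)) z * exp (poly (q - q0) z)) = - poly ((pderiv ^^ n) (A q0)) z"
    for n z
  proof (induction n arbitrary: z)
    case (Suc n)
    have "((\<lambda>z. \<Sum>q\<in>I. poly ((T q ^^ n) (A q)) z * exp (poly (q - q0) z)) has_field_derivative
        (\<Sum>q\<in>I. poly ((T q ^^ Suc n) (A q)) z * exp (poly (q - q0) z))) (at z)"
      unfolding T_def
      by (auto intro!: derivative_eq_intros sum.cong simp: algebra_simps pderiv_diff)
    moreover have "((\<lambda>z. - poly ((pderiv ^^ n) (A q0)) z) has_field_derivative
        - poly ((pderiv ^^ Suc n) (A q0)) z) (at z)"
      by (auto intro!: derivative_eq_intros)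
    ultimately show ?case
      unfolding Suc.IH by (rule DERIV_unique)
  qed (use base in simp)
  have "A q = 0" if "q \<in> I" for q
  proof -
    define n where "n = Suc (degree (A q0))"
    have "exsum I (\<lambda>q. (T q ^^ n) (A q)) z = 0" for z
    proof -
      have "exsum I (\<lambda>q. (T q ^^ n) (A q)) z =
          (\<Sum>q\<in>I. poly ((T q ^^ n) (A q)) z * exp (poly (q - q0) z)) * exp (poly q0 z)"
        by (simp add: exsum_def sum_distrib_right exp_diff)
      also have "\<dots> = 0"
        unfolding iter by (simp add: n_def higher_pderiv_eq_0 del: funpow.simps)
      finally show ?thesis .
    qed
    with insert that have T0: "(T q ^^ n) (A q) = 0"
      by (metis insert_iff)
    \<comment> \<open>As all constant terms are 0, distinct exponents do not differ by a constant;
      hence \<open>T q\<close> annihilates only 0.\<close>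
    have "pderiv (q - q0) \<noteq> 0"
    proof
      assume "pderiv (q - q0) = 0"
      then obtain c where "q - q0 = [:c:]"
        by (metis degree_eq_zeroE pderiv_eq_0_iff)
      moreover have "poly (q - q0) 0 = 0"
        using insert.prems(1) that by simp
      ultimately have "q = q0"
        by simp
      with insert.hyps that show False
        by simp
    qed
    then have "p = 0" if "(T q ^^ n) p = 0" for n p
      using that
    proof (induction n)
      case (Suc n)
      then have "T q ((T q ^^ n) p) = 0"
        by simp
      with Suc show ?case
        using pderiv_add_mult_eq_0[of "(T q ^^ n) p"] unfolding T_def by blast
    qed simp
    with T0 show ?thesis
      by blast
  qed
  moreover from this have "poly (A q0) z = 0" for z
    using base[of z] by simp
  then have "A q0 = 0"
    using poly_all_0_iff_0 by blast
  ultimately show ?case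
    by simp
qed simp

text \<open>The constant term of each exponent is moved into the coefficient as the factor
  \<open>exp (poly (q j) 0)\<close>, and terms whose remaining exponents agree are
  collected.\<close>

lemma exp_polys_exsum:
  assumes "f \<in> exp_polys"
  shows "\<exists>I A. finite I \<and> (\<forall>q\<in>I. poly q 0 = 0) \<and> f = exsum I A"
proof -
  obtain n :: nat and p q where f: "f = (\<lambda>z. \<Sum>j=1..n. poly (p j) z * exp (poly (q j) z))"
    using assms by (rule exp_polysE)
  define r where "r j = q j - [:poly (q j) 0:]" for j
  define A where "A s = (\<Sum>j\<in>{j\<in>{1..n}. r j = s}. Polynomial.smult (exp (poly (q j) 0)) (p j))" for s
  have "f z = exsum (r ` {1..n}) A z" for z
  proof -
    have "f z = (\<Sum>j=1..n. poly (Polynomial.smult (exp (poly (q j) 0)) (p j)) z * exp (poly (r j) z))"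
      unfolding f r_def by (intro sum.cong) (auto simp: exp_diff)
    also have "\<dots> = exsum (r ` {1..n}) A z"
      unfolding exsum_def A_def
      by (subst sum.image_gen[of _ _ r]) (auto simp: poly_sum sum_distrib_right intro!: sum.cong)
    finally show ?thesis .
  qed
  then show ?thesis
    by (intro exI[of _ "r ` {1..n}"] exI[of _ A]) (auto simp: r_def fun_eq_iff)
qed

lemma exsum_extend:
  assumes "finite J" "I \<subseteq> J"
  shows "exsum I A = exsum J (\<lambda>q. if q \<in> I then A q else 0)"
proof
  show "exsum I A z = exsum J (\<lambda>q. if q \<in> I then A q else 0) z" for z
    unfolding exsum_def using assms
    by (intro sum.mono_neutral_cong_left) auto
qed

text \<open>The positive cone of a total order on the additive group of polynomials: leading
  coefficients are compared with 0 lexicographically.\<close>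

definition cone :: "complex poly \<Rightarrow> bool" where
  "cone q \<longleftrightarrow> Re (lead_coeff q) > 0 \<or> Re (lead_coeff q) = 0 \<and> Im (lead_coeff q) > 0"

lemma cone_add:
  assumes "cone p" "cone q"
  shows "cone (p + q)"
proof -
  consider "degree p < degree q" | "degree q < degree p" | "degree p = degree q"
    by linarith
  then show ?thesis
  proof cases
    case 3
    then have "Polynomial.coeff (p + q) (degree p) \<noteq> 0"
      using assms by (auto simp: cone_def complex_eq_iff)
    then have "degree (p + q) = degree p"
      using 3 by (metis degree_add_le le_antisym le_degree le_refl)
    with 3 assms show ?thesis
      by (auto simp: cone_def)
  qed (use assms in \<open>auto simp: cone_def degree_add_eq_left degree_add_eq_right coeff_eq_0\<close>)
qed

lemma cone_total: "q \<noteq> 0 \<Longrightarrow> cone q \<or> cone (- q)"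
  using leading_coeff_0_iff[of q] unfolding cone_def by (auto simp: complex_eq_iff)

text \<open>\<open>g\<close> is the maximum of \<open>J\<close> in the order with positive cone
  \<open>C\<close>. It is positive since \<open>q\<close> is, and two elements that are at most
  \<open>g\<close> add up to \<open>g + g\<close> only if both equal \<open>g\<close>.
  \<open>C\<close> is a parameter because the order is reversed if the given exponent is
  negative.\<close>

lemma extreme_element:
  fixes J :: "complex poly set"
  assumes C: "\<And>p q. C p \<Longrightarrow> C q \<Longrightarrow> C (p + q)" "\<And>q. q \<noteq> 0 \<Longrightarrow> C q \<or> C (- q)" "\<not> C 0"
    and "finite J" "q \<in> J" "C q"
  shows "\<exists>g\<in>J. g \<noteq> 0 \<and> (\<forall>q\<in>J. \<forall>r\<in>J. q + r = g + g \<longrightarrow> q = g \<and> r = g)"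
proof -
  have "\<exists>g\<in>J. \<forall>q\<in>J. q = g \<or> C (g - q)" if "finite J" "J \<noteq> {}" for J :: "complex poly set"
    using that
  proof (induction J rule: finite_ne_induct)
    case (insert p J)
    then obtain g where g: "g \<in> J" "\<forall>q\<in>J. q = g \<or> C (g - q)"
      by blast
    with insert.hyps have "p - g \<noteq> 0"
      by auto
    then consider "C (g - p)" | "C (p - g)"
      using C(2)[of "p - g"] by auto
    then show ?case
    proof cases
      case 2
      then have "C (p - q)" if "q \<in> J" for q
        using g that C(1)[OF 2, of "g - q"] by auto
      then show ?thesis
        by auto
    qed (use g in auto)
  qed auto
  from this[of J] assms(4,5) obtain g where g: "g \<in> J" "\<forall>q\<in>J. q = g \<or> C (g - q)"
    by blast
  have "g \<noteq> 0"
  proof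
    assume "g = 0"
    with g(2) assms(5) have "q = 0 \<or> C (- q)"
      by force
    with assms(6) C(1)[of q "- q"] C(3) show False
      by auto
  qed
  moreover have "q = g \<and> r = g" if "q \<in> J" "r \<in> J" "q + r = g + g" for q r
  proof -
    have r: "g - r = - (g - q)"
      using that(3) by (simp add: algebra_simps)
    have "q = g"
    proof (rule ccontr)
      assume "q \<noteq> g"
      with g that(1) have "C (g - q)"
        by blast
      moreover from \<open>q \<noteq> g\<close> r have "r \<noteq> g"
        by auto
      with g that(2) have "C (g - r)"
        by blast
      ultimately have "C ((g - q) + (g - r))"
        by (rule C(1))
      moreover have "(g - q) + (g - r) = 0"
        by (simp add: r)
      ultimately show False
        using C(3) by simp
    qed
    with that(3) show ?thesis
      by simp
  qed
  ultimately show ?thesis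
    using g(1) by blast
qed

text \<open>
  At an extreme nonzero exponent \<open>\<gamma>\<close>, with respect to an ordering of the exponents, the coefficient
  of \<open>exp (2 \<gamma>)\<close> in \<open>X\<^sup>2 - (w\<^sup>2 - 1) Y\<^sup>2\<close> involves only the coefficients of \<open>exp \<gamma>\<close> in \<open>X\<close> and \<open>Y\<close>.
\<close>

lemma pell_exsum:
  assumes "finite I" "\<forall>q\<in>I. poly q 0 = 0" and w: "degree w \<ge> 1"
    and eq: "\<And>z. exsum I A z * exsum I A z
               = c + (poly w z * poly w z - 1) * (exsum I B z * exsum I B z)"
    and "q \<in> I" "q \<noteq> 0"
  shows "A q = 0 \<and> B q = 0"
proof (rule ccontr)
  assume q: "\<not> ?thesis"
  define J where "J = {q\<in>I. A q \<noteq> 0 \<or> B q \<noteq> 0}"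
  have J: "finite J" "J \<subseteq> I" "q \<in> J"
    using assms q by (auto simp: J_def)
  have JI: "exsum I A = exsum J A" "exsum I B = exsum J B"
    unfolding exsum_def using assms(1) by (auto simp: J_def fun_eq_iff intro!: sum.mono_neutral_right)
  have "\<exists>g\<in>J. g \<noteq> 0 \<and> (\<forall>q\<in>J. \<forall>r\<in>J. q + r = g + g \<longrightarrow> q = g \<and> r = g)"
    using cone_total[OF \<open>q \<noteq> 0\<close>]
  proof
    assume "cone q"
    then show ?thesis
      by (intro extreme_element[of cone J q] cone_add cone_total J) (auto simp: cone_def)
  next
    assume "cone (- q)"
    moreover have "cone (- (p + q))" if "cone (- p)" "cone (- q)" for p q
      using cone_add[OF that] by (simp add: add.commute)
    ultimately show ?thesis
      by (intro extreme_element[of "\<lambda>q. cone (- q)" J q] J)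
        (use cone_total in \<open>auto simp: cone_def\<close>)
  qed
  then obtain g where g: "g \<in> J" "g \<noteq> 0" "\<And>q r. q \<in> J \<Longrightarrow> r \<in> J \<Longrightarrow> q + r = g + g \<Longrightarrow> q = g \<and> r = g"
    by blast
  \<comment> \<open>\<open>D s\<close> is the coefficient of \<open>exp s\<close> in
    \<open>X^2 - (w^2 - 1) Y^2 - c\<close>; the exponent 0 is put into \<open>S\<close> for the sake
    of the constant \<open>c\<close>.\<close>
  define S where "S = insert 0 ((\<lambda>(q, r). q + r) ` (J \<times> J))"
  define D where "D s = (\<Sum>(q, r)\<in>{x\<in>J \<times> J. (case x of (q, r) \<Rightarrow> q + r) = s}.
      A q * A r - (w * w - 1) * (B q * B r)) - (if s = 0 then [:c:] else 0)" for s
  have "exsum S D z = 0" for z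
  proof -
    let ?f = "\<lambda>(q, r). poly (A q * A r - (w * w - 1) * (B q * B r)) z * exp (poly (q + r) z)"
    have fS: "finite S" and sub: "(\<lambda>(q, r). q + r) ` (J \<times> J) \<subseteq> S"
      using J by (auto simp: S_def)
    have sq: "exsum J F z * exsum J F z = (\<Sum>(q, r)\<in>J \<times> J. poly (F q * F r) z * exp (poly (q + r) z))"
      for F
      unfolding exsum_def sum_product sum.cartesian_product
      by (intro sum.cong) (auto simp: exp_add)
    have "exsum S D z = (\<Sum>s\<in>S. (\<Sum>x\<in>{x\<in>J \<times> J. (case x of (q, r) \<Rightarrow> q + r) = s}. ?f x)
        - (if s = 0 then c else 0))"
      unfolding exsum_def D_def
      by (intro sum.cong)
        (auto simp: poly_sum sum_distrib_right left_diff_distrib simp del: poly_add intro!: sum.cong)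
    also have "\<dots> = (\<Sum>x\<in>J \<times> J. ?f x) - (\<Sum>s\<in>S. if s = 0 then c else 0)"
      unfolding sum_subtractf using J fS sub by (subst sum.group) auto
    also have "(\<Sum>s\<in>S. if s = 0 then c else 0) = c"
      using fS by (simp add: S_def)
    also have "(\<Sum>x\<in>J \<times> J. ?f x) = exsum J A z * exsum J A z
        - (poly w z * poly w z - 1) * (exsum J B z * exsum J B z)"
      unfolding sq sum_distrib_left sum_subtractf[symmetric]
      by (intro sum.cong) (auto simp: algebra_simps)
    also have "\<dots> - c = 0"
      using eq[of z] by (simp add: JI)
    finally show ?thesis .
  qed
  moreover have "finite S" "\<forall>q\<in>S. poly q 0 = 0"
    using J assms(2) by (force simp: S_def subset_eq)+
  moreover have "g + g \<in> S"
    using g(1) by (force simp: S_def simp del: mult_2 mult_2_right intro: rev_image_eqI[of "(g, g)"])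
  ultimately have "D (g + g) = 0"
    using exp_independent[of S D] by blast
  moreover have "g + g \<noteq> 0"
    using g(2) by (metis mult_2 mult_eq_0_iff zero_neq_numeral)
  moreover have "{x\<in>J \<times> J. (case x of (q, r) \<Rightarrow> q + r) = g + g} = {(g, g)}"
    using g(1,3) by auto
  ultimately have "A g * A g = (w * w - 1) * (B g * B g)"
    by (simp add: D_def)
  from pell_poly_zero[OF w this] g(1) show False
    by (simp add: J_def)
qed

text \<open>The case \<open>c = 1\<close> is the Pell equation; the case \<open>c = 0\<close> later
  shows that \<open>a^2 - (z^2 - 1) b^2\<close> vanishes only for \<open>a = b = 0\<close>.\<close>

lemma pell_exp_polys_poly:
  assumes "X \<in> exp_polys" "Y \<in> exp_polys" and w: "degree w \<ge> 1"
    and eq: "\<And>z. X z * X z = c + (poly w z * poly w z - 1) * (Y z * Y z)"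
  shows "\<exists>a b. X = poly a \<and> Y = poly b \<and> a * a = [:c:] + (w * w - 1) * (b * b)"
proof -
  obtain I A where I: "finite I" "\<forall>q\<in>I. poly q 0 = 0" "X = exsum I A"
    using exp_polys_exsum[OF assms(1)] by blast
  obtain J B where J: "finite J" "\<forall>q\<in>J. poly q 0 = 0" "Y = exsum J B"
    using exp_polys_exsum[OF assms(2)] by blast
  define K where "K = insert 0 (I \<union> J)"
  define A' where "A' q = (if q \<in> I then A q else 0)" for q
  define B' where "B' q = (if q \<in> J then B q else 0)" for q
  have K: "finite K" "\<forall>q\<in>K. poly q 0 = 0" "0 \<in> K"
    using I J by (auto simp: K_def)
  have X: "X = exsum K A'" and Y: "Y = exsum K B'"
    unfolding I(3) J(3) A'_def B'_def by (rule exsum_extend; use K in \<open>auto simp: K_def\<close>)+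
  have "A' q = 0 \<and> B' q = 0" if "q \<in> K" "q \<noteq> 0" for q
    by (rule pell_exsum[OF K(1,2) w _ that]) (use eq in \<open>simp add: X Y\<close>)
  then have "exsum K A' z = poly (A' 0) z" "exsum K B' z = poly (B' 0) z" for z
    unfolding exsum_def by (subst sum.remove[OF K(1,3)]; simp)+
  then have XY: "X = poly (A' 0)" "Y = poly (B' 0)"
    by (auto simp: X Y)
  have "A' 0 * A' 0 = [:c:] + (w * w - 1) * (B' 0 * B' 0)"
    using eq by (subst poly_eq_poly_eq_iff[symmetric]) (auto simp: XY fun_eq_iff)
  with XY show ?thesis
    by blast
qed

lemma pell_exp_polys:
  assumes "X \<in> exp_polys" "Y \<in> exp_polys" "degree w \<ge> 1"
    and "\<And>z. X z * X z = 1 + (poly w z * poly w z - 1) * (Y z * Y z)"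
  obtains n where "X = poly (pell_x w n) \<or> X = poly (- pell_x w n)" "Y = poly (pell_y w n) \<or> Y = poly (- pell_y w n)"
proof -
  obtain a b where ab: "X = poly a" "Y = poly b" "a * a = [:1:] + (w * w - 1) * (b * b)"
    using pell_exp_polys_poly[OF assms] by blast
  then obtain n where "a = pell_x w n \<or> a = - pell_x w n" "b = pell_y w n \<or> b = - pell_y w n"
    using pell_poly_solutions[OF assms(3), of a b] by (auto simp: one_pCons)
  with ab that show thesis
    by blast
qed

lemma pell_exp_polys_zero:
  assumes "X \<in> exp_polys" "Y \<in> exp_polys" "degree w \<ge> 1"
    and "\<And>z. X z * X z = (poly w z * poly w z - 1) * (Y z * Y z)"
  shows "X = (\<lambda>z. 0) \<and> Y = (\<lambda>z. 0)"
proof -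
  obtain a b where "X = poly a" "Y = poly b" "a * a = [:0:] + (w * w - 1) * (b * b)"
    using pell_exp_polys_poly[OF assms(1-3), of 0] assms(4) by auto
  with pell_poly_zero[OF assms(3), of a b] show ?thesis
    by (auto simp: fun_eq_iff)
qed

section \<open>Diophantine predicates over a ring\<close>

text \<open>Polynomial functions with coefficients in Z[c]: \<open>c\<close> is 0 over the integers
  and the function \<open>z\<close> over a ring of exponential polynomials. Assignments are infinite
  sequences, so that no number of variables has to be recorded.\<close>

inductive pol :: "'a::comm_ring_1 \<Rightarrow> ((nat \<Rightarrow> 'a) \<Rightarrow> 'a) \<Rightarrow> bool" for c where
  pol_one: "pol c (\<lambda>x. 1)"
| pol_minus_one: "pol c (\<lambda>x. - 1)"
| pol_param: "pol c (\<lambda>x. c)"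
| pol_var: "pol c (\<lambda>x. x i)"
| pol_add: "pol c p \<Longrightarrow> pol c q \<Longrightarrow> pol c (\<lambda>x. p x + q x)"
| pol_mult: "pol c p \<Longrightarrow> pol c q \<Longrightarrow> pol c (\<lambda>x. p x * q x)"

lemma pol_minus: "pol c p \<Longrightarrow> pol c (\<lambda>x. - p x)"
  using pol_mult[OF pol_minus_one, of c p] by simp

lemma pol_diff: "pol c p \<Longrightarrow> pol c q \<Longrightarrow> pol c (\<lambda>x. p x - q x)"
  using pol_add[OF _ pol_minus, of c p q] by simp

lemma pol_of_nat: "pol c (\<lambda>x. of_nat n)"
proof (induction n)
  case 0
  show ?case
    using pol_diff[OF pol_one pol_one, of c] by simp
next
  case (Suc n)
  show ?case
    using pol_add[OF pol_one Suc] by simp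
qed

lemma pol_zero: "pol c (\<lambda>x. 0)"
  using pol_of_nat[of c 0] by simp

lemmas pol_intros = pol_one pol_zero pol_param pol_var pol_add pol_mult pol_minus pol_diff

lemma pol_rename: "pol c p \<Longrightarrow> pol c (\<lambda>x. p (\<lambda>i. x (r i)))"
  by (induction rule: pol.induct) (auto intro: pol.intros)

lemma pol_depends: "pol c p \<Longrightarrow> \<exists>m. \<forall>x y. (\<forall>i<m. x i = y i) \<longrightarrow> p x = p y"
proof (induction rule: pol.induct)
  case (pol_var i)
  then show ?case
    by (intro exI[of _ "Suc i"]) auto
next
  case (pol_add p q)
  then obtain m n where "\<forall>x y. (\<forall>i<m. x i = y i) \<longrightarrow> p x = p y" "\<forall>x y. (\<forall>i<n. x i = y i) \<longrightarrow> q x = q y"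
    by blast
  then show ?case
    by (intro exI[of _ "max m n"]) (metis less_max_iff_disj)
next
  case (pol_mult p q)
  then obtain m n where "\<forall>x y. (\<forall>i<m. x i = y i) \<longrightarrow> p x = p y" "\<forall>x y. (\<forall>i<n. x i = y i) \<longrightarrow> q x = q y"
    by blast
  then show ?case
    by (intro exI[of _ "max m n"]) (metis less_max_iff_disj)
qed auto

text \<open>Parameters occupy the even positions and witnesses the odd ones.\<close>

definition join :: "(nat \<Rightarrow> 'a) \<Rightarrow> (nat \<Rightarrow> 'a) \<Rightarrow> nat \<Rightarrow> 'a" where
  "join x y i = (if even i then x (i div 2) else y (i div 2))"

lemma join_simps [simp]: "join x y (2 * i) = x i" "join x y (Suc (2 * i)) = y i"
  by (auto simp: join_def)

lemma join_in: "(\<forall>i. x i \<in> U) \<Longrightarrow> (\<forall>i. y i \<in> U) \<Longrightarrow> join x y i \<in> U"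
  by (simp add: join_def)

text \<open>\<open>K\<close> contains the values of polynomials and \<open>U\<close> is the range of
  the variables. They differ over the natural numbers, where the values are integers.\<close>

locale diophantine =
  fixes K U :: "'a::comm_ring_1 set" and c :: 'a
  assumes K: "1 \<in> K" "- 1 \<in> K" "c \<in> K" "U \<subseteq> K" "U \<noteq> {}"
    and K_add: "\<And>a b. a \<in> K \<Longrightarrow> b \<in> K \<Longrightarrow> a + b \<in> K"
    and K_mult: "\<And>a b. a \<in> K \<Longrightarrow> b \<in> K \<Longrightarrow> a * b \<in> K"
    and anisotropic: "\<And>a b. a \<in> K \<Longrightarrow> b \<in> K \<Longrightarrow> a * a = (c * c - 1) * (b * b) \<Longrightarrow> a = 0 \<and> b = 0"
begin

text \<open>
  Conjunctions are expressed by \<open>a\<^sup>2 - (c\<^sup>2 - 1) b\<^sup>2 = 0\<close>. With \<open>c = 0\<close> this is a sum of two squares,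
  with \<open>c = z\<close> it is the norm form of the Pell equation.
\<close>

definition dio :: "((nat \<Rightarrow> 'a) \<Rightarrow> bool) \<Rightarrow> bool" where
  "dio T \<longleftrightarrow> (\<exists>p. pol c p \<and>
     (\<forall>x. (\<forall>i. x i \<in> U) \<longrightarrow> (T x \<longleftrightarrow> (\<exists>y. (\<forall>i. y i \<in> U) \<and> p (join x y) = 0))))"

lemma pol_in: "pol c p \<Longrightarrow> \<forall>i. x i \<in> U \<Longrightarrow> p x \<in> K"
  by (induction rule: pol.induct) (use K in \<open>auto intro: K_add K_mult\<close>)

lemma dio_cong:
  assumes "dio S" "\<And>x. \<forall>i. x i \<in> U \<Longrightarrow> S x \<longleftrightarrow> T x"
  shows "dio T"
  using assms unfolding dio_def by metis

lemma dio_zero: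
  assumes "pol c p"
  shows "dio (\<lambda>x. p x = 0)"
  unfolding dio_def
proof (intro exI conjI allI impI)
  show "pol c (\<lambda>x. p (\<lambda>i. x (2 * i)))"
    using assms by (rule pol_rename)
qed (use K in auto)

lemma dio_eq: "pol c p \<Longrightarrow> pol c q \<Longrightarrow> dio (\<lambda>x. p x = q x)"
  using dio_zero[of "\<lambda>x. p x - q x"] by (simp add: pol_diff)

lemma dio_rename:
  assumes "dio T"
  shows "dio (\<lambda>x. T (\<lambda>i. x (r i)))"
proof -
  obtain p where p: "pol c p" "\<And>x. \<forall>i. x i \<in> U \<Longrightarrow> T x \<longleftrightarrow> (\<exists>y. (\<forall>i. y i \<in> U) \<and> p (join x y) = 0)"
    using assms unfolding dio_def by blast
  have "join (\<lambda>i. x (r i)) y = (\<lambda>i. join x y (if even i then 2 * r (i div 2) else i))" for x y :: "nat \<Rightarrow> 'a"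
    by (auto simp: join_def)
  then show ?thesis
    unfolding dio_def using pol_rename[OF p(1), of "\<lambda>i. if even i then 2 * r (i div 2) else i"] p(2)
    by (intro exI[of _ "\<lambda>x. p (\<lambda>i. x (if even i then 2 * r (i div 2) else i))"]) auto
qed

text \<open>Two sequences of witnesses share one: entry \<open>j\<close> of \<open>y1\<close> stands
  at position \<open>4 * j + 1\<close> and that of \<open>y2\<close> at
  \<open>4 * j + 3\<close>.\<close>

lemma join_join:
  "join x y1 = (\<lambda>i. join x (join y1 y2) (if even i then i else 2 * i - 1))"
  "join x y2 = (\<lambda>i. join x (join y1 y2) (if even i then i else 2 * i + 1))"
proof -
  have "join x y1 i = join x (join y1 y2) (if even i then i else 2 * i - 1) \<and>
      join x y2 i = join x (join y1 y2) (if even i then i else 2 * i + 1)" for i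
  proof (cases "even i")
    case False
    then obtain j where j: "i = Suc (2 * j)"
      by (elim oddE) simp
    have "2 * i - 1 = Suc (2 * (2 * j))" "2 * i + 1 = Suc (2 * Suc (2 * j))"
      by (simp_all add: j)
    with False show ?thesis
      unfolding j by (simp only: if_False join_simps simp_thms)
  qed (simp add: join_def)
  then show
    "join x y1 = (\<lambda>i. join x (join y1 y2) (if even i then i else 2 * i - 1))"
    "join x y2 = (\<lambda>i. join x (join y1 y2) (if even i then i else 2 * i + 1))"
    by blast+
qed

text \<open>Common to conjunction and disjunction: \<open>P\<close> is the connective and
  \<open>r\<close> the operation whose zeros express it. The hypothesis on \<open>P\<close> pulls
  out both existential quantifiers; for a disjunction this needs a nonempty
  \<open>Y\<close>.\<close>

lemma dio_combine:
  assumes "dio S" "dio T" and r: "\<And>p q. pol c p \<Longrightarrow> pol c q \<Longrightarrow> pol c (\<lambda>x. r (p x) (q x))"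
    and R: "\<And>x. \<forall>i. x i \<in> U \<Longrightarrow> R x \<longleftrightarrow> P (S x) (T x)"
    and P: "\<And>Y p q. Y \<noteq> {} \<Longrightarrow>
        P (\<exists>y\<in>Y. p y = (0::'a)) (\<exists>y\<in>Y. q y = (0::'a)) \<longleftrightarrow>
        (\<exists>y1\<in>Y. \<exists>y2\<in>Y. P (p (y1 :: nat \<Rightarrow> 'a) = 0) (q y2 = 0))"
    and PK: "\<And>a b. a \<in> K \<Longrightarrow> b \<in> K \<Longrightarrow> P (a = 0) (b = 0) \<longleftrightarrow> r a b = 0"
  shows "dio R"
proof -
  obtain p where p: "pol c p" "\<And>x. \<forall>i. x i \<in> U \<Longrightarrow> S x \<longleftrightarrow> (\<exists>y. (\<forall>i. y i \<in> U) \<and> p (join x y) = 0)"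
    using assms(1) unfolding dio_def by blast
  obtain q where q: "pol c q" "\<And>x. \<forall>i. x i \<in> U \<Longrightarrow> T x \<longleftrightarrow> (\<exists>y. (\<forall>i. y i \<in> U) \<and> q (join x y) = 0)"
    using assms(2) unfolding dio_def by blast
  define p' where "p' x = p (\<lambda>i. x (if even i then i else 2 * i - 1))" for x
  define q' where "q' x = q (\<lambda>i. x (if even i then i else 2 * i + 1))" for x
  define Y :: "(nat \<Rightarrow> 'a) set" where "Y = {y. \<forall>i. y i \<in> U}"
  obtain u where "u \<in> U"
    using K(5) by blast
  then have "(\<lambda>i. u) \<in> Y"
    by (simp add: Y_def)
  then have "Y \<noteq> {}"
    by blast
  have "pol c p'" "pol c q'"
    unfolding p'_def q'_def by (rule pol_rename, rule p(1), rule pol_rename, rule q(1))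
  then have "pol c (\<lambda>x. r (p' x) (q' x))"
    by (rule r)
  moreover have "R x \<longleftrightarrow> (\<exists>y. (\<forall>i. y i \<in> U) \<and> r (p' (join x y)) (q' (join x y)) = 0)"
    if x: "\<forall>i. x i \<in> U" for x
  proof -
    have p'q': "p' (join x (join y1 y2)) = p (join x y1)" "q' (join x (join y1 y2)) = q (join x y2)"
      for y1 y2
      unfolding p'_def q'_def by (simp_all only: join_join[where x = x and ?y1.0 = y1 and ?y2.0 = y2, symmetric])
    have S: "S x \<longleftrightarrow> (\<exists>y\<in>Y. p (join x y) = 0)" and T: "T x \<longleftrightarrow> (\<exists>y\<in>Y. q (join x y) = 0)"
      unfolding p(2)[OF x] q(2)[OF x] by (auto simp: Y_def)
    have "R x \<longleftrightarrow> (\<exists>y1\<in>Y. \<exists>y2\<in>Y. P (p (join x y1) = 0) (q (join x y2) = 0))"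
      unfolding R[OF x] S T by (rule P[OF \<open>Y \<noteq> {}\<close>])
    also have "\<dots> \<longleftrightarrow> (\<exists>y1\<in>Y. \<exists>y2\<in>Y. r (p (join x y1)) (q (join x y2)) = 0)"
    proof (intro bex_cong refl PK)
      show "p (join x y) \<in> K" "q (join x y) \<in> K" if "y \<in> Y" for y
        using that x pol_in[OF p(1)] pol_in[OF q(1)] by (simp_all add: Y_def join_in)
    qed
    also have "\<dots> \<longleftrightarrow> (\<exists>y\<in>Y. r (p' (join x y)) (q' (join x y)) = 0)"
    proof (intro iffI; elim bexE)
      fix y1 y2
      assume "y1 \<in> Y" "y2 \<in> Y" "r (p (join x y1)) (q (join x y2)) = 0"
      then show "\<exists>y\<in>Y. r (p' (join x y)) (q' (join x y)) = 0"
        by (intro bexI[of _ "join y1 y2"]) (auto simp: Y_def join_in p'q')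
    next
      fix y
      assume y: "y \<in> Y" and 0: "r (p' (join x y)) (q' (join x y)) = 0"
      define y1 y2 where "y1 i = y (2 * i)" and "y2 i = y (2 * i + 1)" for i
      have "y = join y1 y2"
        by (auto simp: join_def y1_def y2_def fun_eq_iff)
      with 0 have "r (p (join x y1)) (q (join x y2)) = 0"
        by (simp add: p'q')
      moreover have "y1 \<in> Y" "y2 \<in> Y"
        using y by (auto simp: Y_def y1_def y2_def)
      ultimately show "\<exists>y1\<in>Y. \<exists>y2\<in>Y. r (p (join x y1)) (q (join x y2)) = 0"
        by blast
    qed
    finally show ?thesis
      by (simp add: Y_def)
  qed
  ultimately show ?thesis
    unfolding dio_def by (intro exI[of _ "\<lambda>x. r (p' x) (q' x)"]) blast
qed

lemma dio_conj:
  assumes "dio S" "dio T"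
  shows "dio (\<lambda>x. S x \<and> T x)"
proof (rule dio_combine[where r = "\<lambda>a b. a * a - (c * c - 1) * (b * b)" and P = "(\<and>)", OF assms])
  show "pol c (\<lambda>x. p x * p x - (c * c - 1) * (q x * q x))" if "pol c p" "pol c q" for p q
    using that by (intro pol_intros)
qed (auto dest: anisotropic)

lemma dio_disj:
  assumes "\<And>a b. a \<in> K \<Longrightarrow> b \<in> K \<Longrightarrow> a * b = 0 \<Longrightarrow> a = 0 \<or> b = 0"
    and "dio S" "dio T"
  shows "dio (\<lambda>x. S x \<or> T x)"
  by (rule dio_combine[where r = "\<lambda>a b. a * b" and P = "(\<or>)", OF assms(2,3)])
    (auto intro: pol_mult dest: assms(1))

lemma dio_ex:
  assumes "dio T"
  shows "dio (\<lambda>x. \<exists>a\<in>U. T (case_nat a x))"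
proof -
  obtain p where p: "pol c p" "\<And>x. \<forall>i. x i \<in> U \<Longrightarrow> T x \<longleftrightarrow> (\<exists>y. (\<forall>i. y i \<in> U) \<and> p (join x y) = 0)"
    using assms unfolding dio_def by blast
  \<comment> \<open>The bound value becomes witness 0, at position 1; the old variable
    \<open>Suc j\<close> is the new parameter \<open>j\<close>, at \<open>2 * j\<close>; the old
    witnesses move up by two positions.\<close>
  define r where "r i = (if even i then case i div 2 of 0 \<Rightarrow> 1 | Suc j \<Rightarrow> 2 * j else i + 2)" for i
  have r: "join (case_nat a x) y = (\<lambda>i. join x (case_nat a y) (r i))" for a and x y :: "nat \<Rightarrow> 'a"
  proof
    fix i
    show "join (case_nat a x) y i = join x (case_nat a y) (r i)"
    proof (cases "even i")
      case True
      then obtain j where "i = 2 * j" ..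
      then show ?thesis
        by (cases j) (simp_all add: r_def join_def)
    qed (simp add: r_def join_def)
  qed
  have "(\<exists>a\<in>U. T (case_nat a x)) \<longleftrightarrow> (\<exists>y. (\<forall>i. y i \<in> U) \<and> p (\<lambda>i. join x y (r i)) = 0)"
    if x: "\<forall>i. x i \<in> U" for x
  proof
    assume "\<exists>a\<in>U. T (case_nat a x)"
    then obtain a where a: "a \<in> U" "T (case_nat a x)"
      by blast
    then obtain y where "\<forall>i. y i \<in> U" "p (join (case_nat a x) y) = 0"
      using p(2)[of "case_nat a x"] x by (auto split: nat.split)
    then show "\<exists>y. (\<forall>i. y i \<in> U) \<and> p (\<lambda>i. join x y (r i)) = 0"
      using a(1) by (intro exI[of _ "case_nat a y"]) (auto simp: r split: nat.split)
  next
    assume "\<exists>y. (\<forall>i. y i \<in> U) \<and> p (\<lambda>i. join x y (r i)) = 0"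
    then obtain y where y: "\<forall>i. y i \<in> U" "p (\<lambda>i. join x y (r i)) = 0"
      by blast
    have "y = case_nat (y 0) (\<lambda>i. y (Suc i))"
      by (auto simp: fun_eq_iff split: nat.split)
    with y(2) have "p (join (case_nat (y 0) x) (\<lambda>i. y (Suc i))) = 0"
      by (simp add: r)
    then show "\<exists>a\<in>U. T (case_nat a x)"
      using p(2)[of "case_nat (y 0) x"] x y(1) by (intro bexI[of _ "y 0"]) (auto split: nat.split)
  qed
  with pol_rename[OF p(1), of r] show ?thesis
    unfolding dio_def by blast
qed

end

section \<open>Diophantine predicates over the natural numbers\<close>

interpretation Nat: diophantine UNIV "range int" 0
proof
  fix a b :: int
  assume "a * a = (0 * 0 - 1) * (b * b)"
  then have "a * a + b * b = 0"
    by simp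
  then show "a = 0 \<and> b = 0"
    by (simp add: sum_squares_eq_zero_iff)
qed auto

text \<open>Kept apart from the exponential Diophantine predicates: a bounded quantifier is removed
  only in front of polynomial predicates, since the argument reduces them modulo integers.\<close>

definition pdio :: "((nat \<Rightarrow> nat) \<Rightarrow> bool) \<Rightarrow> bool" where
  "pdio S \<longleftrightarrow> Nat.dio (\<lambda>x. S (\<lambda>i. nat (x i)))"

definition npol :: "((nat \<Rightarrow> nat) \<Rightarrow> nat) \<Rightarrow> bool" where
  "npol t \<longleftrightarrow> (\<exists>p. pol 0 p \<and> (\<forall>e. p (\<lambda>i. int (e i)) = int (t e)))"

lemma npol_var: "npol (\<lambda>e. e i)"
  unfolding npol_def by (intro exI[of _ "\<lambda>x. x i"]) (auto intro: pol_intros)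

lemma npol_const: "npol (\<lambda>e. n)"
  unfolding npol_def by (intro exI[of _ "\<lambda>x. of_nat n"]) (auto intro: pol_of_nat)

lemma npol_add: "npol s \<Longrightarrow> npol t \<Longrightarrow> npol (\<lambda>e. s e + t e)"
  unfolding npol_def
  by (elim exE conjE, rule exI, rule conjI, rule pol_add, assumption, assumption) simp

lemma npol_mult: "npol s \<Longrightarrow> npol t \<Longrightarrow> npol (\<lambda>e. s e * t e)"
  unfolding npol_def
  by (elim exE conjE, rule exI, rule conjI, rule pol_mult, assumption, assumption) simp

lemma pdio_iff:
  "pdio S \<longleftrightarrow> (\<exists>p. pol 0 p \<and>
     (\<forall>e. S e \<longleftrightarrow> (\<exists>y. p (join (\<lambda>i. int (e i)) (\<lambda>i. int (y i))) = 0)))"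
proof -
  have range: "(\<forall>i. x i \<in> range int) \<longleftrightarrow> (\<exists>e. x = (\<lambda>i. int (e i)))" for x :: "nat \<Rightarrow> int"
  proof
    assume x: "\<forall>i. x i \<in> range int"
    have "x i = int (nat (x i))" for i
      using x[rule_format, of i] by auto
    then show "\<exists>e. x = (\<lambda>i. int (e i))"
      by (intro exI[of _ "\<lambda>i. nat (x i)"] ext)
  qed auto
  have ex: "(\<exists>y. (\<exists>e. y = (\<lambda>i. int (e i))) \<and> Q y) \<longleftrightarrow> (\<exists>e. Q (\<lambda>i. int (e i)))"
    and all: "(\<forall>y. (\<exists>e. y = (\<lambda>i. int (e i))) \<longrightarrow> Q y) \<longleftrightarrow> (\<forall>e. Q (\<lambda>i. int (e i)))"
    for Q :: "(nat \<Rightarrow> int) \<Rightarrow> bool"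
    by blast+
  show ?thesis
    unfolding pdio_def Nat.dio_def range ex all by simp
qed

lemma pdio_eq:
  assumes "npol s" "npol t"
  shows "pdio (\<lambda>e. s e = t e)"
proof -
  obtain p q where "pol 0 p" "pol 0 q" "\<And>e. p (\<lambda>i. int (e i)) = int (s e)" "\<And>e. q (\<lambda>i. int (e i)) = int (t e)"
    using assms unfolding npol_def by blast
  note pq = this
  have "p x = int (s (\<lambda>i. nat (x i)))" "q x = int (t (\<lambda>i. nat (x i)))" if "\<forall>i. x i \<in> range int" for x
  proof -
    have "x i = int (nat (x i))" for i
      using that[rule_format, of i] by auto
    then have "x = (\<lambda>i. int (nat (x i)))"
      by (rule ext)
    from arg_cong[OF this, of p] arg_cong[OF this, of q]
    show "p x = int (s (\<lambda>i. nat (x i)))" "q x = int (t (\<lambda>i. nat (x i)))"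
      by (simp_all only: pq)
  qed
  with Nat.dio_cong[OF Nat.dio_eq[OF pq(1,2)]] show ?thesis
    unfolding pdio_def by simp
qed

lemma pdio_conj: "pdio S \<Longrightarrow> pdio T \<Longrightarrow> pdio (\<lambda>e. S e \<and> T e)"
  unfolding pdio_def by (rule Nat.dio_conj)

lemma pdio_disj: "pdio S \<Longrightarrow> pdio T \<Longrightarrow> pdio (\<lambda>e. S e \<or> T e)"
  unfolding pdio_def by (rule Nat.dio_disj) auto

lemma pdio_ex:
  assumes "pdio (\<lambda>e. S (e 0) (\<lambda>i. e (Suc i)))"
  shows "pdio (\<lambda>e. \<exists>n. S n e)"
  using Nat.dio_ex[OF assms[unfolded pdio_def]] unfolding pdio_def by simp

section \<open>Exponential Diophantine predicates\<close>

text \<open>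
  Variables are numbered in the manner of de Bruijn: \<open>e i\<close> is the value of the \<open>i\<close>-th variable, and
  quantifiers bind variable 0. The rule \<open>ED_pell\<close> shifts the base by 2 so that it exceeds 1.
\<close>

inductive ED :: "((nat \<Rightarrow> nat) \<Rightarrow> bool) \<Rightarrow> bool" where
  ED_one: "ED (\<lambda>e. e 0 = 1)"
| ED_plus: "ED (\<lambda>e. e 0 = e 1 + e 2)"
| ED_times: "ED (\<lambda>e. e 0 = e 1 * e 2)"
| ED_power2: "ED (\<lambda>e. e 0 = 2 ^ e 1)"
| ED_pell: "ED (\<lambda>e. int (e 0) = pell_x (int (e 2) + 2) (e 3) \<and> int (e 1) = pell_y (int (e 2) + 2) (e 3))"
| ED_conj: "ED S \<Longrightarrow> ED T \<Longrightarrow> ED (\<lambda>e. S e \<and> T e)"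
| ED_ex: "ED S \<Longrightarrow> ED (\<lambda>e. \<exists>n. S (case_nat n e))"
| ED_rename: "ED S \<Longrightarrow> ED (\<lambda>e. S (\<lambda>i. e (r i)))"

lemma ED_exI: "ED (\<lambda>e. S (e 0) (\<lambda>i. e (Suc i))) \<Longrightarrow> ED (\<lambda>e. \<exists>n. S n e)"
  using ED_ex[of "\<lambda>e. S (e 0) (\<lambda>i. e (Suc i))"] by simp

lemma ED_all_less:
  fixes m :: nat
  assumes "\<And>i. i < m \<Longrightarrow> ED (S i)"
  shows "ED (\<lambda>e. \<forall>i<m. S i e)"
  using assms
proof (induction m)
  case 0
  have "ED (\<lambda>e. \<exists>n. n = (1::nat))"
    by (rule ED_exI) (rule ED_one)
  then show ?case
    by simp
next
  case (Suc m)
  then show ?case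
    by (auto simp: less_Suc_eq all_conj_distrib imp_disjL intro!: ED_conj)
qed

lemma ED_exs:
  assumes "ED S"
  shows "ED (\<lambda>e. \<exists>a. S (\<lambda>i. if i < m then a i else e (i - m)))"
proof (induction m)
  case (Suc m)
  have "(\<exists>n a. S (\<lambda>i. if i < m then a i else case_nat n e (i - m))) \<longleftrightarrow>
      (\<exists>a. S (\<lambda>i. if i < Suc m then a i else e (i - Suc m)))" for e
  proof (intro iffI; elim exE)
    fix n a
    assume "S (\<lambda>i. if i < m then a i else case_nat n e (i - m))"
    moreover have "(\<lambda>i. if i < m then a i else case_nat n e (i - m))
        = (\<lambda>i. if i < Suc m then (a(m := n)) i else e (i - Suc m))"
      by (auto simp: fun_eq_iff split: nat.split intro!: arg_cong[where f = e])
    ultimately have "S (\<lambda>i. if i < Suc m then (a(m := n)) i else e (i - Suc m))"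
      by simp
    then show "\<exists>a. S (\<lambda>i. if i < Suc m then a i else e (i - Suc m))"
      by blast
  next
    fix a
    assume "S (\<lambda>i. if i < Suc m then a i else e (i - Suc m))"
    moreover have "(\<lambda>i. if i < Suc m then a i else e (i - Suc m))
        = (\<lambda>i. if i < m then a i else case_nat (a m) e (i - m))"
      by (auto simp: fun_eq_iff less_Suc_eq split: nat.split intro!: arg_cong[where f = e])
    ultimately have "S (\<lambda>i. if i < m then a i else case_nat (a m) e (i - m))"
      by simp
    then show "\<exists>n a. S (\<lambda>i. if i < m then a i else case_nat n e (i - m))"
      by blast
  qed
  with ED_ex[OF Suc] show ?case
    by simp
qed (use assms in simp)

definition EF :: "((nat \<Rightarrow> nat) \<Rightarrow> nat) \<Rightarrow> bool" where
  "EF f \<longleftrightarrow> ED (\<lambda>e. e 0 = f (\<lambda>i. e (Suc i)))"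

lemma EF_rename: "EF f \<Longrightarrow> EF (\<lambda>e. f (\<lambda>i. e (r i)))"
  unfolding EF_def by (drule ED_rename[where r = "case_nat 0 (\<lambda>i. Suc (r i))"]) simp

text \<open>The values of the \<open>g i\<close> are quantified existentially and tied to their
  graphs.\<close>

lemma ED_subst:
  assumes "ED S" "\<And>i. i < m \<Longrightarrow> EF (g i)"
  shows "ED (\<lambda>e. S (\<lambda>i. if i < m then g i e else e (i - m)))"
proof -
  have "ED (\<lambda>e. e i = g i (\<lambda>j. e (j + m)))" if "i < m" for i
    using ED_rename[OF assms(2)[OF that, unfolded EF_def], of "case_nat i (\<lambda>j. j + m)"] by simp
  then have "ED (\<lambda>e. (\<forall>i<m. e i = g i (\<lambda>j. e (j + m))) \<and> S e)"
    by (intro ED_conj ED_all_less assms(1))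
  from ED_exs[OF this, of m]
  have "ED (\<lambda>e. \<exists>a. (\<forall>i<m. a i = g i e) \<and> S (\<lambda>i. if i < m then a i else e (i - m)))"
    by simp
  moreover have "(\<exists>a. (\<forall>i<m. a i = g i e) \<and> S (\<lambda>i. if i < m then a i else e (i - m))) \<longleftrightarrow>
      S (\<lambda>i. if i < m then g i e else e (i - m))" for e
  proof
    assume "\<exists>a. (\<forall>i<m. a i = g i e) \<and> S (\<lambda>i. if i < m then a i else e (i - m))"
    then obtain a where a: "\<forall>i<m. a i = g i e" "S (\<lambda>i. if i < m then a i else e (i - m))"
      by blast
    from a(1) have "(\<lambda>i. if i < m then a i else e (i - m)) = (\<lambda>i. if i < m then g i e else e (i - m))"
      by auto
    with a(2) show "S (\<lambda>i. if i < m then g i e else e (i - m))"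
      by simp
  qed (auto intro: exI[of _ "\<lambda>i. g i e"])
  ultimately show ?thesis
    by simp
qed

lemma ED_subst2:
  assumes "ED (\<lambda>e. P (e 0) (e 1))" "EF f" "EF g"
  shows "ED (\<lambda>e. P (f e) (g e))"
  using ED_subst[OF assms(1), of 2 "\<lambda>i. if i = 0 then f else g"] assms(2,3) by simp

lemma ED_subst3:
  assumes "ED (\<lambda>e. P (e 0) (e 1) (e 2))" "EF f" "EF g" "EF h"
  shows "ED (\<lambda>e. P (f e) (g e) (h e))"
  using ED_subst[OF assms(1), of 3 "\<lambda>i. if i = 0 then f else if i = 1 then g else h"] assms(2-)
  by simp

lemma ED_subst4:
  assumes "ED (\<lambda>e. P (e 0) (e 1) (e 2) (e 3))" "EF f" "EF g" "EF h" "EF k"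
  shows "ED (\<lambda>e. P (f e) (g e) (h e) (k e))"
  using ED_subst[OF assms(1), of 4
      "\<lambda>i. if i = 0 then f else if i = 1 then g else if i = 2 then h else k"] assms(2-)
  by simp

lemma EF_var: "EF (\<lambda>e. e i)"
proof -
  \<comment> \<open>Equality is not among the rules of \<open>ED\<close>; it is obtained as
    multiplication by a variable with value 1.\<close>
  have "ED (\<lambda>e. e 0 = 1 \<and> e 1 = e (i + 2) * e 0)"
    using ED_conj[OF ED_one ED_rename[OF ED_times, of "\<lambda>j. if j = 0 then 1 else if j = 1 then i + 2 else 0"]]
    by simp
  from ED_exI[of "\<lambda>n e. n = 1 \<and> e 0 = e (i + 1) * n"] this show ?thesis
    by (simp add: EF_def)
qed

lemma EF_op1:
  assumes "ED (\<lambda>e. e 0 = h (e 1))" "EF f"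
  shows "EF (\<lambda>e. h (f e))"
  unfolding EF_def
  by (rule ED_subst2[of "\<lambda>a b. a = h b"])
    (rule assms(1), rule EF_var, rule EF_rename, rule assms(2))

lemma EF_op2:
  assumes "ED (\<lambda>e. e 0 = h (e 1) (e 2))" "EF f" "EF g"
  shows "EF (\<lambda>e. h (f e) (g e))"
  unfolding EF_def
  by (rule ED_subst3[of "\<lambda>a b c. a = h b c"])
    (rule assms(1), rule EF_var, rule EF_rename, rule assms(2), rule EF_rename, rule assms(3))

lemma EF_add: "EF f \<Longrightarrow> EF g \<Longrightarrow> EF (\<lambda>e. f e + g e)"
  by (rule EF_op2[OF ED_plus])

lemma EF_mult: "EF f \<Longrightarrow> EF g \<Longrightarrow> EF (\<lambda>e. f e * g e)"
  by (rule EF_op2[OF ED_times])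

lemma EF_power2: "EF f \<Longrightarrow> EF (\<lambda>e. 2 ^ f e)"
  by (rule EF_op1[OF ED_power2])

lemma EF_const: "EF (\<lambda>e. n)"
proof (induction n)
  case 0
  have "ED (\<lambda>e. e 0 = e 0 + e 0)"
    using ED_rename[OF ED_plus, of "\<lambda>_. 0"] .
  then show ?case
    by (simp add: EF_def)
next
  case (Suc n)
  have "EF (\<lambda>e. 1)"
    unfolding EF_def by (rule ED_one)
  from EF_add[OF this Suc] show ?case
    by simp
qed

lemma EF_Suc: "EF f \<Longrightarrow> EF (\<lambda>e. Suc (f e))"
  using EF_add[OF EF_const[of 1]] by simp

lemma ED_eq: "EF f \<Longrightarrow> EF g \<Longrightarrow> ED (\<lambda>e. f e = g e)"
  using ED_subst2[of "(=)"] EF_var[unfolded EF_def, of 0] by simp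

lemmas EF_intros = EF_var EF_const EF_add EF_mult EF_Suc EF_power2

lemma ED_less:
  assumes "EF f" "EF g"
  shows "ED (\<lambda>e. f e < g e)"
proof (rule ED_subst2[of "(<)", OF _ assms])
  have "ED (\<lambda>e. \<exists>n. e 1 = Suc (e 0 + n))"
    by (intro ED_exI ED_eq EF_intros)
  then show "ED (\<lambda>e. e 0 < e 1)"
    by (simp add: less_iff_Suc_add)
qed

lemma ED_dvd:
  assumes "EF f" "EF g"
  shows "ED (\<lambda>e. f e dvd g e)"
proof (rule ED_subst2[of "(dvd)", OF _ assms])
  have "ED (\<lambda>e. \<exists>n. e 1 = e 0 * n)"
    by (intro ED_exI ED_eq EF_intros)
  then show "ED (\<lambda>e. e 0 dvd e 1)"
    by (simp add: dvd_def)
qed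

lemmas ED_intros = ED_exI ED_conj ED_eq ED_less

section \<open>Powers, binomial coefficients and factorials\<close>

lemma pell_nonneg:
  fixes a :: int
  assumes "a \<ge> 1"
  shows "pell_x a n \<ge> 0 \<and> pell_y a n \<ge> 0"
proof (induction n)
  case (Suc n)
  have "a * a \<ge> 1"
    using mult_mono[of 1 a 1 a] assms by simp
  with Suc assms show ?case
    by simp
qed simp

text \<open>By \<open>pell_power_dvd\<close>, \<open>y ^ n\<close> is congruent to
  \<open>X - (b + 2 - y) * Y\<close> modulo \<open>m\<close>. As \<open>y \<le> 2 ^ y\<close>, both
  \<open>y ^ n\<close> and \<open>y\<close> are at most \<open>b\<close>; hence
  \<open>y ^ n < m\<close>, and the remainder is \<open>y ^ n\<close> itself. The two multiples of
  \<open>m\<close> stand for one multiple of unknown sign.\<close>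

lemma power_pell_iff:
  fixes y n r :: nat
  assumes "y \<ge> 1"
  defines "b \<equiv> 2 ^ (y * n + 2 * y)"
  shows "r = y ^ n \<longleftrightarrow> (\<exists>X Y m q1 q2. (int X = pell_x (int b + 2) n \<and> int Y = pell_y (int b + 2) n) \<and>
    m + y * y + 1 = 2 * (b + 2) * y \<and> r < m \<and> X + y * Y + q1 * m = (b + 2) * Y + r + q2 * m)"
proof -
  define a where "a = b + 2"
  define m where "m = 2 * a * y - y * y - 1"
  define D where "D = pell_x (int a) n - (int a - int y) * pell_y (int a) n"
  have y2: "y \<le> 2 ^ y"
    using less_exp[of y] by simp
  then have "y * y \<le> 2 ^ y * 2 ^ y"
    by (rule mult_mono[OF _ y2]) auto
  have "y ^ n \<le> (2 ^ y) ^ n"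
    using y2 by (rule power_mono) simp
  also have "\<dots> \<le> b"
    unfolding b_def by (simp add: power_add flip: power_mult)
  finally have yn: "y ^ n \<le> b" .
  have "2 ^ y \<le> b"
    unfolding b_def by (intro power_increasing) auto
  with y2 have "y \<le> b"
    by (rule le_trans)
  then have "(y + 2) * y \<le> a * y"
    unfolding a_def by (intro mult_mono) auto
  moreover have "a \<le> a * y"
    using assms(1) by simp
  moreover have "(y + 2) * y = y * y + 2 * y" "2 * a * y = a * y + a * y"
    by (simp_all add: algebra_simps)
  ultimately have m: "m + y * y + 1 = 2 * a * y" and "a \<le> m"
    using assms(1) unfolding m_def by linarith+
  with yn have ynm: "y ^ n < m"
    by (simp add: a_def)
  have im: "int m = 2 * int a * int y - int y * int y - 1"
    using arg_cong[OF m, of int] by simp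
  have dvd: "int m dvd D - int (y ^ n)"
    unfolding im D_def using pell_power_dvd[of "int a" "int y" n] by simp
  have pos: "pell_x (int a) n \<ge> 0" "pell_y (int a) n \<ge> 0"
    using pell_nonneg[of "int a" n] by (auto simp: a_def)
  have iff: "int m dvd D - int r \<longleftrightarrow> (\<exists>q1 q2. X + y * Y + q1 * m = a * Y + r + q2 * m)"
    if "int X = pell_x (int a) n" "int Y = pell_y (int a) n" for X Y r
  proof -
    have D: "D - int r = int (X + y * Y) - int (a * Y + r)"
      unfolding D_def by (simp add: algebra_simps flip: that)
    show ?thesis
    proof
      assume "int m dvd D - int r"
      then obtain k where "D - int r = int m * k" ..
      then have "int (X + y * Y) - int (a * Y + r) = k * int m"
        by (simp add: D mult.commute)
      moreover have "k = int (nat k) - int (nat (- k))"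
        by simp
      ultimately have "int (X + y * Y) - int (a * Y + r) = (int (nat k) - int (nat (- k))) * int m"
        by simp
      then have "int (X + y * Y) + int (nat (- k)) * int m = int (a * Y + r) + int (nat k) * int m"
        by (simp add: left_diff_distrib)
      then have "X + y * Y + nat (- k) * m = a * Y + r + nat k * m"
        by (metis of_nat_add of_nat_eq_iff of_nat_mult)
      then show "\<exists>q1 q2. X + y * Y + q1 * m = a * Y + r + q2 * m"
        by blast
    next
      assume "\<exists>q1 q2. X + y * Y + q1 * m = a * Y + r + q2 * m"
      then obtain q1 q2 where "X + y * Y + q1 * m = a * Y + r + q2 * m"
        by blast
      from arg_cong[OF this, of int] have "D - int r = int m * (int q2 - int q1)"
        unfolding D by (simp add: algebra_simps)
      then show "int m dvd D - int r"
        by simp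
    qed
  qed
  show ?thesis
    unfolding a_def[symmetric]
  proof
    assume "r = y ^ n"
    with dvd have "int m dvd D - int r"
      by simp
    moreover obtain X Y where XY: "int X = pell_x (int a) n" "int Y = pell_y (int a) n"
      using pos nonneg_int_cases by metis
    ultimately obtain q1 q2 where "X + y * Y + q1 * m = a * Y + r + q2 * m"
      using iff[OF XY] by blast
    with XY m ynm \<open>r = y ^ n\<close>
    show "\<exists>X Y m q1 q2. (int X = pell_x (int b + 2) n \<and> int Y = pell_y (int b + 2) n) \<and>
      m + y * y + 1 = 2 * a * y \<and> r < m \<and> X + y * Y + q1 * m = a * Y + r + q2 * m"
      by (intro exI[of _ X] exI[of _ Y] exI[of _ m] exI[of _ q1] exI[of _ q2])
        (simp add: a_def algebra_simps)
  next
    assume "\<exists>X Y m q1 q2. (int X = pell_x (int b + 2) n \<and> int Y = pell_y (int b + 2) n) \<and>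
      m + y * y + 1 = 2 * a * y \<and> r < m \<and> X + y * Y + q1 * m = a * Y + r + q2 * m"
    then obtain X Y m' q1 q2 where XY: "int X = pell_x (int a) n" "int Y = pell_y (int a) n"
      and m': "m' + y * y + 1 = 2 * a * y" "r < m'" "X + y * Y + q1 * m' = a * Y + r + q2 * m'"
      by (auto simp: a_def algebra_simps)
    then have "m' = m"
      using m by linarith
    with iff[OF XY] m' have "int m dvd D - int r"
      by blast
    with dvd have "int m dvd (D - int r) - (D - int (y ^ n))"
      by (rule dvd_diff[rotated])
    then have "int m dvd int (y ^ n) - int r"
      by simp
    then have "[int (y ^ n) = int r] (mod int m)"
      by (simp add: cong_iff_dvd_diff)
    then have "[y ^ n = r] (mod m)"
      by (simp only: cong_int_iff)
    with ynm m'(2) \<open>m' = m\<close> show "r = y ^ n"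
      by (simp add: cong_def)
  qed
qed

text \<open>The successor keeps the base positive, as \<open>power_pell_iff\<close>
  requires.\<close>

lemma EF_power: "EF f \<Longrightarrow> EF g \<Longrightarrow> EF (\<lambda>e. Suc (f e) ^ g e)"
proof (rule EF_op2[of "\<lambda>a b. Suc a ^ b"])
  have "ED (\<lambda>e. \<exists>X Y m q1 q2.
      (int X = pell_x (int (2 ^ (Suc (e 1) * e 2 + 2 * Suc (e 1))) + 2) (e 2) \<and>
       int Y = pell_y (int (2 ^ (Suc (e 1) * e 2 + 2 * Suc (e 1))) + 2) (e 2)) \<and>
      m + Suc (e 1) * Suc (e 1) + 1 = 2 * (2 ^ (Suc (e 1) * e 2 + 2 * Suc (e 1)) + 2) * Suc (e 1) \<and> e 0 < m \<and>
      X + Suc (e 1) * Y + q1 * m = (2 ^ (Suc (e 1) * e 2 + 2 * Suc (e 1)) + 2) * Y + e 0 + q2 * m)"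
    by (intro ED_intros EF_intros ED_subst4[OF ED_pell])
  then show "ED (\<lambda>e. e 0 = Suc (e 1) ^ e 2)"
    by (subst power_pell_iff) auto
qed

lemma sum_split_at:
  fixes c :: "nat \<Rightarrow> 'a::comm_semiring_1"
  shows "(\<Sum>i<Suc k + j. c i * u ^ i) =
    (\<Sum>i<j. c (Suc k + i) * u ^ i) * u ^ Suc k + c k * u ^ k + (\<Sum>i<k. c i * u ^ i)"
  by (induction j) (simp_all add: algebra_simps power_add)

lemma sum_digits_less:
  fixes c :: "nat \<Rightarrow> nat"
  assumes "\<And>i. c i < u"
  shows "(\<Sum>i<k. c i * u ^ i) < u ^ k"
proof (induction k)
  case (Suc k)
  have "Suc (c k) * u ^ k \<le> u * u ^ k"
    using assms[of k] by (intro mult_right_mono) auto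
  with Suc show ?case
    by simp
qed simp

text \<open>The binomial coefficients are the digits of \<open>(u + 1) ^ n\<close> in base
  \<open>u\<close>, because \<open>u = 2 ^ (n + 1)\<close> exceeds all of them.\<close>

lemma binomial_digit_iff:
  fixes n k c :: nat
  defines "u \<equiv> 2 ^ (n + 1)"
  shows "c = n choose k \<longleftrightarrow>
    (\<exists>h l. Suc u ^ n = h * 2 ^ ((n + 1) * (k + 1)) + c * 2 ^ ((n + 1) * k) + l \<and>
           c < 2 ^ (n + 1) \<and> l < 2 ^ ((n + 1) * k))"
proof -
  have small: "n choose i < u" for i
    unfolding u_def using binomial_le_pow2[of n i] by (rule le_less_trans) simp
  have "Suc u ^ n = (\<Sum>i\<le>n. (n choose i) * u ^ i)"
    using binomial[of u 1 n] by simp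
  also have "\<dots> = (\<Sum>i<Suc k + n. (n choose i) * u ^ i)"
    by (rule sum.mono_neutral_left) (auto simp: not_le)
  finally obtain h l where hl: "Suc u ^ n = h * u ^ Suc k + (n choose k) * u ^ k + l" "l < u ^ k"
    using sum_digits_less[OF small, where k = k] by (simp only: sum_split_at)
  have digit: "c = (h * u ^ Suc k + c * u ^ k + l) div u ^ k mod u" if "c < u" "l < u ^ k" for c h l
  proof -
    have "h * u ^ Suc k + c * u ^ k + l = (h * u + c) * u ^ k + l"
      by (simp add: algebra_simps)
    with that show ?thesis
      by simp
  qed
  have "c = n choose k \<longleftrightarrow> (\<exists>h l. Suc u ^ n = h * u ^ Suc k + c * u ^ k + l \<and> c < u \<and> l < u ^ k)"
    using hl small digit by metis
  moreover have "u ^ j = 2 ^ ((n + 1) * j)" for j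
    by (simp only: u_def power_mult)
  ultimately show ?thesis
    by (simp only: Suc_eq_plus1) (simp only: u_def)
qed

lemma EF_binomial: "EF f \<Longrightarrow> EF g \<Longrightarrow> EF (\<lambda>e. f e choose g e)"
proof (rule EF_op2[of "(choose)"])
  have "ED (\<lambda>e. \<exists>h l. Suc (2 ^ (e 1 + 1)) ^ e 1 =
        h * 2 ^ ((e 1 + 1) * (e 2 + 1)) + e 0 * 2 ^ ((e 1 + 1) * e 2) + l \<and>
      e 0 < 2 ^ (e 1 + 1) \<and> l < 2 ^ ((e 1 + 1) * e 2))"
    by (intro ED_intros EF_power EF_intros)
  then show "ED (\<lambda>e. e 0 = e 1 choose e 2)"
    by (subst binomial_digit_iff)
qed

lemma binomial_prod: "(n choose k) * fact k = (\<Prod>i<k. n - i)"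
proof (induction k)
  case (Suc k)
  have "(n choose Suc k) * Suc k = (n choose k) * (n - k)"
    using binomial_absorb_comp[of n k] times_binomial_minus1_eq[of "Suc k" n]
    by (simp only: diff_Suc_1 zero_less_Suc simp_thms mult.commute)
  then have "(n choose Suc k) * fact (Suc k) = (n choose k) * fact k * (n - k)"
    by (simp only: fact_Suc of_nat_id mult_ac)
  with Suc show ?case
    by simp
qed simp

text \<open>In other words, the falling factorial is at least \<open>r ^ n * (1 - n^2 / r)\<close>.
  In the induction the next factor \<open>r - n\<close> costs at most \<open>n * r ^ Suc n\<close>,
  and \<open>n * n + n \<le> Suc n * Suc n\<close>.\<close>

lemma falling_factorial_ge:
  fixes n r :: nat
  assumes "n \<le> r"
  shows "int r ^ Suc n \<le> int r * int (\<Prod>i<n. r - i) + int n * int n * int r ^ n"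
  using assms
proof (induction n)
  case (Suc n)
  define P where "P = int (\<Prod>i<n. r - i)"
  have "(\<Prod>i<n. r - i) \<le> (\<Prod>i<n. r)"
    by (intro prod_mono) auto
  then have P: "P \<le> int r ^ n"
    unfolding P_def by (metis of_nat_le_iff of_nat_power card_lessThan prod_constant)
  have P': "int (\<Prod>i<Suc n. r - i) = P * (int r - int n)"
    using Suc.prems by (simp add: P_def of_nat_diff)
  from Suc have IH: "int r ^ Suc n \<le> int r * P + int n * int n * int r ^ n"
    by (simp add: P_def)
  have "int r * int r ^ Suc n \<le> int r * (int r * P + int n * int n * int r ^ n)"
    using IH by (intro mult_left_mono) auto
  moreover have "int n * int r * P \<le> int n * int r * int r ^ n"
    using P by (intro mult_left_mono) auto
  ultimately have "int r ^ Suc (Suc n) \<le> int r * (P * (int r - int n)) +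
      (int n * int n + int n) * int r ^ Suc n"
    by (simp add: algebra_simps)
  also have "(int n * int n + int n) * int r ^ Suc n \<le> int (Suc n) * int (Suc n) * int r ^ Suc n"
    by (intro mult_right_mono) (auto simp: algebra_simps)
  finally show ?case
    by (simp only: P')
qed simp

text \<open>\<open>r ^ n / (r choose n)\<close> is \<open>fact n\<close> times the quotient of
  \<open>r ^ n\<close> by the falling factorial, which tends to 1 for large \<open>r\<close>. By
  \<open>falling_factorial_ge\<close> the excess over \<open>fact n\<close> is below 1 for such
  \<open>r\<close>.\<close>

lemma fact_eq_div:
  fixes n r :: nat
  assumes r: "n * n * (fact n + 1) < r"
  shows "fact n = r ^ n div (r choose n)"
proof (rule div_nat_eqI[symmetric])
  define C where "C = (r choose n)"
  have "n * n * 2 \<le> n * n * (fact n + 1)"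
    using fact_ge_1[of n] by (intro mult_left_mono) auto
  with r have nn: "n * n < r"
    by linarith
  then have "n \<le> r"
    using le_square[of n] by linarith
  then have "C > 0"
    by (simp add: C_def)
  show "(r choose n) * fact n \<le> r ^ n"
    by (rule binomial_fact_pow)
  show "r ^ n < (r choose n) * Suc (fact n)"
  proof (rule ccontr)
    assume "\<not> ?thesis"
    then have "int (C * (fact n + 1)) \<le> int (r ^ n)"
      unfolding C_def not_less by (simp only: of_nat_le_iff add_Suc_right Suc_eq_plus1)
    then have 1: "int C * (int (fact n) + 1) * (int r - int (n * n)) \<le> int r ^ n * (int r - int (n * n))"
    proof (intro mult_right_mono)
      show "0 \<le> int r - int (n * n)"
        using nn by linarith
    qed (simp add: algebra_simps)
    have 2: "int r ^ n * (int r - int (n * n)) \<le> int r * int (C * fact n)"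
      using falling_factorial_ge[OF \<open>n \<le> r\<close>] unfolding C_def binomial_prod by (simp add: algebra_simps)
    from order_trans[OF 1 2]
    have "int C * ((int (fact n) + 1) * (int r - int (n * n))) \<le> int C * (int r * int (fact n))"
      by (simp only: of_nat_mult mult_ac)
    with \<open>C > 0\<close> have "(int (fact n) + 1) * (int r - int (n * n)) \<le> int r * int (fact n)"
      by simp
    then have "int r \<le> int (n * n * (fact n + 1))"
      by (simp add: algebra_simps)
    with r show False
      by linarith
  qed
qed

text \<open>The exponent in \<open>r\<close> comes from \<open>n * n < 2 ^ (2 * n)\<close> and
  \<open>fact n + 1 \<le> 2 * 2 ^ (n * n)\<close>, which multiply to the hypothesis of
  \<open>fact_eq_div\<close>.\<close>

lemma fact_iff:
  fixes n f :: nat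
  defines "r \<equiv> 2 ^ (n * n + 2 * n + 1)"
  shows "f = fact n \<longleftrightarrow> (\<exists>q. 2 ^ ((n * n + 2 * n + 1) * n) = f * (r choose n) + q \<and> q < r choose n)"
proof -
  have n: "n < 2 ^ n"
    by (rule less_exp)
  then have "n * n < 2 ^ n * 2 ^ n"
    by (intro mult_strict_mono) auto
  then have nn: "n * n < 2 ^ (2 * n)"
    by (simp flip: power_add add: mult_2)
  have "fact n \<le> n ^ n"
    using fact_le_power[of n, where 'a = nat] by simp
  also have "\<dots> \<le> (2 ^ n) ^ n"
    using n by (intro power_mono) auto
  finally have "fact n \<le> (2::nat) ^ (n * n)"
    by (simp add: power_mult)
  moreover have "1 \<le> (2::nat) ^ (n * n)"
    by simp
  ultimately have "fact n + 1 \<le> 2 * (2::nat) ^ (n * n)"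
    by linarith
  then have "n * n * (fact n + 1) < 2 ^ (2 * n) * (2 * 2 ^ (n * n))"
    using nn by (intro mult_less_le_imp_less) auto
  then have r: "n * n * (fact n + 1) < r"
    by (simp add: r_def power_add mult_ac)
  have "n * n * 1 \<le> n * n * (fact n + 1)"
    by (intro mult_left_mono) auto
  then have "n \<le> r"
    using r le_square[of n] by linarith
  then have C: "r choose n > 0"
    by simp
  have rn: "r ^ n = 2 ^ ((n * n + 2 * n + 1) * n)"
    unfolding r_def by (rule power_mult[symmetric])
  have "(\<exists>q. r ^ n = f * (r choose n) + q \<and> q < r choose n) \<longleftrightarrow> f = r ^ n div (r choose n)"
  proof
    assume "f = r ^ n div (r choose n)"
    then show "\<exists>q. r ^ n = f * (r choose n) + q \<and> q < r choose n"
      using C mod_less_divisor div_mult_mod_eq by metis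
  qed (use C in auto)
  then show ?thesis
    unfolding fact_eq_div[OF r] rn by simp
qed

lemma EF_fact: "EF f \<Longrightarrow> EF (\<lambda>e. fact (f e))"
proof (rule EF_op1[of fact])
  have "ED (\<lambda>e. \<exists>q. 2 ^ ((e 1 * e 1 + 2 * e 1 + 1) * e 1) =
        e 0 * (2 ^ (e 1 * e 1 + 2 * e 1 + 1) choose e 1) + q \<and>
      q < 2 ^ (e 1 * e 1 + 2 * e 1 + 1) choose e 1)"
    by (intro ED_intros EF_binomial EF_intros)
  then show "ED (\<lambda>e. e 0 = fact (e 1))"
    by (subst fact_iff)
qed

section \<open>The bounded universal quantifier\<close>

lemma pol_cong_dvd:
  "pol c p \<Longrightarrow> (\<And>i. d dvd x i - y i) \<Longrightarrow> d dvd p x - p y"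
proof (induction rule: pol.induct)
  case (pol_add p q)
  have "p x + q x - (p y + q y) = (p x - p y) + (q x - q y)"
    by simp
  with pol_add show ?case
    by (metis dvd_add)
next
  case (pol_mult p q)
  have "p x * q x - p y * q y = p x * (q x - q y) + (p x - p y) * q y"
    by (simp add: algebra_simps)
  with pol_mult show ?case
    by (metis dvd_add dvd_mult dvd_mult2)
qed auto

text \<open>The two parts have natural coefficients. So they are monotone, which bounds
  \<open>p\<close>, and they are expressible as \<open>EF\<close>, where no negative numbers
  exist.\<close>

lemma pol_difference:
  assumes "pol (0::int) p"
  shows "\<exists>g h. (\<forall>x. p (\<lambda>i. int (x i)) = int (g x) - int (h x)) \<and>
    (\<forall>x y. (\<forall>i. x i \<le> y i) \<longrightarrow> g x \<le> g y \<and> h x \<le> h y) \<and>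
    (\<forall>v. (\<forall>i. EF (v i)) \<longrightarrow> EF (\<lambda>e. g (\<lambda>i. v i e)) \<and> EF (\<lambda>e. h (\<lambda>i. v i e)))"
  using assms
proof (induction rule: pol.induct)
  case pol_one
  show ?case
    by (rule exI[of _ "\<lambda>_. 1"], rule exI[of _ "\<lambda>_. 0"]) (auto intro: EF_const)
next
  case pol_minus_one
  show ?case
    by (rule exI[of _ "\<lambda>_. 0"], rule exI[of _ "\<lambda>_. 1"]) (auto intro: EF_const)
next
  case pol_param
  show ?case
    by (rule exI[of _ "\<lambda>_. 0"], rule exI[of _ "\<lambda>_. 0"]) (auto intro: EF_const)
next
  case (pol_var i)
  show ?case
    by (rule exI[of _ "\<lambda>x. x i"], rule exI[of _ "\<lambda>_. 0"]) (auto intro: EF_const)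
next
  case (pol_add p q)
  then obtain g1 h1 g2 h2 where
    "\<forall>x. p (\<lambda>i. int (x i)) = int (g1 x) - int (h1 x)" "\<forall>x. q (\<lambda>i. int (x i)) = int (g2 x) - int (h2 x)"
    "\<forall>x y. (\<forall>i. x i \<le> y i) \<longrightarrow> g1 x \<le> g1 y \<and> h1 x \<le> h1 y"
    "\<forall>x y. (\<forall>i. x i \<le> y i) \<longrightarrow> g2 x \<le> g2 y \<and> h2 x \<le> h2 y"
    "\<forall>v. (\<forall>i. EF (v i)) \<longrightarrow> EF (\<lambda>e. g1 (\<lambda>i. v i e)) \<and> EF (\<lambda>e. h1 (\<lambda>i. v i e))"
    "\<forall>v. (\<forall>i. EF (v i)) \<longrightarrow> EF (\<lambda>e. g2 (\<lambda>i. v i e)) \<and> EF (\<lambda>e. h2 (\<lambda>i. v i e))"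
    by blast
  then show ?case
    by (intro exI[of _ "\<lambda>x. g1 x + g2 x"] exI[of _ "\<lambda>x. h1 x + h2 x"])
      (auto intro!: EF_add add_mono)
next
  case (pol_mult p q)
  then obtain g1 h1 g2 h2 where
    "\<forall>x. p (\<lambda>i. int (x i)) = int (g1 x) - int (h1 x)" "\<forall>x. q (\<lambda>i. int (x i)) = int (g2 x) - int (h2 x)"
    "\<forall>x y. (\<forall>i. x i \<le> y i) \<longrightarrow> g1 x \<le> g1 y \<and> h1 x \<le> h1 y"
    "\<forall>x y. (\<forall>i. x i \<le> y i) \<longrightarrow> g2 x \<le> g2 y \<and> h2 x \<le> h2 y"
    "\<forall>v. (\<forall>i. EF (v i)) \<longrightarrow> EF (\<lambda>e. g1 (\<lambda>i. v i e)) \<and> EF (\<lambda>e. h1 (\<lambda>i. v i e))"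
    "\<forall>v. (\<forall>i. EF (v i)) \<longrightarrow> EF (\<lambda>e. g2 (\<lambda>i. v i e)) \<and> EF (\<lambda>e. h2 (\<lambda>i. v i e))"
    by blast
  note gh = this
  show ?case
  proof (rule exI[of _ "\<lambda>x. g1 x * g2 x + h1 x * h2 x"],
      rule exI[of _ "\<lambda>x. g1 x * h2 x + h1 x * g2 x"], intro conjI allI impI)
    show "p (\<lambda>i. int (x i)) * q (\<lambda>i. int (x i)) =
        int (g1 x * g2 x + h1 x * h2 x) - int (g1 x * h2 x + h1 x * g2 x)" for x
      unfolding gh(1)[rule_format] gh(2)[rule_format] by (simp add: algebra_simps)
  qed (use gh(3-6) in \<open>auto intro!: EF_add EF_mult add_mono mult_mono\<close>)
qed

lemma prime_common_divisor: "\<not> coprime (a::nat) b \<Longrightarrow> \<exists>q. prime q \<and> q dvd a \<and> q dvd b"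
  by (metis coprime_iff_gcd_eq_1 prime_factor_nat gcd_nat.bounded_iff)

lemma dvd_diff_nat_cong:
  fixes a b m :: nat
  assumes "[a = b] (mod m)"
  shows "m dvd a - b"
  using assms by (cases "b \<le> a") (auto simp: cong_altdef_nat)

text \<open>
  The moduli \<open>T div k - 1\<close> for \<open>1 \<le> k \<le> n\<close> are pairwise coprime, their product is a binomial
  coefficient, and \<open>T\<close> is congruent to \<open>k\<close> modulo the \<open>k\<close>-th of them. So a single congruence for
  \<open>T\<close> expresses a congruence for every \<open>k\<close>, and since the prime divisors of the moduli exceed \<open>B\<close>,
  a congruence between small numbers is an equality.
\<close>

locale bounded_quantifier =
  fixes n B :: nat
  assumes B: "n \<le> B" "3 \<le> B"
begin

text \<open>The square makes \<open>T div k\<close> still a multiple of \<open>fact B\<close> for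
  \<open>1 \<le> k \<le> n\<close>, so that no prime up to \<open>B\<close> divides
  \<open>md k\<close>.\<close>

definition T :: nat where "T = (fact B)\<^sup>2"

definition md :: "nat \<Rightarrow> nat" where "md k = T div k - 1"

lemma md:
  assumes "k \<in> {1..n}"
  shows "T = k * Suc (md k)" and "md k \<ge> 2" and "\<And>q. prime q \<Longrightarrow> q dvd md k \<Longrightarrow> B < q"
proof -
  have k: "k dvd fact B" "0 < k"
    using assms B by (auto intro!: dvd_fact)
  from k(1) obtain l where l: "fact B = k * l" ..
  have Tk: "T div k = l * fact B"
    using k(2) by (simp add: T_def power2_eq_square l)
  have "fact B > (0::nat)"
    by simp
  then have "l \<ge> 1"
    by (cases l) (auto simp: l)
  then have "1 * fact B \<le> l * (fact B :: nat)"
    by (rule mult_right_mono) simp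
  moreover have "B \<le> fact B"
    by (rule fact_ge_self)
  ultimately have "T div k \<ge> 3"
    using B(2) unfolding Tk by linarith
  moreover have "k dvd T"
    using k(1) by (simp add: T_def power2_eq_square)
  ultimately show T: "T = k * Suc (md k)" and "md k \<ge> 2"
    by (auto simp: md_def)
  fix q :: nat
  assume q: "prime q" "q dvd md k"
  show "B < q"
  proof (rule ccontr)
    assume "\<not> ?thesis"
    then have "q dvd fact B"
      using q(1) by (intro dvd_fact) (auto simp: prime_gt_0_nat Suc_le_eq)
    then have "q dvd T div k"
      by (simp add: Tk)
    also have "T div k = md k + 1"
      using \<open>T div k \<ge> 3\<close> by (simp add: md_def)
    finally have "q dvd 1"
      using q(2) by (metis dvd_add_right_iff)
    with q(1) show False
      by simp
  qed
qed

lemma T_cong: "k \<in> {1..n} \<Longrightarrow> [T = k] (mod md k)"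
  using md(1)[of k] by (simp add: cong_def)

text \<open>A common prime divisor \<open>q\<close> would give
  \<open>k \<equiv> T \<equiv> l\<close> modulo \<open>q\<close>, but \<open>q\<close> exceeds
  \<open>B\<close> and hence \<open>k\<close> and \<open>l\<close>.\<close>

lemma md_coprime:
  assumes "k \<in> {1..n}" "l \<in> {1..n}" "k \<noteq> l"
  shows "coprime (md k) (md l)"
proof (rule ccontr)
  assume "\<not> coprime (md k) (md l)"
  then obtain q where q: "prime q" "q dvd md k" "q dvd md l"
    using prime_common_divisor by blast
  then have "[T = k] (mod q)" "[T = l] (mod q)"
    using T_cong assms(1,2) cong_dvd_modulus_nat by blast+
  then have "[k = l] (mod q)"
    by (metis cong_sym cong_trans)
  moreover have "k < q" "l < q"
    using md(3)[OF assms(1) q(1,2)] assms(1,2) B by auto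
  ultimately show False
    using assms(3) by (simp add: cong_def)
qed

lemma md_fact_coprime:
  assumes "k \<in> {1..n}" "j \<le> B"
  shows "coprime (md k) (fact j)"
proof (rule ccontr)
  assume "\<not> coprime (md k) (fact j)"
  then obtain q where q: "prime q" "q dvd md k" "q dvd fact j"
    using prime_common_divisor by blast
  with md(3)[OF assms(1), of q] assms(2) show False
    by (simp add: prime_dvd_fact_iff)
qed

text \<open>Since \<open>k * md k = T - k\<close>, multiplication by \<open>fact n\<close> yields a
  falling factorial.\<close>

lemma prod_md: "(\<Prod>k\<in>{1..n}. md k) = (T - 1) choose n"
proof -
  have "fact n * (\<Prod>k\<in>{1..n}. md k) = (\<Prod>k\<in>{1..n}. k * md k)"
    by (simp add: fact_prod prod.distrib)
  also have "\<dots> = (\<Prod>k\<in>{1..n}. T - k)"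
  proof (intro prod.cong refl)
    show "k * md k = T - k" if "k \<in> {1..n}" for k
      using md(1)[OF that] by simp
  qed
  also have "\<dots> = (\<Prod>i<n. T - 1 - i)"
    by (rule prod.reindex_bij_witness[of _ Suc "\<lambda>k. k - 1"]) auto
  also have "\<dots> = fact n * ((T - 1) choose n)"
    by (simp only: binomial_prod[symmetric] mult.commute)
  finally show ?thesis
    by simp
qed

lemma md_dvd_all:
  "(T - 1 choose n) dvd x" if "\<And>k. k \<in> {1..n} \<Longrightarrow> md k dvd x"
proof -
  have "(\<Prod>k\<in>A. md k) dvd x" if "finite A" "A \<subseteq> {1..n}" for A
    using that
  proof (induction A rule: finite_induct)
    case (insert k A)
    have "coprime (md k) (\<Prod>k\<in>A. md k)"
      using insert.prems insert.hyps by (intro prod_coprime_right md_coprime) auto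
    with insert \<open>\<And>k. k \<in> {1..n} \<Longrightarrow> md k dvd x\<close> show ?case
      by (auto intro: divides_mult)
  qed simp
  from this[of "{1..n}"] show ?thesis
    by (simp only: prod_md finite_atLeastAtMost subset_refl)
qed

text \<open>With \<open>dvd_binomial_cong\<close>, this divisibility expresses that a residue is at
  most \<open>u\<close>: one of the factors \<open>a, ..., a - u\<close> is divisible, and the
  denominator \<open>fact (Suc u)\<close> is coprime to \<open>md k\<close>.\<close>

lemma md_dvd_binomial:
  assumes "k \<in> {1..n}" "Suc u \<le> B" "[a = y] (mod md k)" "y \<le> u"
  shows "md k dvd a choose Suc u"
proof -
  have "md k dvd (\<Prod>i<Suc u. a - i)"
    using dvd_diff_nat_cong[OF assms(3)] assms(4) by (intro dvd_prodI[THEN dvd_trans[rotated]]) auto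
  then have "md k dvd (a choose Suc u) * fact (Suc u)"
    by (simp only: binomial_prod)
  then show ?thesis
    using coprime_dvd_mult_left_iff[OF md_fact_coprime[OF assms(1,2)]] by simp
qed

lemma dvd_binomial_cong:
  assumes "prime q" "q dvd a choose Suc u"
  shows "\<exists>y\<le>u. int q dvd int a - int y"
proof -
  have "q dvd (\<Prod>i<Suc u. a - i)"
    unfolding binomial_prod[symmetric] using assms(2) by (rule dvd_mult2)
  then obtain i where i: "i \<le> u" "q dvd a - i"
    using assms(1) prime_dvd_prod_iff[of "{..<Suc u}" q "\<lambda>i. a - i"]
    by (auto simp: less_Suc_eq_le simp del: prod.lessThan_Suc)
  show ?thesis
  proof (cases "i \<le> a")
    case True
    with i show ?thesis
      by (intro exI[of _ i]) (metis int_dvd_int_iff of_nat_diff)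
  next
    \<comment> \<open>Truncated subtraction makes the factor 0 here; as
      \<open>a < i \<le> u\<close>, the number \<open>a\<close> is itself the residue.\<close>
    case False
    with i(1) show ?thesis
      by (intro exI[of _ a]) auto
  qed
qed

text \<open>From left to right, the witnesses for all \<open>k\<close> are merged by the Chinese
  remainder theorem. Conversely, a prime divisor \<open>q\<close> of \<open>md k\<close> turns
  \<open>a\<close> into witnesses that are at most \<open>u\<close>; as \<open>T\<close> is
  congruent to \<open>k\<close> modulo \<open>q\<close>, the value of \<open>p\<close> is divisible
  by \<open>q\<close> but smaller in absolute value, hence 0.\<close>

lemma bounded_all_iff:
  fixes p :: "(nat \<Rightarrow> int) \<Rightarrow> int" and e :: "nat \<Rightarrow> nat" and m u :: nat
  defines "J \<equiv> \<lambda>k y. join (\<lambda>i. int (case_nat k e i)) (\<lambda>i. int (if i < m then y i else 0))"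
  assumes p: "pol 0 p" and u: "Suc u \<le> B"
    and bound: "\<And>k y. k \<in> {1..n} \<Longrightarrow> \<forall>i<m. y i \<le> u \<Longrightarrow> \<bar>p (J k y)\<bar> \<le> int B"
  shows "(\<forall>k\<in>{1..n}. \<exists>y. (\<forall>i<m. y i \<le> u) \<and> p (J k y) = 0) \<longleftrightarrow>
    (\<exists>a. (\<forall>i<m. (T - 1 choose n) dvd a i choose Suc u) \<and> int (T - 1 choose n) dvd p (J T a))"
proof -
  have J: "d dvd p (J T a) - p (J k y)"
    if "d dvd int T - int k" "\<And>i. i < m \<Longrightarrow> d dvd int (a i) - int (y i)" for d k a y
  proof (rule pol_cong_dvd[OF p])
    show "d dvd J T a i - J k y i" for i
      using that by (auto simp: J_def join_def split: nat.split)
  qed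
  show ?thesis
  proof
    assume "\<forall>k\<in>{1..n}. \<exists>y. (\<forall>i<m. y i \<le> u) \<and> p (J k y) = 0"
    then obtain y where y: "\<And>k i. k \<in> {1..n} \<Longrightarrow> i < m \<Longrightarrow> y k i \<le> u"
        "\<And>k. k \<in> {1..n} \<Longrightarrow> p (J k (y k)) = 0"
      by metis
    have "\<exists>a. \<forall>k\<in>{1..n}. [a = y k i] (mod md k)" for i
      using md_coprime by (intro chinese_remainder_nat) auto
    then obtain a where a: "\<And>i k. k \<in> {1..n} \<Longrightarrow> [a i = y k i] (mod md k)"
      by metis
    have "(T - 1 choose n) dvd a i choose Suc u" if "i < m" for i
      using a y(1) that u by (intro md_dvd_all md_dvd_binomial) auto
    moreover have "(T - 1 choose n) dvd nat \<bar>p (J T a)\<bar>"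
    proof (rule md_dvd_all)
      fix k
      assume k: "k \<in> {1..n}"
      have "int (md k) dvd p (J T a) - p (J k (y k))"
        using T_cong[OF k] a[OF k] by (intro J) (simp_all add: flip: cong_iff_dvd_diff cong_int_iff)
      with y(2)[OF k] show "md k dvd nat \<bar>p (J T a)\<bar>"
        by (simp add: dvd_nat_abs_iff)
    qed
    ultimately show "\<exists>a. (\<forall>i<m. (T - 1 choose n) dvd a i choose Suc u) \<and>
        int (T - 1 choose n) dvd p (J T a)"
      by (auto simp: dvd_nat_abs_iff)
  next
    assume "\<exists>a. (\<forall>i<m. (T - 1 choose n) dvd a i choose Suc u) \<and> int (T - 1 choose n) dvd p (J T a)"
    then obtain a where a: "\<And>i. i < m \<Longrightarrow> (T - 1 choose n) dvd a i choose Suc u"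
        "int (T - 1 choose n) dvd p (J T a)"
      by blast
    show "\<forall>k\<in>{1..n}. \<exists>y. (\<forall>i<m. y i \<le> u) \<and> p (J k y) = 0"
    proof
      fix k
      assume k: "k \<in> {1..n}"
      from md(2)[OF k] obtain q where q: "prime q" "q dvd md k"
        using prime_factor_nat[of "md k"] by auto
      have qM: "q dvd (T - 1 choose n)"
        using q(2) k unfolding prod_md[symmetric] by (metis dvd_prodI dvd_trans finite_atLeastAtMost)
      have "\<forall>i. \<exists>y. i < m \<longrightarrow> y \<le> u \<and> int q dvd int (a i) - int y"
        using dvd_binomial_cong[OF q(1)] a(1) dvd_trans[OF qM] by blast
      from choice[OF this] obtain y where y: "\<And>i. i < m \<Longrightarrow> y i \<le> u" "\<And>i. i < m \<Longrightarrow> int q dvd int (a i) - int (y i)"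
        by blast
      have "int q dvd int T - int k"
        using T_cong[OF k] q(2) by (metis cong_dvd_modulus_nat cong_iff_dvd_diff cong_int_iff)
      then have "int q dvd p (J T a) - p (J k y)"
        using y(2) by (rule J)
      moreover have "int q dvd p (J T a)"
        using a(2) qM by (metis dvd_trans int_dvd_int_iff)
      ultimately have "int q dvd p (J k y)"
        by (metis dvd_diff_right_iff dvd_diff_commute)
      moreover have "\<bar>p (J k y)\<bar> < int q"
        using bound[OF k, of y] y(1) md(3)[OF k q] by simp
      ultimately have "p (J k y) = 0"
        by (metis dvd_imp_le_int not_less abs_of_nat)
      with y(1) show "\<exists>y. (\<forall>i<m. y i \<le> u) \<and> p (J k y) = 0"
        by blast
    qed
  qed
qed

end

theorem ED_bounded_all:
  assumes "pdio S"
  shows "ED (\<lambda>e. \<forall>k\<in>{1..e 0}. S (case_nat k e))"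
proof -
  obtain p where p: "pol 0 p"
      "\<And>e. S e \<longleftrightarrow> (\<exists>y. p (join (\<lambda>i. int (e i)) (\<lambda>i. int (y i))) = 0)"
    using assms unfolding pdio_iff by blast
  obtain m where m: "\<And>x y. (\<forall>i<m. x i = y i) \<Longrightarrow> p x = p y"
    using pol_depends[OF p(1)] by blast
  obtain g h where gh: "\<And>x. p (\<lambda>i. int (x i)) = int (g x) - int (h x)"
      "\<And>x y. (\<forall>i. x i \<le> y i) \<Longrightarrow> g x \<le> g y" "\<And>x y. (\<forall>i. x i \<le> y i) \<Longrightarrow> h x \<le> h y"
      "\<And>v. (\<forall>i. EF (v i)) \<Longrightarrow> EF (\<lambda>e. g (\<lambda>i. v i e))" "\<And>v. (\<forall>i. EF (v i)) \<Longrightarrow> EF (\<lambda>e. h (\<lambda>i. v i e))"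
    using pol_difference[OF p(1)] by blast
  define J where "J k e y = join (\<lambda>i. int (case_nat k e i)) (\<lambda>i. int (if i < m then y i else 0))" for k e y
  define J' where "J' k e y = join (case_nat k e) (\<lambda>i. if i < m then y i else 0)" for k e and y :: "nat \<Rightarrow> nat"
  have JJ': "J k e y = (\<lambda>i. int (J' k e y i))" for k e y
    by (simp add: J_def J'_def join_def fun_eq_iff)
  have S: "S (case_nat k e) \<longleftrightarrow> (\<exists>y. p (J k e y) = 0)" for k e
  proof -
    have "p (join (\<lambda>i. int (case_nat k e i)) (\<lambda>i. int (y i))) = p (J k e y)" for y
      unfolding J_def by (rule m) (auto simp: join_def)
    with p(2) show ?thesis
      by simp
  qed
  \<comment> \<open>Only finitely many witnesses are involved, so a single bound serves for
    all.\<close>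
  have bnd: "(\<forall>k\<in>{1..n}. \<exists>y. p (J k e y) = 0) \<longleftrightarrow>
      (\<exists>u. \<forall>k\<in>{1..n}. \<exists>y. (\<forall>i<m. y i \<le> u) \<and> p (J k e y) = 0)" for n e
  proof
    assume "\<forall>k\<in>{1..n}. \<exists>y. p (J k e y) = 0"
    then obtain y where y: "\<And>k. k \<in> {1..n} \<Longrightarrow> p (J k e (y k)) = 0"
      by metis
    have "y k i \<le> (\<Sum>k\<in>{1..n}. \<Sum>i<m. y k i)" if "k \<in> {1..n}" "i < m" for k i
    proof -
      have "y k i \<le> (\<Sum>i<m. y k i)"
        using that(2) by (intro member_le_sum) auto
      also have "\<dots> \<le> (\<Sum>k\<in>{1..n}. \<Sum>i<m. y k i)"
        using that(1) by (intro member_le_sum[of k _ "\<lambda>k. \<Sum>i<m. y k i"]) auto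
      finally show ?thesis .
    qed
    with y show "\<exists>u. \<forall>k\<in>{1..n}. \<exists>y. (\<forall>i<m. y i \<le> u) \<and> p (J k e y) = 0"
      by blast
  qed blast
  \<comment> \<open>By monotonicity \<open>g\<close> and \<open>h\<close> at the largest arguments
    bound \<open>\<bar>p\<bar>\<close>; the other summands ensure \<open>n \<le> B\<close>,
    \<open>Suc u \<le> B\<close> and \<open>3 \<le> B\<close>.\<close>
  define B where "B n e u = g (J' n e (\<lambda>_. u)) + h (J' n e (\<lambda>_. u)) + n + u + 3" for n e and u :: nat
  have bound: "\<bar>p (J k e y)\<bar> \<le> int (B n e u)" if "k \<in> {1..n}" "\<forall>i<m. y i \<le> u" for k n e y u
  proof -
    have le: "\<forall>i. J' k e y i \<le> J' n e (\<lambda>_. u) i"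
      using that by (auto simp: J'_def join_def split: nat.split)
    from gh(2,3)[OF le] show ?thesis
      unfolding JJ' gh(1) B_def by linarith
  qed
  \<comment> \<open>Variables of \<open>V\<close> and \<open>R\<close>: the witnesses
    \<open>a\<close> below \<open>m\<close>, then \<open>s\<close> at \<open>m\<close>,
    \<open>u\<close> at \<open>m + 1\<close> and \<open>e\<close> from \<open>m + 2\<close> on, so
    that \<open>E (m + 2)\<close> is the bound \<open>e 0\<close>. In \<open>Z\<close> and
    \<open>W\<close> the witnesses are absent. As there is no subtraction, \<open>s = T - 1\<close>
    is stated as \<open>Suc s = T\<close>.\<close>
  define V where "V E = J' (Suc (E m)) (\<lambda>i. E (i + m + 2)) (\<lambda>i. E i)" for E
  define R where "R E \<longleftrightarrow> (\<forall>i<m. (E m choose E (m + 2)) dvd (E i choose Suc (E (m + 1)))) \<and>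
      (\<exists>q1 q2. g (V E) + q1 * (E m choose E (m + 2)) = h (V E) + q2 * (E m choose E (m + 2)))" for E
  define Z where "Z E = J' (E 2) (\<lambda>i. E (i + 2)) (\<lambda>_. E 1)" for E
  define W where "W E \<longleftrightarrow> Suc (E 0) = fact (g (Z E) + h (Z E) + E 2 + E 1 + 3) * fact (g (Z E) + h (Z E) + E 2 + E 1 + 3) \<and>
      (\<exists>a. R (\<lambda>i. if i < m then a i else E (i - m)))" for E
  have "EF (\<lambda>E. V E i)" for i
    unfolding V_def J'_def join_def
    by (cases "even i"; cases "i div 2"; cases "i div 2 < m") (simp_all add: EF_Suc EF_var EF_const)
  from gh(4,5)[OF allI[of "\<lambda>i. EF (\<lambda>E. V E i)", OF this]]
  have EFV: "EF (\<lambda>E. g (V E))" "EF (\<lambda>E. h (V E))"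
    by simp_all
  have "EF (\<lambda>E. Z E i)" for i
    unfolding Z_def J'_def join_def
    by (cases "even i"; cases "i div 2"; cases "i div 2 < m") (simp_all add: EF_var EF_const)
  from gh(4,5)[OF allI[of "\<lambda>i. EF (\<lambda>E. Z E i)", OF this]]
  have EFZ: "EF (\<lambda>E. g (Z E))" "EF (\<lambda>E. h (Z E))"
    by simp_all
  have "ED R"
    unfolding R_def
    by (intro ED_conj ED_all_less ED_exI ED_dvd ED_eq EF_binomial EF_Suc EF_add EF_mult EF_var
        EF_rename[OF EF_rename[OF EFV(1)]] EF_rename[OF EF_rename[OF EFV(2)]])
  from ED_exs[OF this] have "ED W"
    unfolding W_def by (intro ED_conj ED_eq EF_mult EF_fact EF_add EF_Suc EF_var EF_const EFZ)
  from ED_ex[OF ED_ex[OF this]] have "ED (\<lambda>e. \<exists>u s. W (case_nat s (case_nat u e)))" .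
  moreover have "(\<forall>k\<in>{1..e 0}. S (case_nat k e)) \<longleftrightarrow> (\<exists>u s. W (case_nat s (case_nat u e)))" for e
  proof -
    have "(\<forall>k\<in>{1..e 0}. \<exists>y. (\<forall>i<m. y i \<le> u) \<and> p (J k e y) = 0) \<longleftrightarrow>
        (\<exists>s. W (case_nat s (case_nat u e)))" for u
    proof -
      interpret bounded_quantifier "e 0" "B (e 0) e u"
        by unfold_locales (auto simp: B_def)
      have Z: "Z (case_nat s (case_nat u e)) = J' (e 0) e (\<lambda>_. u)" for s
        by (simp add: Z_def eval_nat_numeral)
      have "T \<noteq> 0"
        by (simp add: T_def)
      then have T: "Suc s = fact (B (e 0) e u) * fact (B (e 0) e u) \<longleftrightarrow> s = T - 1" for s
        by (auto simp: T_def power2_eq_square)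
      have dvd: "int M dvd p (J k e a) \<longleftrightarrow> (\<exists>q1 q2. g (J' k e a) + q1 * M = h (J' k e a) + q2 * M)" for M k a
      proof
        assume "int M dvd p (J k e a)"
        then obtain q where "p (J k e a) = int M * q" ..
        then have "int (g (J' k e a)) + int (nat (- q)) * int M = int (h (J' k e a)) + int (nat q) * int M"
          unfolding JJ' gh(1) by (cases "q \<ge> 0") (auto simp: algebra_simps)
        then have "g (J' k e a) + nat (- q) * M = h (J' k e a) + nat q * M"
          by (metis of_nat_add of_nat_eq_iff of_nat_mult)
        then show "\<exists>q1 q2. g (J' k e a) + q1 * M = h (J' k e a) + q2 * M"
          by blast
      next
        assume "\<exists>q1 q2. g (J' k e a) + q1 * M = h (J' k e a) + q2 * M"
        then obtain q1 q2 where "g (J' k e a) + q1 * M = h (J' k e a) + q2 * M"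
          by blast
        from arg_cong[OF this, of int] have "p (J k e a) = int M * (int q2 - int q1)"
          unfolding JJ' gh(1) by (simp add: algebra_simps)
        then show "int M dvd p (J k e a)"
          by simp
      qed
      have R: "R (\<lambda>i. if i < m then a i else case_nat s (case_nat u e) (i - m)) \<longleftrightarrow>
          (\<forall>i<m. (s choose e 0) dvd a i choose Suc u) \<and> int (s choose e 0) dvd p (J (Suc s) e a)" for s a
      proof -
        have "V (\<lambda>i. if i < m then a i else case_nat s (case_nat u e) (i - m)) = J' (Suc s) e a"
          unfolding V_def J'_def by (intro arg_cong2[where f = join]) (auto simp: fun_eq_iff eval_nat_numeral)
        then show ?thesis
          unfolding R_def dvd by (simp add: eval_nat_numeral)
      qed
      have W: "W (case_nat s (case_nat u e)) \<longleftrightarrow> s = T - 1 \<and>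
          (\<exists>a. (\<forall>i<m. (s choose e 0) dvd a i choose Suc u) \<and> int (s choose e 0) dvd p (J (Suc s) e a))" for s
        unfolding W_def R Z T[symmetric] by (simp add: eval_nat_numeral(2) B_def)
      have "(\<exists>s. W (case_nat s (case_nat u e))) \<longleftrightarrow>
          (\<exists>a. (\<forall>i<m. (T - 1 choose e 0) dvd a i choose Suc u) \<and> int (T - 1 choose e 0) dvd p (J T e a))"
        using \<open>T \<noteq> 0\<close> unfolding W by simp
      also have "\<dots> \<longleftrightarrow> (\<forall>k\<in>{1..e 0}. \<exists>y. (\<forall>i<m. y i \<le> u) \<and> p (J k e y) = 0)"
        unfolding J_def by (rule bounded_all_iff[symmetric, OF p(1)]) (use bound[unfolded J_def] in \<open>auto simp: B_def\<close>)
      finally show ?thesis ..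
    qed
    then show ?thesis
      unfolding S bnd by simp
  qed
  ultimately show ?thesis
    by simp
qed

section \<open>Recursive functions\<close>

text \<open>Polynomial, so that the rules below become \<open>pdio\<close>, and never 0, so that 0
  can code the empty list. The value lies above \<open>(a + b)^2\<close> and is at most
  \<open>(a + b + 1)^2\<close>, which determines \<open>a + b\<close> and then
  \<open>a\<close>.\<close>

definition pr :: "nat \<Rightarrow> nat \<Rightarrow> nat" where
  "pr a b = (a + b) * (a + b) + a + 1"

lemma pr_inject [simp]: "pr a b = pr c d \<longleftrightarrow> a = c \<and> b = d"
proof
  have less: "pr a b < pr c d" if "a + b < c + d" for a b c d
  proof -
    have "Suc (a + b) * Suc (a + b) \<le> (c + d) * (c + d)"
      using that by (intro mult_mono) auto
    then show ?thesis
      by (simp add: pr_def)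
  qed
  assume eq: "pr a b = pr c d"
  then have "a + b = c + d"
    using less[of a b c d] less[of c d a b] by linarith
  with eq show "a = c \<and> b = d"
    by (simp add: pr_def)
qed simp

lemma pr_pos [simp]: "0 < pr a b" "pr a b \<noteq> 0" "0 \<noteq> pr a b"
  by (simp_all add: pr_def)

primrec list_code :: "nat list \<Rightarrow> nat" where
  "list_code [] = 0"
| "list_code (x # xs) = pr x (list_code xs)"

definition atom :: "nat \<Rightarrow> nat \<Rightarrow> nat \<Rightarrow> nat" where
  "atom p xs y = pr p (pr xs y)"

text \<open>
  \<open>atom p xs y\<close> states that the program \<open>p\<close> yields \<open>y\<close> on input \<open>xs\<close>, and \<open>step k b\<^sub>1 b\<^sub>2\<close> that
  the statement \<open>k\<close> follows from \<open>b\<^sub>1\<close> and \<open>b\<^sub>2\<close>, where an absent premise is replaced by \<open>k\<close> itself.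
  The tags 0 to 3, 5 and 6 stand for the constructions of recursive functions, 4 for the
  simultaneous evaluation of a list of programs, and 7 for the absence of a zero below \<open>y\<close>.
\<close>

inductive step :: "nat \<Rightarrow> nat \<Rightarrow> nat \<Rightarrow> bool" where
  "k = atom (pr 0 0) xs 0 \<Longrightarrow> step k k k"
| "k = atom (pr 1 0) (pr x xs) (Suc x) \<Longrightarrow> step k k k"
| "k = atom (pr 2 0) (pr x xs) x \<Longrightarrow> step k k k"
| "k = atom (pr 2 (Suc i)) (pr x xs) y \<Longrightarrow> step k (atom (pr 2 i) xs y) k"
| "step (atom (pr 3 (pr f gs)) xs y) (atom (pr 4 gs) xs ys) (atom f ys y)"
| "k = atom (pr 4 0) xs 0 \<Longrightarrow> step k k k"
| "step (atom (pr 4 (pr g gs)) xs (pr y ys)) (atom g xs y) (atom (pr 4 gs) xs ys)"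
| "k = atom (pr 5 (pr f g)) (pr 0 xs) y \<Longrightarrow> step k (atom f xs y) k"
| "step (atom (pr 5 (pr f g)) (pr (Suc m) xs) y)
     (atom (pr 5 (pr f g)) (pr m xs) v) (atom g (pr m (pr v xs)) y)"
| "step (atom (pr 6 f) xs y) (atom f (pr y xs) 0) (atom (pr 7 f) xs y)"
| "k = atom (pr 7 f) xs 0 \<Longrightarrow> step k k k"
| "step (atom (pr 7 f) xs (Suc y)) (atom (pr 7 f) xs y) (atom f (pr y xs) (Suc v))"

text \<open>A derivation tree is replaced by a finite set closed under backward steps, which is
  easier to code. That circular support does no harm is shown by the induction over programs and
  arguments in \<open>recursive_supported\<close>.\<close>

definition supported :: "nat \<Rightarrow> bool" where
  "supported k \<longleftrightarrow> (\<exists>D. finite D \<and> k \<in> D \<and> (\<forall>j\<in>D. \<exists>b1\<in>D. \<exists>b2\<in>D. step j b1 b2))"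

lemma supported_step:
  assumes "step k b1 b2" "b1 = k \<or> supported b1" "b2 = k \<or> supported b2"
  shows "supported k"
proof -
  have "\<exists>D. finite D \<and> b \<in> insert k D \<and> (\<forall>j\<in>D. \<exists>b1\<in>D. \<exists>b2\<in>D. step j b1 b2)"
    if "b = k \<or> supported b" for b
    using that unfolding supported_def by blast
  from this[OF assms(2)] this[OF assms(3)] obtain D1 D2 where D:
    "finite D1" "b1 \<in> insert k D1" "\<forall>j\<in>D1. \<exists>b1\<in>D1. \<exists>b2\<in>D1. step j b1 b2"
    "finite D2" "b2 \<in> insert k D2" "\<forall>j\<in>D2. \<exists>b1\<in>D2. \<exists>b2\<in>D2. step j b1 b2"
    by (elim exE conjE) rule
  let ?D = "insert k (D1 \<union> D2)"
  have "\<exists>b1\<in>?D. \<exists>b2\<in>?D. step j b1 b2" if "j \<in> ?D" for j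
    using that
  proof (elim insertE UnE)
    assume "j = k"
    with assms(1) D(2,5) show ?thesis
      by (intro bexI[of _ b1] bexI[of _ b2]) auto
  qed (use D(3,6) in fast)+
  with D(1,4) show ?thesis
    unfolding supported_def by (intro exI[of _ ?D]) simp
qed

lemma supported_cases: "supported k \<Longrightarrow> \<exists>b1 b2. step k b1 b2 \<and> supported b1 \<and> supported b2"
  unfolding supported_def by blast

section \<open>Inversion of the rules\<close>

lemma supported_zero: "supported (atom (pr 0 0) xs y) \<longleftrightarrow> y = 0"
  by (rule iffI, drule supported_cases, (auto elim!: step.cases simp: atom_def)[1])
    (hypsubst, rule supported_step[OF step.intros(1)[OF refl]], simp_all)

lemma supported_Suc: "supported (atom (pr 1 0) (pr x xs) y) \<longleftrightarrow> y = Suc x"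
  by (rule iffI, drule supported_cases, (auto elim!: step.cases simp: atom_def)[1])
    (hypsubst, rule supported_step[OF step.intros(2)[OF refl]], simp_all)

lemma supported_proj_0: "supported (atom (pr 2 0) (pr x xs) y) \<longleftrightarrow> y = x"
  by (rule iffI, drule supported_cases, (auto elim!: step.cases simp: atom_def)[1])
    (hypsubst, rule supported_step[OF step.intros(3)[OF refl]], simp_all)

lemma supported_proj_Suc:
  "supported (atom (pr 2 (Suc i)) (pr x xs) y) \<longleftrightarrow> supported (atom (pr 2 i) xs y)"
  by (rule iffI, drule supported_cases, (auto elim!: step.cases simp: atom_def)[1])
    (rule supported_step[OF step.intros(4)[OF refl]], simp_all)

lemma supported_comp:
  "supported (atom (pr 3 (pr f gs)) xs y) \<longleftrightarrow>
     (\<exists>ys. supported (atom (pr 4 gs) xs ys) \<and> supported (atom f ys y))"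
  by (rule iffI, drule supported_cases, (auto elim!: step.cases simp: atom_def)[1])
    (elim exE conjE, rule supported_step[OF step.intros(5)], (rule disjI2, assumption)+)

lemma supported_list_Nil: "supported (atom (pr 4 0) xs y) \<longleftrightarrow> y = 0"
  by (rule iffI, drule supported_cases, (auto elim!: step.cases simp: atom_def)[1])
    (hypsubst, rule supported_step[OF step.intros(6)[OF refl]], simp_all)

lemma supported_list_Cons:
  "supported (atom (pr 4 (pr g gs)) xs z) \<longleftrightarrow>
     (\<exists>y ys. z = pr y ys \<and> supported (atom g xs y) \<and> supported (atom (pr 4 gs) xs ys))"
  by (rule iffI, drule supported_cases, (auto elim!: step.cases simp: atom_def)[1])
    (elim exE conjE, hypsubst?, rule supported_step[OF step.intros(7)], (rule disjI2, assumption)+)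

lemma supported_prim_0:
  "supported (atom (pr 5 (pr f g)) (pr 0 xs) y) \<longleftrightarrow> supported (atom f xs y)"
  by (rule iffI, drule supported_cases, (auto elim!: step.cases simp: atom_def)[1])
    (rule supported_step[OF step.intros(8)[OF refl]], simp_all)

lemma supported_prim_Suc:
  "supported (atom (pr 5 (pr f g)) (pr (Suc m) xs) y) \<longleftrightarrow>
     (\<exists>v. supported (atom (pr 5 (pr f g)) (pr m xs) v) \<and> supported (atom g (pr m (pr v xs)) y))"
  by (rule iffI, drule supported_cases, (auto elim!: step.cases simp: atom_def)[1])
    (elim exE conjE, rule supported_step[OF step.intros(9)], (rule disjI2, assumption)+)

lemma supported_min:
  "supported (atom (pr 6 f) xs y) \<longleftrightarrow>
     supported (atom f (pr y xs) 0) \<and> supported (atom (pr 7 f) xs y)"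
  by (rule iffI, drule supported_cases, (auto elim!: step.cases simp: atom_def)[1])
    (elim exE conjE, rule supported_step[OF step.intros(10)], (rule disjI2, assumption)+)

lemma supported_below_0: "supported (atom (pr 7 f) xs 0)"
  by (rule supported_step[OF step.intros(11)]) auto

lemma supported_below_Suc:
  "supported (atom (pr 7 f) xs (Suc y)) \<longleftrightarrow>
     supported (atom (pr 7 f) xs y) \<and> (\<exists>v. supported (atom f (pr y xs) (Suc v)))"
  by (rule iffI, drule supported_cases, (auto elim!: step.cases simp: atom_def)[1])
    (elim exE conjE, rule supported_step[OF step.intros(12)], (rule disjI2, assumption)+)

lemma recursive_supported:
  "recursive n f \<Longrightarrow>
     \<exists>p. \<forall>xs y. length xs = n \<longrightarrow> (supported (atom p (list_code xs) y) \<longleftrightarrow> y = f xs)"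
proof (induction rule: recursive.induct)
  case (recursive_zero n)
  then show ?case
    using supported_zero by blast
next
  case recursive_suc
  have "supported (atom (pr 1 0) (list_code xs) y) \<longleftrightarrow> y = Suc (xs ! 0)" if "length xs = 1" for xs y
    using that by (cases xs) (auto simp: supported_Suc[simplified])
  then show ?case
    by blast
next
  case (recursive_proj i n)
  have "supported (atom (pr 2 i) (list_code xs) y) \<longleftrightarrow> y = xs ! i" if "i < length xs" for xs y
    using that
  proof (induction i arbitrary: xs)
    case 0
    then show ?case
      by (cases xs) (auto simp: supported_proj_0)
  next
    case (Suc i)
    then show ?case
      by (cases xs) (auto simp: supported_proj_Suc)
  qed
  with recursive_proj show ?case
    by blast
next
  case (recursive_comp gs f n)
  then obtain F where F: "\<And>xs y. length xs = length gs \<Longrightarrow>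
      supported (atom F (list_code xs) y) \<longleftrightarrow> y = f xs"
    by blast
  obtain G where G: "\<And>g xs y. g \<in> set gs \<Longrightarrow> length xs = n \<Longrightarrow>
      supported (atom (G g) (list_code xs) y) \<longleftrightarrow> y = g xs"
    using recursive_comp.IH(2) by metis
  have "supported (atom (pr 4 (list_code (map G hs))) (list_code xs) ys) \<longleftrightarrow>
      ys = list_code (map (\<lambda>g. g xs) hs)" if "set hs \<subseteq> set gs" "length xs = n" for hs xs ys
    using that by (induction hs arbitrary: ys) (auto simp: supported_list_Nil supported_list_Cons G)
  then show ?case
    by (intro exI[of _ "pr 3 (pr F (list_code (map G gs)))"]) (simp add: supported_comp F)
next
  case (recursive_prim n f g)
  then obtain F G where F: "\<And>xs y. length xs = n \<Longrightarrow> supported (atom F (list_code xs) y) \<longleftrightarrow> y = f xs"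
    and G: "\<And>xs y. length xs = Suc (Suc n) \<Longrightarrow> supported (atom G (list_code xs) y) \<longleftrightarrow> y = g xs"
    by blast
  have "supported (atom (pr 5 (pr F G)) (pr m (list_code xs)) y) \<longleftrightarrow>
      y = rec_nat (f xs) (\<lambda>k y. g (k # y # xs)) m" if "length xs = n" for m xs y
  proof (induction m arbitrary: y)
    case (Suc m)
    have "supported (atom G (pr m (pr v (list_code xs))) y) \<longleftrightarrow> y = g (m # v # xs)" for v
      using G[of "m # v # xs"] that by simp
    with Suc show ?case
      by (simp add: supported_prim_Suc)
  qed (simp add: supported_prim_0 F that)
  then have "supported (atom (pr 5 (pr F G)) (list_code xs) y) \<longleftrightarrow>
      y = rec_nat (f (tl xs)) (\<lambda>k y. g (k # y # tl xs)) (hd xs)" if "length xs = Suc n" for xs y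
    using that by (cases xs) auto
  then show ?case
    by blast
next
  case (recursive_min n f)
  then obtain F where "\<And>xs y. length xs = Suc n \<Longrightarrow> supported (atom F (list_code xs) y) \<longleftrightarrow> y = f xs"
    by blast
  then have F: "supported (atom F (pr x (list_code xs)) y) \<longleftrightarrow> y = f (x # xs)" if "length xs = n" for x xs y
    using that by (metis length_Cons list_code.simps(2))
  have below: "supported (atom (pr 7 F) (list_code xs) y) \<longleftrightarrow> (\<forall>x<y. f (x # xs) \<noteq> 0)"
    if "length xs = n" for xs y
  proof (induction y)
    case (Suc y)
    have "(\<exists>v. Suc v = f (y # xs)) \<longleftrightarrow> f (y # xs) \<noteq> 0"
      by (metis not0_implies_Suc nat.distinct(1))
    with Suc show ?case
      by (auto simp: supported_below_Suc F[OF that] less_Suc_eq)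
  qed (simp add: supported_below_0)
  have "supported (atom (pr 6 F) (list_code xs) y) \<longleftrightarrow> y = (LEAST y. f (y # xs) = 0)"
    if xs: "length xs = n" for xs y
  proof -
    have "\<exists>y. f (y # xs) = 0"
      using recursive_min.hyps xs by blast
    then have "f ((LEAST y. f (y # xs) = 0) # xs) = 0"
      by (rule LeastI_ex)
    then show ?thesis
      unfolding supported_min F[OF xs] below[OF xs]
      by (metis (mono_tags, lifting) Least_equality not_less not_less_Least)
  qed
  then show ?case
    by blast
qed

section \<open>Coding finite sets of statements\<close>

lemma npol_pr: "npol s \<Longrightarrow> npol t \<Longrightarrow> npol (\<lambda>e. pr (s e) (t e))"
  unfolding pr_def by (intro npol_add npol_mult npol_const)

lemma npol_atom: "npol p \<Longrightarrow> npol s \<Longrightarrow> npol t \<Longrightarrow> npol (\<lambda>e. atom (p e) (s e) (t e))"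
  unfolding atom_def by (intro npol_pr)

lemma EF_pr: "EF f \<Longrightarrow> EF g \<Longrightarrow> EF (\<lambda>e. pr (f e) (g e))"
  unfolding pr_def by (intro EF_add EF_mult EF_const)

lemma npol_Suc: "npol t \<Longrightarrow> npol (\<lambda>e. Suc (t e))"
  using npol_add[OF npol_const[of 1]] by simp

lemmas pdio_intros = pdio_disj pdio_conj pdio_ex pdio_eq
  npol_atom npol_pr npol_Suc npol_add npol_mult npol_var npol_const

lemma pdio_step: "pdio (\<lambda>e. step (e i) (e j) (e k))"
  unfolding step.simps by (intro pdio_intros)

text \<open>As in Goedel's beta function, a suitable \<open>b\<close> makes the moduli
  \<open>1 + k b\<close> pairwise coprime, and \<open>a\<close> is the product of those that belong
  to members.\<close>

definition coded_member :: "nat \<Rightarrow> nat \<Rightarrow> nat \<Rightarrow> nat \<Rightarrow> bool" where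
  "coded_member n a b k \<longleftrightarrow> k \<in> {1..n} \<and> Suc (k * b) dvd a"

lemma coded_set_exists:
  assumes "finite D" "D \<subseteq> {1..n}"
  shows "\<exists>a b. \<forall>k. coded_member n a b k \<longleftrightarrow> k \<in> D"
proof -
  \<comment> \<open>A common prime divisor of two moduli divides \<open>(k - j) * b\<close>, hence
    \<open>b\<close>, as \<open>k - j\<close> divides \<open>fact n\<close>; but then it divides
    1.\<close>
  define b :: nat where "b = fact n"
  have coprime: "coprime (Suc (j * b)) (Suc (k * b))" if "j \<in> {1..n}" "k \<in> {1..n}" "j < k" for j k
  proof (rule ccontr)
    assume "\<not> coprime (Suc (j * b)) (Suc (k * b))"
    then obtain q where q: "prime q" "q dvd Suc (j * b)" "q dvd Suc (k * b)"
      using prime_common_divisor by blast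
    have "q dvd Suc (k * b) - Suc (j * b)"
      using q(2,3) by (intro dvd_diff_nat)
    also have "Suc (k * b) - Suc (j * b) = (k - j) * b"
      by (simp add: diff_mult_distrib)
    finally have "q dvd k - j \<or> q dvd b"
      using q(1) by (simp add: prime_dvd_mult_iff)
    then have "q dvd b"
    proof
      assume "q dvd k - j"
      moreover have "k - j dvd b"
        unfolding b_def using that by (intro dvd_fact) auto
      ultimately show ?thesis
        by (rule dvd_trans)
    qed
    then have "q dvd Suc (j * b) - j * b"
      using q(2) by (intro dvd_diff_nat) auto
    with q(1) show False
      by simp
  qed
  have "coded_member n (\<Prod>j\<in>D. Suc (j * b)) b k \<longleftrightarrow> k \<in> D" for k
  proof
    assume "k \<in> D"
    with assms show "coded_member n (\<Prod>j\<in>D. Suc (j * b)) b k"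
      unfolding coded_member_def by (auto intro: dvd_prodI)
  next
    assume k: "coded_member n (\<Prod>j\<in>D. Suc (j * b)) b k"
    show "k \<in> D"
    proof (rule ccontr)
      assume "k \<notin> D"
      have "coprime (Suc (k * b)) (Suc (j * b))" if "j \<in> D" for j
        using coprime[of j k] coprime[of k j] that assms(2) k \<open>k \<notin> D\<close>
        unfolding coded_member_def by (metis coprime_commute linorder_neqE_nat subsetD)
      then have "coprime (Suc (k * b)) (\<Prod>j\<in>D. Suc (j * b))"
        by (rule prod_coprime_right)
      with k have "is_unit (Suc (k * b))"
        unfolding coded_member_def by (metis coprime_absorb_left)
      with k show False
        by (simp add: coded_member_def b_def)
    qed
  qed
  then show ?thesis
    by blast
qed

text \<open>The order of the quantifiers makes \<open>n\<close> variable 0, where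
  \<open>ED_bounded_all\<close> expects its bound. The implication is written as a disjunction,
  under which \<open>pdio\<close> is closed.\<close>

lemma supported_iff:
  "supported k \<longleftrightarrow> (\<exists>b a n. coded_member n a b k \<and>
     (\<forall>j\<in>{1..n}. \<not> Suc (j * b) dvd a \<or>
        (\<exists>b1 b2. step j b1 b2 \<and> coded_member n a b b1 \<and> coded_member n a b b2)))"
proof
  assume "supported k"
  then obtain D where D: "finite D" "k \<in> D" "\<forall>j\<in>D. \<exists>b1\<in>D. \<exists>b2\<in>D. step j b1 b2"
    unfolding supported_def by blast
  have "j \<ge> 1" if j: "j \<in> D" for j
  proof -
    obtain b1 b2 where "step j b1 b2"
      using D(3) j by blast
    then show ?thesis
      by cases (simp_all add: atom_def Suc_le_eq)
  qed
  moreover have "j \<le> Max D" if "j \<in> D" for j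
    using D(1) that by simp
  ultimately obtain a b where "\<And>k. coded_member (Max D) a b k \<longleftrightarrow> k \<in> D"
    using coded_set_exists[OF D(1), of "Max D"] by fastforce
  note ab = this
  have "\<not> Suc (j * b) dvd a \<or>
      (\<exists>b1 b2. step j b1 b2 \<and> coded_member (Max D) a b b1 \<and> coded_member (Max D) a b b2)"
    if j: "j \<in> {1..Max D}" for j
  proof (cases "Suc (j * b) dvd a")
    case True
    with ab[of j] j have "j \<in> D"
      by (simp add: coded_member_def)
    with D(3) show ?thesis
      unfolding ab by blast
  qed simp
  with D(2) ab show "\<exists>b a n. coded_member n a b k \<and>
     (\<forall>j\<in>{1..n}. \<not> Suc (j * b) dvd a \<or>
        (\<exists>b1 b2. step j b1 b2 \<and> coded_member n a b b1 \<and> coded_member n a b b2))"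
    by blast
next
  assume "\<exists>b a n. coded_member n a b k \<and>
     (\<forall>j\<in>{1..n}. \<not> Suc (j * b) dvd a \<or>
        (\<exists>b1 b2. step j b1 b2 \<and> coded_member n a b b1 \<and> coded_member n a b b2))"
  then obtain n a b where k: "coded_member n a b k" and n: "\<forall>j\<in>{1..n}. \<not> Suc (j * b) dvd a \<or>
        (\<exists>b1 b2. step j b1 b2 \<and> coded_member n a b b1 \<and> coded_member n a b b2)"
    by blast
  let ?D = "{j. coded_member n a b j}"
  have "?D \<subseteq> {1..n}"
    by (auto simp: coded_member_def)
  then have "finite ?D"
    by (rule finite_subset) simp
  moreover have "\<exists>b1\<in>?D. \<exists>b2\<in>?D. step j b1 b2" if "j \<in> ?D" for j
  proof -
    have "j \<in> {1..n}" "Suc (j * b) dvd a"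
      using that by (simp_all add: coded_member_def)
    with n show ?thesis
      by blast
  qed
  ultimately show "supported k"
    unfolding supported_def using k by (intro exI[of _ ?D]) simp
qed

lemma coded_member_iff:
  "coded_member n a b k \<longleftrightarrow> (\<exists>s t q. k = s + 1 \<and> n = k + t \<and> a = (k * b + 1) * q)"
  unfolding coded_member_def by (auto simp: dvd_def le_iff_add intro: exI[of _ "k - 1"])

text \<open>Removes a negation: the remainder modulo \<open>x + 1\<close> is \<open>r + 1\<close>,
  which is nonzero and at most \<open>x\<close>.\<close>

lemma not_Suc_dvd_iff: "\<not> Suc x dvd a \<longleftrightarrow> (\<exists>q r s. a = q * (x + 1) + r + 1 \<and> x = r + 1 + s)"
proof
  assume "\<not> Suc x dvd a"
  then obtain r where r: "a mod Suc x = Suc r"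
    by (metis dvd_eq_mod_eq_0 not0_implies_Suc)
  moreover have "a mod Suc x < Suc x"
    by simp
  ultimately have "a = (a div Suc x) * (x + 1) + r + 1" "x = r + 1 + (x - (r + 1))"
    using div_mult_mod_eq[of a "Suc x"] by simp_all
  then show "\<exists>q r s. a = q * (x + 1) + r + 1 \<and> x = r + 1 + s"
    by blast
next
  assume "\<exists>q r s. a = q * (x + 1) + r + 1 \<and> x = r + 1 + s"
  then obtain q r s where "a = q * (x + 1) + r + 1" and x: "x = r + 1 + s"
    by blast
  then have "a = r + 1 + q * Suc x"
    by simp
  then have "a mod Suc x = (r + 1) mod Suc x"
    by (simp only: mod_mult_self1)
  also have "\<dots> = r + 1"
    using x by simp
  finally have "a mod Suc x = r + 1" .
  then show "\<not> Suc x dvd a"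
    by (simp add: dvd_eq_mod_eq_0)
qed

lemma ED_supported: "ED (\<lambda>e. supported (e 0))"
proof -
  have "pdio (\<lambda>E. \<not> Suc (E 0 * E 3) dvd E 2 \<or> (\<exists>b1 b2. step (E 0) b1 b2 \<and>
      coded_member (E 1) (E 2) (E 3) b1 \<and> coded_member (E 1) (E 2) (E 3) b2))"
    unfolding coded_member_iff not_Suc_dvd_iff by (intro pdio_step pdio_intros)
  from ED_bounded_all[OF this]
  have "ED (\<lambda>E. coded_member (E 0) (E 1) (E 2) (E 3) \<and>
      (\<forall>j\<in>{1..E 0}. \<not> Suc (j * E 2) dvd E 1 \<or> (\<exists>b1 b2. step j b1 b2 \<and>
      coded_member (E 0) (E 1) (E 2) b1 \<and> coded_member (E 0) (E 1) (E 2) b2)))"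
    unfolding coded_member_iff
    by (intro ED_conj ED_intros EF_intros) (simp add: eval_nat_numeral)
  from ED_ex[OF ED_ex[OF ED_ex[OF this]]] show ?thesis
    unfolding supported_iff by (simp add: eval_nat_numeral)
qed

theorem ED_recursive:
  assumes "recursive 1 f"
  shows "ED (\<lambda>e. f [e 0] = c)"
proof -
  obtain p where "\<And>xs y. length xs = 1 \<Longrightarrow> supported (atom p (list_code xs) y) \<longleftrightarrow> y = f xs"
    using recursive_supported[OF assms] by blast
  from this[of "[x]" for x] have p: "f [x] = c \<longleftrightarrow> supported (atom p (pr x 0) c)" for x
    by auto
  have "EF (\<lambda>e. atom p (pr (e 0) 0) c)"
    unfolding atom_def by (intro EF_pr EF_intros)
  with ED_subst[OF ED_supported, of 1 "\<lambda>_ e. atom p (pr (e 0) 0) c"] show ?thesis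
    by (simp add: p)
qed

section \<open>Representation in rings of exponential polynomials\<close>

abbreviation (input) zz :: "complex \<Rightarrow> complex" where "zz \<equiv> \<lambda>z. z"

text \<open>These functions lie in every subring containing \<open>z\<close>; all witnesses
  constructed below are of this form.\<close>

definition zpoly :: "int poly \<Rightarrow> complex \<Rightarrow> complex" where
  "zpoly F = poly (map_poly of_int F)"

lemma zpoly_0 [simp]: "zpoly 0 z = 0"
  by (simp add: zpoly_def)

lemma zpoly_pCons [simp]: "zpoly (pCons a F) z = of_int a + z * zpoly F z"
  by (simp add: zpoly_def map_poly_pCons)

lemma zpoly_1 [simp]: "zpoly 1 z = 1"
  by (simp add: one_pCons)

lemma zpoly_add [simp]: "zpoly (F + G) z = zpoly F z + zpoly G z"
proof (induction F G rule: poly_induct2)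
  case (pCons a p b q)
  then show ?case
    by (simp add: algebra_simps)
qed simp

lemma zpoly_smult [simp]: "zpoly (Polynomial.smult a F) z = of_int a * zpoly F z"
  by (induction F) (simp_all add: algebra_simps)

lemma zpoly_uminus [simp]: "zpoly (- F) z = - zpoly F z"
  using zpoly_smult[of "- 1" F z] by simp

lemma zpoly_diff [simp]: "zpoly (F - G) z = zpoly F z - zpoly G z"
  using zpoly_add[of F "- G" z] by simp

lemma zpoly_mult [simp]: "zpoly (F * G) z = zpoly F z * zpoly G z"
  by (induction F) (simp_all add: algebra_simps)

lemma zpoly_of_int: "zpoly F (of_int a) = of_int (poly F a)"
  by (induction F) simp_all

lemma zpoly_pell: "zpoly (pell_x F n) z = pell_x (zpoly F z) n" "zpoly (pell_y F n) z = pell_y (zpoly F z) n"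
  by (induction n) simp_all

lemma of_int_fun: "(of_int a :: 'b \<Rightarrow> 'a::comm_ring_1) = (\<lambda>_. of_int a)"
  by (cases a rule: int_cases2) (simp_all add: of_nat_fun fun_eq_iff)

lemma pol_zpoly: "pol zz (\<lambda>x. zpoly F)"
proof (induction F)
  case 0
  have "zpoly 0 = 0"
    by (simp add: fun_eq_iff)
  then show ?case
    using pol_zero[of zz] by (simp only:)
next
  case (pCons a F)
  have "pol zz (\<lambda>x. of_int a)"
    using pol_of_nat[of zz] pol_minus[OF pol_of_nat[of zz]] by (cases a rule: int_cases2) auto
  then have "pol zz (\<lambda>x. of_int a + zz * zpoly F)"
    by (intro pol_add pol_mult pol_param pCons.IH)
  moreover have "of_int a + zz * zpoly F = zpoly (pCons a F)"
    by (simp add: fun_eq_iff of_int_fun)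
  ultimately show ?case
    by (simp only:)
qed

text \<open>
  The base has the value 1 at 0, 1 and \<open>5 / 4\<close>, so that \<open>n\<close> can be read off its code at each of
  these points.
\<close>

definition code_base :: "int poly" where
  "code_base = 1 + [:0, 1:] * [:- 1, 1:] * [:- 5, 4:]"

text \<open>The ring offers solutions of Pell equations as a definable set, so numbers are carried
  by their values rather than by constant functions.\<close>

definition code :: "nat \<Rightarrow> complex \<Rightarrow> complex" where
  "code n = zpoly (pell_y code_base n)"

lemma code_values: "code n 0 = of_nat n" "code n 1 = of_nat n" "code n (5 / 4) = of_nat n"
  by (simp_all add: code_def code_base_def zpoly_pell pell_one)

lemma pell_numbers:
  "pell_x (5 / 4 :: complex) n - (5 / 4 - 2) * pell_y (5 / 4) n = 2 ^ n"
  "pell_x (5 / 4 :: complex) n + (5 / 4 - 2) * pell_y (5 / 4) n = inverse 2 ^ n"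
  by (rule pell_rational; simp)+

locale exp_poly_subring =
  fixes R :: "(complex \<Rightarrow> complex) set"
  assumes R_exp: "R \<subseteq> exp_polys" and R_one: "1 \<in> R" and R_uminus: "\<And>a. a \<in> R \<Longrightarrow> - a \<in> R"
    and R_z: "(\<lambda>z. z) \<in> R"
    and R_add: "\<And>a b. a \<in> R \<Longrightarrow> b \<in> R \<Longrightarrow> a + b \<in> R"
    and R_mult: "\<And>a b. a \<in> R \<Longrightarrow> b \<in> R \<Longrightarrow> a * b \<in> R"
begin

sublocale diophantine R R "\<lambda>z. z"
proof
  fix a b :: "complex \<Rightarrow> complex"
  assume "a \<in> R" "b \<in> R" "a * a = (zz * zz - 1) * (b * b)"
  moreover from this(3) have "a z * a z = (z * z - 1) * (b z * b z)" for z
    by (simp add: fun_eq_iff)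
  ultimately show "a = 0 \<and> b = 0"
    using pell_exp_polys_zero[of a b "[:0, 1:]"] R_exp by (auto simp: zero_fun_def)
qed (use R_one R_uminus R_z in \<open>auto intro: R_add R_mult\<close>)

lemma zpoly_in: "zpoly F \<in> R"
  by (rule pol_in[OF pol_zpoly, of "\<lambda>_. 1"]) (use R_one in simp)

lemma dio_exI: "dio (\<lambda>x. T (x 0) (\<lambda>i. x (Suc i))) \<Longrightarrow> dio (\<lambda>x. \<exists>a\<in>R. T a x)"
  using dio_ex[of "\<lambda>x. T (x 0) (\<lambda>i. x (Suc i))"] by simp

definition divides :: "(complex \<Rightarrow> complex) \<Rightarrow> (complex \<Rightarrow> complex) \<Rightarrow> bool" where
  "divides a b \<longleftrightarrow> (\<exists>q\<in>R. b = a * q)"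

lemma dio_divides:
  assumes "pol zz p" "pol zz q"
  shows "dio (\<lambda>x. divides (p x) (q x))"
  unfolding divides_def
  by (rule dio_exI, rule dio_eq)
    (rule pol_rename, rule assms(2), rule pol_mult, rule pol_rename, rule assms(1), rule pol_var)

lemma divides_zpoly: "F dvd G \<Longrightarrow> divides (zpoly F) (zpoly G)"
proof (elim dvdE)
  fix H
  assume "G = F * H"
  then have "zpoly G = zpoly F * zpoly H"
    by (simp add: fun_eq_iff)
  then show ?thesis
    unfolding divides_def using zpoly_in by blast
qed

text \<open>Division by a monic polynomial stays within Z[z]. Together with
  \<open>divides_root\<close>, divisibility thus expresses equality of values at
  \<open>a\<close>.\<close>

lemma divides_zpoly_root: "poly F a = 0 \<Longrightarrow> divides (zpoly [:- a, 1:]) (zpoly F)"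
  by (intro divides_zpoly) (simp add: poly_eq_0_iff_dvd)

lemma divides_root: "divides (zpoly F) b \<Longrightarrow> zpoly F z = 0 \<Longrightarrow> b z = 0"
  unfolding divides_def by (auto simp del: zpoly_pCons)

definition pell :: "(complex \<Rightarrow> complex) \<Rightarrow> (complex \<Rightarrow> complex) \<Rightarrow> (complex \<Rightarrow> complex) \<Rightarrow> bool" where
  "pell V X Y \<longleftrightarrow> X * X = 1 + (V * V - 1) * (Y * Y)"

lemma dio_pell: "pol zz v \<Longrightarrow> pol zz p \<Longrightarrow> pol zz q \<Longrightarrow> dio (\<lambda>x. pell (v x) (p x) (q x))"
  unfolding pell_def by (intro dio_eq pol_intros)

lemma pell_solution: "pell (zpoly F) (zpoly (pell_x F n)) (zpoly (pell_y F n))"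
  unfolding pell_def fun_eq_iff by (simp add: zpoly_pell pell_norm)

lemma pell_cases:
  assumes "pell (zpoly F) X Y" "X \<in> R" "Y \<in> R" "zpoly F a \<noteq> zpoly F b"
  obtains n s t where "s \<in> {1, - 1}" "t \<in> {1, - 1}"
    "\<And>z. X z = s * pell_x (zpoly F z) n" "\<And>z. Y z = t * pell_y (zpoly F z) n"
proof -
  define w :: "complex poly" where "w = map_poly of_int F"
  have w: "zpoly F = poly w"
    by (simp add: zpoly_def w_def)
  have "degree w \<ge> 1"
  proof (rule ccontr)
    assume "\<not> ?thesis"
    then obtain c where "w = [:c:]"
      by (metis degree_eq_zeroE less_one not_le)
    with assms(4) show False
      by (simp add: w)
  qed
  moreover have "X z * X z = 1 + (poly w z * poly w z - 1) * (Y z * Y z)" for z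
    using fun_cong[OF assms(1)[unfolded pell_def], of z] by (simp add: w)
  ultimately obtain n where "X = poly (pell_x w n) \<or> X = poly (- pell_x w n)" "Y = poly (pell_y w n) \<or> Y = poly (- pell_y w n)"
    using assms(2,3) R_exp pell_exp_polys[of X Y w] by blast
  then show thesis
    using that[of 1 1 n] that[of 1 "- 1" n] that[of "- 1" 1 n] that[of "- 1" "- 1" n]
    by (auto simp: w pell_poly)
qed

text \<open>
  At \<open>z = 5 / 4\<close> we have \<open>z + sqrt (z\<^sup>2 - 1) = 2\<close>, so \<open>x - (z - 2) y\<close> has the value \<open>2 ^ n\<close> for the
  solution with \<open>x(1) = 1\<close> and \<open>y(1) = n\<close>. As \<open>v\<close> has an integer value there, this also excludes
  negative \<open>n\<close>.
\<close>

definition power_code :: "(complex \<Rightarrow> complex) \<Rightarrow> (complex \<Rightarrow> complex) \<Rightarrow> bool" where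
  "power_code c v \<longleftrightarrow> (\<exists>a\<in>R. \<exists>b\<in>R. \<exists>x\<in>R. \<exists>y\<in>R.
     pell (zpoly code_base) a c \<and> pell (zpoly code_base) b v \<and> pell (zpoly [:0, 1:]) x y \<and>
     divides (zpoly [:- 1, 1:]) (x - 1) \<and> divides (zpoly [:- 1, 1:]) (y - c) \<and>
     divides (zpoly [:- 5, 4:]) (x - zpoly [:- 2, 1:] * y - v))"

lemma dio_power_code: "dio (\<lambda>x. power_code (x i) (x j))"
  unfolding power_code_def
  by (intro dio_exI dio_conj dio_pell dio_divides pol_add pol_mult pol_diff pol_var pol_one pol_zpoly)

lemma power_code_iff:
  assumes "c \<in> R" "v \<in> R"
  shows "power_code c v \<longleftrightarrow> (\<exists>n. c = code n \<and> v = code (2 ^ n))"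
proof
  assume "power_code c v"
  then obtain a b x y where R: "a \<in> R" "b \<in> R" "x \<in> R" "y \<in> R"
    and pell: "pell (zpoly code_base) a c" "pell (zpoly code_base) b v" "pell (zpoly [:0, 1:]) x y"
    and dvd: "divides (zpoly [:- 1, 1:]) (x - 1)" "divides (zpoly [:- 1, 1:]) (y - c)"
      "divides (zpoly [:- 5, 4:]) (x - zpoly [:- 2, 1:] * y - v)"
    unfolding power_code_def by blast
  have base: "zpoly code_base 0 \<noteq> zpoly code_base 2"
    by (simp add: code_base_def)
  obtain n t where c: "t \<in> {1, - 1}" "\<And>z. c z = t * pell_y (zpoly code_base z) n"
    by (rule pell_cases[OF pell(1) R(1) assms(1) base]) (rule that)
  obtain m u where v: "u \<in> {1, - 1}" "\<And>z. v z = u * pell_y (zpoly code_base z) m"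
    by (rule pell_cases[OF pell(2) R(2) assms(2) base]) (rule that)
  have "zpoly [:0, 1:] 0 \<noteq> zpoly [:0, 1:] 1"
    by simp
  then obtain k r s where "r \<in> {1, - 1}" "s \<in> {1, - 1}"
    "\<And>z. x z = r * pell_x (zpoly [:0, 1:] z) k" "\<And>z. y z = s * pell_y (zpoly [:0, 1:] z) k"
    by (rule pell_cases[OF pell(3) R(3,4)]) (rule that)
  then have xy: "r \<in> {1, - 1}" "s \<in> {1, - 1}" "\<And>z. x z = r * pell_x z k" "\<And>z. y z = s * pell_y z k"
    by simp_all
  have cv: "c = (\<lambda>z. t * code n z)" "v = (\<lambda>z. u * code m z)"
    by (simp_all add: fun_eq_iff c v code_def zpoly_pell)
  have "x 1 = 1"
    using divides_root[OF dvd(1), of 1] by simp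
  then have "r = 1"
    by (simp add: xy pell_one)
  have "y 1 = c 1"
    using divides_root[OF dvd(2), of 1] by simp
  then have sk: "s * of_nat k = t * of_nat n"
    by (simp add: xy cv pell_one code_values)
  have "x (5 / 4) - (5 / 4 - 2) * y (5 / 4) = v (5 / 4)"
    using divides_root[OF dvd(3), of "5 / 4"] by simp
  then have v54: "pell_x (5 / 4) k - s * ((5 / 4 - 2) * pell_y (5 / 4) k) = u * of_nat m"
    by (simp add: xy \<open>r = 1\<close> cv code_values mult.left_commute)
  have nat: "a = of_nat n" if "t \<in> {1, - 1}" "(of_nat a :: complex) = t * of_nat n" for t a n
  proof -
    have "of_int (int a) = (of_int (int n) :: complex) \<or> of_int (int a) = (of_int (- int n) :: complex)"
      using that by auto
    then show ?thesis
      unfolding of_int_eq_iff by auto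
  qed
  have "s = 1 \<or> k = 0"
  proof (rule ccontr)
    assume not: "\<not> (s = 1 \<or> k = 0)"
    with xy(2) have "s = - 1"
      by simp
    with v54 have "inverse 2 ^ k = u * of_nat m"
      using pell_numbers(2)[of k] by simp
    then have "1 = u * of_nat (m * 2 ^ k)"
      by (simp add: field_simps)
    then have "1 = m * 2 ^ k"
      using nat[OF v(1), of 1 "m * 2 ^ k"] by simp
    with not show False
      by simp
  qed
  then have "of_nat k = t * of_nat n"
    using sk by auto
  with nat[OF c(1)] have "k = n"
    by simp
  with \<open>of_nat k = t * of_nat n\<close> have "c = code n"
    unfolding cv by (cases "n = 0") (auto simp: code_def fun_eq_iff)
  have "2 ^ k = u * of_nat m"
    using v54 pell_numbers(1)[of k] \<open>s = 1 \<or> k = 0\<close> by auto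
  then have um: "of_nat (2 ^ k) = u * (of_nat m :: complex)"
    by simp
  from nat[OF v(1) um] have "m = 2 ^ k"
    by simp
  with um have "u = 1"
    by simp
  with \<open>m = 2 ^ k\<close> \<open>k = n\<close> \<open>c = code n\<close> show "\<exists>n. c = code n \<and> v = code (2 ^ n)"
    unfolding cv by auto
next
  assume "\<exists>n. c = code n \<and> v = code (2 ^ n)"
  then obtain n where cv: "c = zpoly (pell_y code_base n)" "v = zpoly (pell_y code_base (2 ^ n))"
    by (auto simp: code_def)
  have minus: "zpoly F - zpoly G = zpoly (F - G)" "zpoly F * zpoly G = zpoly (F * G)"
    "zpoly F - 1 = zpoly (F - 1)" for F G
    by (simp_all add: fun_eq_iff)
  have "poly (pell_x [:0, 1:] n) 1 = (1 :: int)" "poly (pell_y [:0, 1:] n) 1 = int n"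
    "poly (pell_y code_base n) 1 = int n"
    by (simp_all add: pell_poly pell_one code_base_def)
  then have "divides (zpoly [:- 1, 1:]) (zpoly (pell_x [:0, 1:] n) - 1)"
    "divides (zpoly [:- 1, 1:]) (zpoly (pell_y [:0, 1:] n) - c)"
    unfolding cv minus by (intro divides_zpoly_root; simp)+
  \<comment> \<open>\<open>[:- 5, 4:]\<close> is not monic, so the quotient comes from explicit
    congruences: it is the modulus of \<open>pell_power_dvd\<close> for \<open>y = 2\<close>, and it
    divides \<open>code_base - 1\<close>.\<close>
  moreover have "[:- 5, 4:] dvd pell_x [:0, 1:] n - [:- 2, 1:] * pell_y [:0, 1:] n - pell_y code_base (2 ^ n)"
  proof -
    have "[:- 5, 4:] dvd pell_x [:0, 1:] n - [:- 2, 1:] * pell_y [:0, 1:] n - (2 :: int poly) ^ n"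
    proof -
      have "2 * [:0, 1:] * 2 - 2 * 2 - 1 = ([:- 5, 4:] :: int poly)" "[:0, 1:] - 2 = ([:- 2, 1:] :: int poly)"
        by (simp_all add: numeral_poly one_pCons)
      with pell_power_dvd[of "[:0, 1:] :: int poly" 2 n] show ?thesis
        by (simp only:)
    qed
    moreover have "[:- 5, 4:] dvd code_base - 1"
      unfolding code_base_def by (simp only: add_diff_cancel_left' dvd_triv_right)
    from this have "[:- 5, 4:] dvd pell_y code_base (2 ^ n) - of_nat (2 ^ n)"
      using py_dvd_diff dvd_trans by blast
    ultimately have "[:- 5, 4:] dvd (pell_x [:0, 1:] n - [:- 2, 1:] * pell_y [:0, 1:] n - 2 ^ n)
        - (pell_y code_base (2 ^ n) - of_nat (2 ^ n))"
      by (rule dvd_diff)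
    moreover have "(f - h) - (g - h) = f - g" for f g h :: "int poly"
      by simp
    ultimately show ?thesis
      by (simp only: of_nat_power of_nat_numeral)
  qed
  then have "divides (zpoly [:- 5, 4:]) (zpoly (pell_x [:0, 1:] n) - zpoly [:- 2, 1:] * zpoly (pell_y [:0, 1:] n) - v)"
    unfolding cv minus by (rule divides_zpoly)
  ultimately show "power_code c v"
    unfolding power_code_def cv
    by (intro bexI[OF _ zpoly_in[of "pell_x code_base n"]] bexI[OF _ zpoly_in[of "pell_x code_base (2 ^ n)"]]
        bexI[OF _ zpoly_in[of "pell_x [:0, 1:] n"]] bexI[OF _ zpoly_in[of "pell_y [:0, 1:] n"]] conjI pell_solution)
qed

lemma code_in: "code n \<in> R"
  unfolding code_def by (rule zpoly_in)

lemma code_inject: "code m = code n \<longleftrightarrow> m = n"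
  by (metis code_values(1) of_nat_eq_iff)

text \<open>Serves to restrict quantifiers to codes. The Pell equation alone also has the solutions
  \<open>- code n\<close>, which \<open>power_code\<close> excludes for
  \<open>n > 0\<close>.\<close>

lemma is_code_iff:
  assumes "c \<in> R"
  shows "(\<exists>v\<in>R. power_code c v) \<longleftrightarrow> (\<exists>n. c = code n)"
  using power_code_iff[OF assms] code_in by blast

lemma divides_code_iff:
  assumes "\<And>z. p z = zpoly F z"
  shows "divides (zpoly [:0, 1:]) p \<longleftrightarrow> p 0 = 0"
proof
  assume "p 0 = 0"
  then have "poly F 0 = 0"
    using assms[of 0] zpoly_of_int[of F 0] by simp
  moreover have "p = zpoly F"
    using assms by blast
  ultimately show "divides (zpoly [:0, 1:]) p"
    using divides_zpoly_root[of F 0] by simp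
qed (auto dest: divides_root[where z = 0])

text \<open>The base has the value 1 at 1 and \<open>a + 2\<close> at 0; these differ, so it is not
  constant. The values at 1 single out the solution with index \<open>n\<close>, and its values at 0
  are the Pell numbers.\<close>

lemma pell_code_iff:
  fixes a n k l :: nat
  shows "(\<exists>X\<in>R. \<exists>Y\<in>R. pell (1 + zpoly [:1, - 1:] * (code a + 1)) X Y \<and>
      divides (zpoly [:- 1, 1:]) (X - 1) \<and> divides (zpoly [:- 1, 1:]) (Y - code n) \<and>
      divides (zpoly [:0, 1:]) (X - code k) \<and> divides (zpoly [:0, 1:]) (Y - code l)) \<longleftrightarrow>
    int k = pell_x (int a + 2) n \<and> int l = pell_y (int a + 2) n"
proof -
  define F where "F = 1 + [:1, - 1:] * (pell_y code_base a + 1)"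
  have F: "1 + zpoly [:1, - 1:] * (code a + 1) = zpoly F"
    by (simp only: F_def code_def fun_eq_iff plus_fun_apply times_fun_apply one_fun_apply
        zpoly_add zpoly_mult zpoly_1 simp_thms)
  have F01: "zpoly F 0 = of_int (int a + 2)" "zpoly F 1 = 1"
    by (simp_all add: code_values flip: F)
  have of_nat_int: "(of_nat x :: complex) = of_int i \<longleftrightarrow> int x = i" for x i
    by (metis of_int_eq_iff of_int_of_nat_eq)
  show ?thesis
    unfolding F
  proof (intro iffI; (elim bexE conjE)?)
    fix X Y
    assume XY: "X \<in> R" "Y \<in> R" "pell (zpoly F) X Y"
      and dvd: "divides (zpoly [:- 1, 1:]) (X - 1)" "divides (zpoly [:- 1, 1:]) (Y - code n)"
        "divides (zpoly [:0, 1:]) (X - code k)" "divides (zpoly [:0, 1:]) (Y - code l)"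
    have "int a + 2 \<noteq> 1"
      by linarith
    then have "of_int (int a + 2) \<noteq> (1 :: complex)"
      by (metis of_int_1 of_int_eq_iff)
    then obtain m s t where m: "s \<in> {1, - 1}" "t \<in> {1, - 1}"
      "\<And>z. X z = s * pell_x (zpoly F z) m" "\<And>z. Y z = t * pell_y (zpoly F z) m"
      by (rule pell_cases[OF XY(3,1,2), of 0 1, unfolded F01]) (rule that)
    have "X 1 = 1" "Y 1 = of_nat n" "X 0 = of_nat k" "Y 0 = of_nat l"
      using divides_root[OF dvd(1), of 1] divides_root[OF dvd(2), of 1]
        divides_root[OF dvd(3), of 0] divides_root[OF dvd(4), of 0] by (simp_all add: code_values)
    note vals = this
    then have "s = 1"
      using m(3)[of 1] by (simp add: F01 pell_one)
    have tn: "t * of_nat m = of_nat n"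
      using m(4)[of 1] vals(2) by (simp add: F01 pell_one)
    have "t = 1 \<or> m = 0"
    proof (rule ccontr)
      assume "\<not> (t = 1 \<or> m = 0)"
      with m(2) have "t = - 1" "m \<noteq> 0"
        by auto
      with tn have "(of_nat (m + n) :: complex) = 0"
        by (simp flip: tn)
      with \<open>m \<noteq> 0\<close> show False
        by (simp only: of_nat_eq_0_iff add_is_0 simp_thms)
    qed
    with tn have "m = n"
      by auto
    have "of_nat k = (pell_x (of_int (int a + 2)) n :: complex)" "of_nat l = (pell_y (of_int (int a + 2)) n :: complex)"
      using vals(3,4) m(3,4)[of 0] \<open>s = 1\<close> \<open>t = 1 \<or> m = 0\<close> \<open>m = n\<close> by (auto simp: F01)
    then show "int k = pell_x (int a + 2) n \<and> int l = pell_y (int a + 2) n"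
      by (simp only: of_nat_int flip: pell_of_int)
  next
    assume "int k = pell_x (int a + 2) n" "int l = pell_y (int a + 2) n"
    then have kl0: "pell_x (zpoly F 0) n = of_nat k" "pell_y (zpoly F 0) n = of_nat l"
      unfolding F01 pell_of_int[symmetric] by (metis of_int_of_nat_eq)+
    define X Y where "X = zpoly (pell_x F n)" and "Y = zpoly (pell_y F n)"
    have XY: "X z = pell_x (zpoly F z) n" "Y z = pell_y (zpoly F z) n" for z
      by (simp_all add: X_def Y_def zpoly_pell)
    have "poly F 1 = 1"
      by (simp add: F_def)
    then have "divides (zpoly [:- 1, 1:]) (zpoly (pell_x F n - 1))"
      "divides (zpoly [:- 1, 1:]) (zpoly (pell_y F n - pell_y code_base n))"
      by (intro divides_zpoly_root; simp add: pell_poly pell_one code_base_def)+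
    moreover have "zpoly (pell_x F n - 1) = X - 1" "zpoly (pell_y F n - pell_y code_base n) = Y - code n"
      by (simp_all add: X_def Y_def code_def fun_eq_iff)
    moreover have "divides (zpoly [:0, 1:]) (X - code k)"
    proof (subst divides_code_iff)
      show "(X - code k) z = zpoly (pell_x F n - pell_y code_base k) z" for z
        by (simp add: X_def code_def)
      show "(X - code k) 0 = 0"
        by (simp add: XY kl0 code_values)
    qed
    moreover have "divides (zpoly [:0, 1:]) (Y - code l)"
    proof (subst divides_code_iff)
      show "(Y - code l) z = zpoly (pell_y F n - pell_y code_base l) z" for z
        by (simp add: Y_def code_def)
      show "(Y - code l) 0 = 0"
        by (simp add: XY kl0 code_values)
    qed
    moreover have "X \<in> R" "Y \<in> R" "pell (zpoly F) X Y"
      unfolding X_def Y_def by (rule zpoly_in, rule zpoly_in, rule pell_solution)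
    ultimately show "\<exists>X\<in>R. \<exists>Y\<in>R. pell (zpoly F) X Y \<and>
      divides (zpoly [:- 1, 1:]) (X - 1) \<and> divides (zpoly [:- 1, 1:]) (Y - code n) \<and>
      divides (zpoly [:0, 1:]) (X - code k) \<and> divides (zpoly [:0, 1:]) (Y - code l)"
      by auto
  qed
qed

text \<open>A code determines its number by the value at 0, so sums and products are compared there,
  by divisibility by \<open>z\<close>. Bound variables are restricted to codes by
  \<open>power_code\<close>.\<close>

theorem ED_dio: "ED S \<Longrightarrow> \<exists>T. dio T \<and> (\<forall>e. S e \<longleftrightarrow> T (\<lambda>i. code (e i)))"
proof (induction rule: ED.induct)
  case ED_one
  have "divides (zpoly [:0, 1:]) (code n - 1) \<longleftrightarrow> n = 1" for n
    by (subst divides_code_iff[of _ "pell_y code_base n - 1"]) (auto simp: code_values, simp add: code_def)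
  moreover have "dio (\<lambda>x. divides (zpoly [:0, 1:]) (x 0 - 1))"
    by (intro dio_divides pol_diff pol_var pol_one pol_zpoly)
  ultimately show ?case
    by (intro exI[of _ "\<lambda>x. divides (zpoly [:0, 1:]) (x 0 - 1)"]) simp
next
  case ED_plus
  have "divides (zpoly [:0, 1:]) (code k - (code m + code n)) \<longleftrightarrow> k = m + n" for k m n
  proof (subst divides_code_iff)
    show "(code k - (code m + code n)) z
        = zpoly (pell_y code_base k - (pell_y code_base m + pell_y code_base n)) z" for z
      by (simp add: code_def)
    have "(of_nat k :: complex) = of_nat (m + n) \<longleftrightarrow> k = m + n"
      by (rule of_nat_eq_iff)
    then show "(code k - (code m + code n)) 0 = 0 \<longleftrightarrow> k = m + n"
      by (simp add: code_values)
  qed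
  moreover have "dio (\<lambda>x. divides (zpoly [:0, 1:]) (x 0 - (x 1 + x 2)))"
    by (intro dio_divides pol_diff pol_add pol_var pol_zpoly)
  ultimately show ?case
    by (intro exI[of _ "\<lambda>x. divides (zpoly [:0, 1:]) (x 0 - (x 1 + x 2))"]) simp
next
  case ED_times
  have "divides (zpoly [:0, 1:]) (code k - (code m * code n)) \<longleftrightarrow> k = m * n" for k m n
  proof (subst divides_code_iff)
    show "(code k - (code m * code n)) z
        = zpoly (pell_y code_base k - (pell_y code_base m * pell_y code_base n)) z" for z
      by (simp add: code_def)
    have "(of_nat k :: complex) = of_nat (m * n) \<longleftrightarrow> k = m * n"
      by (rule of_nat_eq_iff)
    then show "(code k - (code m * code n)) 0 = 0 \<longleftrightarrow> k = m * n"
      by (simp add: code_values)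
  qed
  moreover have "dio (\<lambda>x. divides (zpoly [:0, 1:]) (x 0 - (x 1 * x 2)))"
    by (intro dio_divides pol_diff pol_mult pol_var pol_zpoly)
  ultimately show ?case
    by (intro exI[of _ "\<lambda>x. divides (zpoly [:0, 1:]) (x 0 - (x 1 * x 2))"]) simp
next
  case ED_power2
  have "power_code (code m) (code n) \<longleftrightarrow> n = 2 ^ m" for m n
    using power_code_iff[OF code_in code_in] by (auto simp: code_inject)
  then show ?case
    using dio_power_code[of 1 0] by (intro exI[of _ "\<lambda>x. power_code (x 1) (x 0)"]) simp
next
  case ED_pell
  define T where "T x \<longleftrightarrow> (\<exists>X\<in>R. \<exists>Y\<in>R. pell (1 + zpoly [:1, - 1:] * (x 2 + 1)) X Y \<and>
      divides (zpoly [:- 1, 1:]) (X - 1) \<and> divides (zpoly [:- 1, 1:]) (Y - x 3) \<and>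
      divides (zpoly [:0, 1:]) (X - x 0) \<and> divides (zpoly [:0, 1:]) (Y - x 1))"
    for x :: "nat \<Rightarrow> complex \<Rightarrow> complex"
  have "dio T"
    unfolding T_def by (intro dio_exI dio_conj dio_pell dio_divides pol_add pol_mult pol_diff pol_var pol_one pol_zpoly)
  moreover have "T (\<lambda>i. code (e i)) \<longleftrightarrow>
      int (e 0) = pell_x (int (e 2) + 2) (e 3) \<and> int (e 1) = pell_y (int (e 2) + 2) (e 3)" for e
    unfolding T_def by (rule pell_code_iff)
  ultimately show ?case
    by (intro exI[of _ T]) simp
next
  case (ED_conj S1 S2)
  then obtain T1 T2 where "dio T1" "\<forall>e. S1 e \<longleftrightarrow> T1 (\<lambda>i. code (e i))"
    "dio T2" "\<forall>e. S2 e \<longleftrightarrow> T2 (\<lambda>i. code (e i))"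
    by blast
  then show ?case
    by (intro exI[of _ "\<lambda>x. T1 x \<and> T2 x"]) (simp add: dio_conj)
next
  case (ED_ex S)
  then obtain T where T: "dio T" "\<And>e. S e \<longleftrightarrow> T (\<lambda>i. code (e i))"
    by blast
  have case_nat: "(\<lambda>i. x i) = case_nat (x 0) (\<lambda>i. x (Suc i))" for x :: "nat \<Rightarrow> complex \<Rightarrow> complex"
    by (simp add: fun_eq_iff split: nat.split)
  have "dio (\<lambda>x. (\<exists>v\<in>R. power_code (x 0) v) \<and> T (case_nat (x 0) (\<lambda>i. x (Suc i))))"
    unfolding case_nat[symmetric] using dio_power_code[of 1 0] T(1) by (intro dio_conj dio_exI) simp_all
  then have "dio (\<lambda>x. \<exists>c\<in>R. (\<exists>v\<in>R. power_code c v) \<and> T (case_nat c x))"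
    by (rule dio_exI)
  moreover have "(\<exists>n. S (case_nat n e)) \<longleftrightarrow>
      (\<exists>c\<in>R. (\<exists>v\<in>R. power_code c v) \<and> T (case_nat c (\<lambda>i. code (e i))))" for e
  proof -
    have "(\<lambda>i. code (case_nat n e i)) = case_nat (code n) (\<lambda>i. code (e i))" for n
      by (simp add: fun_eq_iff split: nat.split)
    then show ?thesis
      unfolding T(2) using is_code_iff code_in by auto
  qed
  ultimately show ?case
    by blast
next
  case (ED_rename S r)
  then obtain T where "dio T" "\<forall>e. S e \<longleftrightarrow> T (\<lambda>i. code (e i))"
    by blast
  then show ?case
    by (intro exI[of _ "\<lambda>x. T (\<lambda>i. x (r i))"]) (simp add: dio_rename)
qed

end

section \<open>Undecidability\<close>

definition eval_monomial :: "(nat \<Rightarrow> complex \<Rightarrow> complex) \<Rightarrow> int list \<times> nat list \<Rightarrow> complex \<Rightarrow> complex" where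
  "eval_monomial x m z =
     (\<Sum>i<length (fst m). of_int (fst m ! i) * z ^ i) * (\<Prod>j<length (snd m). x j z ^ (snd m ! j))"

lemma eval_mpoly_Nil [simp]: "eval_mpoly x [] z = 0"
  and eval_mpoly_Cons [simp]: "eval_mpoly x (m # P) z = eval_monomial x m z + eval_mpoly x P z"
  by (simp_all add: eval_mpoly_def eval_monomial_def case_prod_unfold)

lemma eval_mpoly_append [simp]: "eval_mpoly x (P @ Q) z = eval_mpoly x P z + eval_mpoly x Q z"
  by (induction P) simp_all

lemma sum_coeff_list: "(\<Sum>i<length cs. of_int (cs ! i) * z ^ i) = zpoly (Poly cs) z"
proof (induction cs)
  case (Cons c cs)
  then show ?case
    by (simp add: sum.lessThan_Suc_shift sum_distrib_left mult_ac del: sum.lessThan_Suc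
        flip: Cons.IH)
qed simp

lemma eval_monomial_mult: "\<exists>m. \<forall>x z. eval_monomial x m z = eval_monomial x m1 z * eval_monomial x m2 z"
proof -
  obtain cs1 es1 cs2 es2 where m: "m1 = (cs1, es1)" "m2 = (cs2, es2)"
    by (cases m1; cases m2) blast
  define cs where "cs = coeffs (Poly cs1 * Poly cs2)"
  define ex where "ex es j = (if j < length es then es ! j else 0)" for es :: "nat list" and j
  define N where "N = max (length es1) (length es2)"
  define es where "es = map (\<lambda>j. ex es1 j + ex es2 j) [0..<N]"
  have "(\<Prod>j<length es'. y j ^ (es' ! j)) = (\<Prod>j<N. y j ^ ex es' j)"
    if "length es' \<le> N" for es' and y :: "nat \<Rightarrow> complex"
    using that by (intro prod.mono_neutral_cong_left) (auto simp: ex_def)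
  then have "eval_monomial x (cs, es) z = eval_monomial x m1 z * eval_monomial x m2 z" for x z
    unfolding eval_monomial_def sum_coeff_list m
    by (simp add: cs_def es_def N_def power_add prod.distrib)
  then show ?thesis
    by blast
qed

lemma eval_mpoly_mult: "\<exists>R. \<forall>x z. eval_mpoly x R z = eval_mpoly x P z * eval_mpoly x Q z"
proof (induction P)
  case Nil
  show ?case
    by (intro exI[of _ "[]"]) simp
next
  case (Cons m P)
  have "\<exists>R. \<forall>x z. eval_mpoly x R z = eval_monomial x m z * eval_mpoly x Q z"
  proof (induction Q)
    case Nil
    show ?case
      by (intro exI[of _ "[]"]) simp
  next
    case (Cons m' Q)
    then obtain R where "\<forall>x z. eval_mpoly x R z = eval_monomial x m z * eval_mpoly x Q z"
      by blast
    moreover obtain k where "\<forall>x z. eval_monomial x k z = eval_monomial x m z * eval_monomial x m' z"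
      using eval_monomial_mult by blast
    ultimately show ?case
      by (intro exI[of _ "k # R"]) (simp add: algebra_simps)
  qed
  with Cons obtain R1 R2 where "\<forall>x z. eval_mpoly x R1 z = eval_monomial x m z * eval_mpoly x Q z"
    "\<forall>x z. eval_mpoly x R2 z = eval_mpoly x P z * eval_mpoly x Q z"
    by blast
  then show ?case
    by (intro exI[of _ "R1 @ R2"]) (simp add: algebra_simps)
qed

lemma pol_eval_mpoly: "pol zz p \<Longrightarrow> \<exists>P. \<forall>x z. eval_mpoly x P z = p x z"
proof (induction rule: pol.induct)
  case pol_one
  show ?case
    by (intro exI[of _ "[([1], [])]"]) (simp add: eval_monomial_def)
next
  case pol_minus_one
  show ?case
    by (intro exI[of _ "[([- 1], [])]"]) (simp add: eval_monomial_def)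
next
  case pol_param
  show ?case
    by (intro exI[of _ "[([0, 1], [])]"]) (simp add: eval_monomial_def)
next
  case (pol_var i)
  have "(\<Prod>j<i. x j z ^ ((replicate i 0 @ [1]) ! j)) = (1::complex)" for x z
    by (intro prod.neutral) (auto simp: nth_append)
  then show ?case
    by (intro exI[of _ "[([1], replicate i 0 @ [1])]"]) (simp add: eval_monomial_def nth_append)
next
  case (pol_add p q)
  then obtain P Q where "\<forall>x z. eval_mpoly x P z = p x z" "\<forall>x z. eval_mpoly x Q z = q x z"
    by blast
  then show ?case
    by (intro exI[of _ "P @ Q"]) simp
next
  case (pol_mult p q)
  then obtain P Q where "\<forall>x z. eval_mpoly x P z = p x z" "\<forall>x z. eval_mpoly x Q z = q x z"
    by blast
  then show ?case
    using eval_mpoly_mult[of P Q] by simp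
qed

section \<open>Recursive functions for the diagonal argument\<close>

lemma recursive_comp1:
  assumes "recursive 1 h" "recursive n f"
  shows "recursive n (\<lambda>xs. h [f xs])"
  using recursive_comp[of "[f]" h n] assms by simp

lemma recursive_comp2:
  assumes "recursive 2 h" "recursive n f" "recursive n g"
  shows "recursive n (\<lambda>xs. h [f xs, g xs])"
  using recursive_comp[of "[f, g]" h n] assms by (simp add: numeral_2_eq_2)

lemma recursive_Suc: "recursive n f \<Longrightarrow> recursive n (\<lambda>xs. Suc (f xs))"
  using recursive_comp1[OF recursive_suc] by simp

lemma recursive_const: "recursive n (\<lambda>xs. c)"
  by (induction c) (auto intro: recursive_zero recursive_Suc)

lemma recursive_add:
  assumes "recursive n f" "recursive n g"
  shows "recursive n (\<lambda>xs. f xs + g xs)"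
proof -
  have "rec_nat a (\<lambda>k y. Suc y) m = m + a" for a m
    by (induction m) auto
  then have "recursive 2 (\<lambda>xs. hd xs + tl xs ! 0)"
    using recursive_prim[of "Suc 0" "\<lambda>xs. xs ! 0" "\<lambda>xs. Suc (xs ! 1)",
        OF recursive_proj recursive_Suc[OF recursive_proj]]
    by (simp add: eval_nat_numeral)
  from recursive_comp2[OF this assms] show ?thesis
    by simp
qed

lemma recursive_mult:
  assumes "recursive n f" "recursive n g"
  shows "recursive n (\<lambda>xs. f xs * g xs)"
proof -
  have "rec_nat 0 (\<lambda>k y. y + a) m = m * a" for a m :: nat
    by (induction m) auto
  then have "recursive 2 (\<lambda>xs. hd xs * tl xs ! 0)"
    using recursive_prim[of "Suc 0" "\<lambda>xs. 0" "\<lambda>xs. xs ! 1 + xs ! 2",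
        OF recursive_zero recursive_add[OF recursive_proj recursive_proj]]
    by (simp add: eval_nat_numeral)
  from recursive_comp2[OF this assms] show ?thesis
    by simp
qed

lemma recursive_triangle:
  assumes "recursive n f"
  shows "recursive n (\<lambda>xs. triangle (f xs))"
proof -
  have "rec_nat 0 (\<lambda>k y. y + Suc k) m = triangle m" for m
    by (induction m) auto
  then have "recursive 1 (\<lambda>xs. triangle (hd xs))"
    using recursive_prim[of 0 "\<lambda>xs. 0" "\<lambda>xs. xs ! 1 + Suc (xs ! 0)",
        OF recursive_zero recursive_add[OF recursive_proj recursive_Suc[OF recursive_proj]]]
    by (simp add: eval_nat_numeral)
  from recursive_comp1[OF this assms] show ?thesis
    by simp
qed

lemma recursive_prod_encode:
  assumes "recursive n f" "recursive n g"
  shows "recursive n (\<lambda>xs. prod_encode (f xs, g xs))"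
  unfolding prod_encode_def by (simp add: recursive_add recursive_triangle assms)

lemma int_encode_of_nat: "int_encode (int n) = 2 * n"
  by (simp add: int_encode_def sum_encode_def)

text \<open>
  These monomials complete \<open>x\<^sub>0\<^sup>2\<close> to the square of \<open>x\<^sub>0 + n\<close>. Hence a parameter \<open>n\<close> enters an
  equation through its first two monomials only, and with nonnegative coefficients.
\<close>

definition add_square :: "nat \<Rightarrow> zz_mpoly \<Rightarrow> zz_mpoly" where
  "add_square n P = ([int (n * n)], []) # ([int (2 * n)], [1]) # P"

lemma eval_add_square:
  "eval_mpoly x (add_square n P) z = of_nat (n * n) + of_nat (2 * n) * x 0 z + eval_mpoly x P z"
  by (simp add: add_square_def eval_monomial_def)

text \<open>\<open>add_square\<close> only prepends two monomials, so the code of \<open>P\<close>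
  reappears unchanged as the code of the tail, and nothing has to be decoded. The outer factors 2
  come from \<open>int_encode_of_nat\<close>.\<close>

lemma recursive_code_add_square:
  "\<exists>s. recursive 1 s \<and> (\<forall>P. s [code_mpoly P] = code_mpoly (add_square (code_mpoly P) P))"
proof (intro exI conjI allI)
  let ?k = "\<lambda>xs :: nat list. xs ! 0"
  show "recursive 1 (\<lambda>xs. Suc (prod_encode (prod_encode (Suc (prod_encode (2 * (?k xs * ?k xs), 0)), 0),
      Suc (prod_encode (prod_encode (Suc (prod_encode (2 * (2 * ?k xs), 0)), Suc (prod_encode (1, 0))), ?k xs)))))"
    by (intro recursive_Suc recursive_prod_encode recursive_mult recursive_const recursive_proj) simp_all
qed (simp add: code_mpoly_def add_square_def int_encode_of_nat flip: of_nat_mult)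

context exp_poly_subring
begin

lemma of_int_in: "(\<lambda>z. of_int a) \<in> R"
proof -
  have "zpoly [:a:] = (\<lambda>z. of_int a)"
    by (simp add: fun_eq_iff)
  with zpoly_in show ?thesis
    by metis
qed

text \<open>\<open>P\<close> stands for \<open>x\<^sub>0^2 - (z^2 - 1) p^2\<close>, which
  \<open>add_square n\<close> turns into \<open>(x\<^sub>0 + n)^2 - (z^2 - 1) p^2\<close>. This
  vanishes only if \<open>x\<^sub>0 = - n\<close> and \<open>p = 0\<close>, so the equation itself
  fixes the parameter and \<open>P\<close> is the same for all \<open>n\<close>.\<close>

lemma recursive_solvable:
  assumes "recursive 1 f"
  shows "\<exists>P. \<forall>n. f [n] = 0 \<longleftrightarrow> solvable_in R (add_square n P)"
proof -
  obtain T where T: "dio T" "\<And>e. f [e 0] = 0 \<longleftrightarrow> T (\<lambda>i. code (e i))"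
    using ED_dio[OF ED_recursive[OF assms]] by blast
  \<comment> \<open>Passes from the constant \<open>- n\<close> in \<open>x 0\<close> to
    \<open>code n\<close>: divisibility by \<open>z\<close> forces the value of \<open>c\<close> at
    0 to be \<open>n\<close>.\<close>
  define T0 where "T0 x \<longleftrightarrow> (\<exists>c\<in>R. (\<exists>v\<in>R. power_code c v) \<and> divides (zpoly [:0, 1:]) (c + x 0) \<and> T (\<lambda>_. c))"
    for x :: "nat \<Rightarrow> complex \<Rightarrow> complex"
  have "dio (\<lambda>x. T (\<lambda>_. x 0))"
    by (rule dio_rename[OF T(1)])
  then have "dio T0"
    unfolding T0_def
    by (intro dio_exI dio_conj dio_power_code dio_divides pol_add pol_var pol_zpoly)
  then obtain p where p: "pol zz p"
    "\<And>x. \<forall>i. x i \<in> R \<Longrightarrow> T0 x \<longleftrightarrow> (\<exists>y. (\<forall>i. y i \<in> R) \<and> p (join x y) = 0)"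
    unfolding dio_def by blast
  have T0: "T0 x \<longleftrightarrow> f [n] = 0" if x: "x 0 = (\<lambda>z. - of_nat n)" for x n
  proof -
    have div: "divides (zpoly [:0, 1:]) (code m + x 0) \<longleftrightarrow> m = n" for m
    proof (subst divides_code_iff)
      show "(code m + x 0) z = zpoly (pell_y code_base m + [:- int n:]) z" for z
        by (simp add: code_def x)
    qed (simp add: code_values x)
    have "T0 x \<longleftrightarrow> (\<exists>m. divides (zpoly [:0, 1:]) (code m + x 0) \<and> T (\<lambda>_. code m))"
      unfolding T0_def using is_code_iff code_in by auto
    also have "\<dots> \<longleftrightarrow> f [n] = 0"
      unfolding div using T(2)[of "\<lambda>_. n"] by simp
    finally show ?thesis .
  qed
  have "pol zz (\<lambda>x. x 0 * x 0 - (zz * zz - 1) * (p x * p x))"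
    by (intro pol_diff pol_mult pol_var pol_param pol_one p(1))
  then obtain P where P: "\<And>x z. eval_mpoly x P z = (x 0 * x 0 - (zz * zz - 1) * (p x * p x)) z"
    using pol_eval_mpoly by blast
  have "f [n] = 0 \<longleftrightarrow> solvable_in R (add_square n P)" for n
  proof -
    have zero: "eval_mpoly x (add_square n P) = (\<lambda>z. 0) \<longleftrightarrow> x 0 = (\<lambda>z. - of_nat n) \<and> p x = 0"
      if x: "\<forall>i. x i \<in> R" for x
    proof -
      define g where "g = x 0 + (\<lambda>z. of_int (int n))"
      have "g \<in> R"
        unfolding g_def using x by (intro R_add of_int_in) auto
      have "eval_mpoly x (add_square n P) z = (g * g - (zz * zz - 1) * (p x * p x)) z" for z
        by (simp add: eval_add_square P g_def algebra_simps)
      then have "eval_mpoly x (add_square n P) = (\<lambda>z. 0) \<longleftrightarrow> g * g = (zz * zz - 1) * (p x * p x)"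
        by (auto simp: fun_eq_iff)
      also have "\<dots> \<longleftrightarrow> g = 0 \<and> p x = 0"
        using anisotropic[OF \<open>g \<in> R\<close> pol_in[OF p(1) x]] by auto
      also have "g = 0 \<longleftrightarrow> x 0 = (\<lambda>z. - of_nat n)"
        by (simp add: g_def fun_eq_iff eq_neg_iff_add_eq_0)
      finally show ?thesis .
    qed
    have "(\<lambda>z. - of_nat n) \<in> R"
      using of_int_in[of "- int n"] by simp
    define x0 where "x0 = (\<lambda>_::nat. \<lambda>z::complex. - of_nat n :: complex)"
    have x0: "\<forall>i. x0 i \<in> R" "x0 0 = (\<lambda>z. - of_nat n)"
      using \<open>(\<lambda>z. - of_nat n) \<in> R\<close> by (simp_all add: x0_def)
    show ?thesis
    proof
      assume "f [n] = 0"
      with T0[of x0 n] x0 p(2)[of x0] obtain y where "\<forall>i. y i \<in> R" "p (join x0 y) = 0"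
        by auto
      with x0 show "solvable_in R (add_square n P)"
        unfolding solvable_in_def
        by (intro exI[of _ "join x0 y"]) (simp add: zero join_in join_def[of _ _ 0])
    next
      assume "solvable_in R (add_square n P)"
      then obtain x where x: "\<forall>i. x i \<in> R" "eval_mpoly x (add_square n P) = (\<lambda>z. 0)"
        unfolding solvable_in_def by blast
      have "x = join (\<lambda>i. x (2 * i)) (\<lambda>i. x (2 * i + 1))"
        by (auto simp: join_def fun_eq_iff)
      with x zero[OF x(1)] have "p (join (\<lambda>i. x (2 * i)) (\<lambda>i. x (2 * i + 1))) = 0" "x 0 = (\<lambda>z. - of_nat n)"
        by simp_all
      then show "f [n] = 0"
        using T0[of "\<lambda>i. x (2 * i)" n] p(2)[of "\<lambda>i. x (2 * i)"] x(1) by auto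
    qed
  qed
  then show ?thesis
    by blast
qed

text \<open>A decision procedure \<open>f\<close> and the map \<open>s\<close> from the code of
  \<open>P\<close> to that of \<open>add_square (code_mpoly P) P\<close> compose to a recursive
  function, which is represented by some \<open>P\<close> as in \<open>recursive_solvable\<close>.
  At \<open>n = code_mpoly P\<close> the procedure rejects the equation
  \<open>add_square n P\<close> iff it is solvable.\<close>

theorem hilbert10_undecidable: "\<not> hilbert10_decidable R"
proof
  assume "hilbert10_decidable R"
  then obtain f where f: "recursive 1 f"
    "\<And>n. f [n] = (if n \<in> {code_mpoly P | P. solvable_in R P} then 1 else 0)"
    unfolding hilbert10_decidable_def decidable_def by blast
  obtain s where s: "recursive 1 s" "\<And>P. s [code_mpoly P] = code_mpoly (add_square (code_mpoly P) P)"
    using recursive_code_add_square by blast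
  have "recursive 1 (\<lambda>xs. f [s xs])"
    by (rule recursive_comp1[OF f(1) s(1)])
  then obtain P where P: "\<And>n. f [s [n]] = 0 \<longleftrightarrow> solvable_in R (add_square n P)"
    using recursive_solvable by blast
  have "code_mpoly Q \<in> {code_mpoly P | P. solvable_in R P} \<longleftrightarrow> solvable_in R Q" for Q
    using bij_code_mpoly by (auto simp: bij_def inj_eq)
  with f(2)[of "s [code_mpoly P]"] P[of "code_mpoly P"] show False
    unfolding s(2) by auto
qed

end

section \<open>Interpretation of the integers\<close>

lemma exp_poly_subringI:
  assumes "subring R exp_poly_ring" "(\<lambda>z. z) \<in> R"
  shows "exp_poly_subring R"
proof -
  interpret E: cring exp_poly_ring
    by (rule cring_exp_poly_ring)
  note sub = subringE[OF assms(1)]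
  show ?thesis
  proof
    show "R \<subseteq> exp_polys"
      using sub(1) by (simp add: exp_poly_ring_def)
    show "1 \<in> R"
      using sub(3) by (simp add: exp_poly_ring_def one_fun_def)
    show "a + b \<in> R" "a * b \<in> R" if "a \<in> R" "b \<in> R" for a b
      using sub(6,7)[OF that] by (simp_all add: exp_poly_ring_def plus_fun_def times_fun_def)
    show "- a \<in> R" if "a \<in> R" for a
    proof -
      have "(\<ominus>\<^bsub>exp_poly_ring\<^esub> a) \<oplus>\<^bsub>exp_poly_ring\<^esub> a = \<zero>\<^bsub>exp_poly_ring\<^esub>"
        using sub(1) that by (intro E.l_neg) auto
      then have "a + (\<ominus>\<^bsub>exp_poly_ring\<^esub> a) = 0"
        by (subst add.commute) (simp add: exp_poly_ring_def plus_fun_def zero_fun_def)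
      then have "- a = \<ominus>\<^bsub>exp_poly_ring\<^esub> a"
        by (rule minus_unique)
      with sub(5)[OF that] show ?thesis
        by simp
    qed
  qed (rule assms(2))
qed

context exp_poly_subring
begin

abbreviation LZ :: "(lz_sym, complex \<Rightarrow> complex) fo_structure" where
  "LZ \<equiv> lz_structure (exp_poly_ring\<lparr>carrier := R\<rparr>) (\<lambda>z. z)"

lemma universe_LZ [simp]: "universe LZ = R"
  by (simp add: lz_structure_def)

definition tm_plus where "tm_plus s t = App (SRing SPlus) [s, t]"
definition tm_times where "tm_times s t = App (SRing STimes) [s, t]"
definition tm_zero where "tm_zero = App (SRing SZero) []"
definition tm_one where "tm_one = App (SRing SOne) []"
definition tm_z where "tm_z = App SZ []"

lemmas tm_defs = tm_plus_def tm_times_def tm_zero_def tm_one_def tm_z_def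

lemma eval_tm [simp]:
  "eval_term LZ e (tm_plus s t) = eval_term LZ e s + eval_term LZ e t"
  "eval_term LZ e (tm_times s t) = eval_term LZ e s * eval_term LZ e t"
  "eval_term LZ e tm_zero = 0" "eval_term LZ e tm_one = 1" "eval_term LZ e tm_z = (\<lambda>z. z)"
  by (simp_all add: tm_defs lz_structure_def exp_poly_ring_def plus_fun_def times_fun_def
      zero_fun_def one_fun_def)

lemma wf_tm [simp]:
  "wf_term lz_arity (tm_plus s t) \<longleftrightarrow> wf_term lz_arity s \<and> wf_term lz_arity t"
  "wf_term lz_arity (tm_times s t) \<longleftrightarrow> wf_term lz_arity s \<and> wf_term lz_arity t"
  "wf_term lz_arity tm_zero" "wf_term lz_arity tm_one" "wf_term lz_arity tm_z"
  by (auto simp: tm_defs)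

lemma term_vars_tm [simp]:
  "term_vars (tm_plus s t) = term_vars s \<union> term_vars t"
  "term_vars (tm_times s t) = term_vars s \<union> term_vars t"
  "term_vars tm_zero = {}" "term_vars tm_one = {}" "term_vars tm_z = {}"
  by (auto simp: tm_defs)

definition is_int :: "(complex \<Rightarrow> complex) \<Rightarrow> bool" where
  "is_int y \<longleftrightarrow> (\<exists>x\<in>R. pell (\<lambda>z. z) x y)"

definition int_val :: "(complex \<Rightarrow> complex) \<Rightarrow> int" where
  "int_val y = \<lfloor>Re (y 1)\<rfloor>"

lemma is_int_iff:
  assumes "y \<in> R"
  shows "is_int y \<longleftrightarrow> (\<exists>n. y = zpoly (pell_y [:0, 1:] n) \<or> y = zpoly (- pell_y [:0, 1:] n))"
proof
  have z: "(\<lambda>z. z) = zpoly [:0, 1:]"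
    by (simp add: fun_eq_iff)
  show "\<exists>n. y = zpoly (pell_y [:0, 1:] n) \<or> y = zpoly (- pell_y [:0, 1:] n)" if y: "is_int y"
  proof -
    obtain x where x: "x \<in> R" "pell (zpoly [:0, 1:]) x y"
      using y unfolding is_int_def z by blast
    have "zpoly [:0, 1:] 0 \<noteq> zpoly [:0, 1:] 1"
      by simp
    then obtain n t where "t \<in> {1, - 1}" "\<And>z. y z = t * pell_y (zpoly [:0, 1:] z) n"
      by (rule pell_cases[OF x(2,1) assms]) (rule that)
    then show ?thesis
      by (intro exI[of _ n]) (auto simp: fun_eq_iff zpoly_pell)
  qed
  show "is_int y" if y: "\<exists>n. y = zpoly (pell_y [:0, 1:] n) \<or> y = zpoly (- pell_y [:0, 1:] n)"
  proof -
    obtain n where n: "y = zpoly (pell_y [:0, 1:] n) \<or> y = zpoly (- pell_y [:0, 1:] n)"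
      using y by blast
    have "zpoly (- pell_y [:0, 1:] n) = - zpoly (pell_y [:0, 1:] n)"
      by (simp add: fun_eq_iff)
    with n pell_solution[of "[:0, 1:]" n] have "pell (\<lambda>z. z) (zpoly (pell_x [:0, 1:] n)) y"
      unfolding z pell_def by auto
    then show ?thesis
      unfolding is_int_def using zpoly_in by blast
  qed
qed

lemma is_int_val:
  assumes "y \<in> R" "is_int y"
  shows "y 1 = of_int (int_val y)" and "\<exists>F. y = zpoly F"
proof -
  obtain n where n: "y = zpoly (pell_y [:0, 1:] n) \<or> y = zpoly (- pell_y [:0, 1:] n)"
    using assms is_int_iff by blast
  then have "y 1 = of_int (int n) \<or> y 1 = of_int (- int n)"
    by (auto simp: zpoly_pell pell_one)
  then obtain i where "y 1 = of_int i"
    by blast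
  then show "y 1 = of_int (int_val y)"
    by (simp add: int_val_def)
  show "\<exists>F. y = zpoly F"
    using n by blast
qed

lemma int_val_surj: "\<exists>y\<in>R. is_int y \<and> int_val y = i"
proof -
  define F :: "int poly" where "F = (if i \<ge> 0 then pell_y [:0, 1:] (nat i) else - pell_y [:0, 1:] (nat (- i)))"
  have "is_int (zpoly F)"
    using is_int_iff[OF zpoly_in] by (auto simp: F_def)
  moreover have "zpoly F 1 = of_int i"
    by (simp add: F_def zpoly_pell pell_one)
  then have "int_val (zpoly F) = i"
    by (simp add: int_val_def)
  ultimately show ?thesis
    using zpoly_in by blast
qed

text \<open>Variable 100 serves as the bound variable; it exceeds the indices of all free variables.\<close>

definition int_formula :: "nat \<Rightarrow> lz_sym pe_formula" where
  "int_formula i = Exists 100 (Eq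
     (tm_plus (tm_times (Var 100) (Var 100)) (tm_times (Var i) (Var i)))
     (tm_plus tm_one (tm_times (tm_times tm_z tm_z) (tm_times (Var i) (Var i)))))"

lemma satisfies_int_formula: "i < 100 \<Longrightarrow> satisfies LZ e (int_formula i) \<longleftrightarrow> is_int (e i)"
  by (simp add: int_formula_def is_int_def pell_def algebra_simps)

text \<open>The language has no subtraction: the equation says that \<open>t - s\<close> is
  \<open>z - 1\<close> times the bound variable. The Pell equation in \<open>int_formula\<close> is
  rearranged for the same reason.\<close>

definition cong_formula :: "lz_sym fo_term \<Rightarrow> lz_sym fo_term \<Rightarrow> lz_sym pe_formula" where
  "cong_formula s t = Exists 100 (Eq (tm_plus s (tm_times tm_z (Var 100))) (tm_plus t (Var 100)))"

lemma cong_iff: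
  "(\<exists>q\<in>R. zpoly F + (\<lambda>z. z) * q = zpoly G + q) \<longleftrightarrow> zpoly F 1 = zpoly G 1"
proof
  assume "\<exists>q\<in>R. zpoly F + (\<lambda>z. z) * q = zpoly G + q"
  then obtain q where "zpoly F + (\<lambda>z. z) * q = zpoly G + q"
    by blast
  from fun_cong[OF this, of 1] show "zpoly F 1 = zpoly G 1"
    by simp
next
  assume "zpoly F 1 = zpoly G 1"
  then have "poly (G - F) 1 = 0"
    using zpoly_of_int[of F 1] zpoly_of_int[of G 1] by simp
  then have "divides (zpoly [:- 1, 1:]) (zpoly (G - F))"
    by (rule divides_zpoly_root)
  then obtain q where q: "q \<in> R" "zpoly (G - F) = zpoly [:- 1, 1:] * q"
    unfolding divides_def by blast
  have "zpoly F z + z * q z = zpoly G z + q z" for z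
    using fun_cong[OF q(2), of z] by (simp add: algebra_simps)
  with q(1) show "\<exists>q\<in>R. zpoly F + (\<lambda>z. z) * q = zpoly G + q"
    by (intro bexI[of _ q]) (auto simp: fun_eq_iff)
qed

fun ints_formula :: "nat \<Rightarrow> lz_sym pe_formula \<Rightarrow> lz_sym pe_formula" where
  "ints_formula 0 \<phi> = \<phi>"
| "ints_formula (Suc k) \<phi> = Conj (int_formula k) (ints_formula k \<phi>)"

lemma satisfies_ints_formula:
  "k \<le> 100 \<Longrightarrow> satisfies LZ e (ints_formula k \<phi>) \<longleftrightarrow> (\<forall>i<k. is_int (e i)) \<and> satisfies LZ e \<phi>"
  by (induction k) (auto simp: satisfies_int_formula less_Suc_eq)

lemma pe_definable_ints:
  assumes "k \<le> 100" "wf_formula lz_arity \<phi>" "free_vars \<phi> \<subseteq> {..<k}"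
    and "\<And>ys. ys \<in> tuples k R \<Longrightarrow> \<forall>y\<in>set ys. is_int y \<Longrightarrow> satisfies LZ (\<lambda>i. ys ! i) \<phi> \<longleftrightarrow> Q ys"
  shows "pe_definable lz_arity LZ k {ys \<in> tuples k R. (\<forall>y\<in>set ys. is_int y) \<and> Q ys}"
  unfolding pe_definable_def
proof (intro exI conjI)
  have wf: "wf_formula lz_arity (ints_formula j \<phi>)" for j
    by (induction j) (simp_all add: assms(2) int_formula_def)
  show "wf_formula lz_arity (ints_formula k \<phi>)"
    by (rule wf)
  have "free_vars (ints_formula j \<phi>) \<subseteq> {..<k}" if "j \<le> k" for j
    using that by (induction j) (use assms(3) in \<open>auto simp: int_formula_def\<close>)
  then show "free_vars (ints_formula k \<phi>) \<subseteq> {..<k}"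
    by simp
  have "(\<forall>y\<in>set ys. is_int y) \<and> Q ys \<longleftrightarrow> satisfies LZ (\<lambda>i. ys ! i) (ints_formula k \<phi>)"
    if "ys \<in> tuples k R" for ys
  proof -
    have "(\<forall>y\<in>set ys. is_int y) \<longleftrightarrow> (\<forall>i<k. is_int (ys ! i))"
      using that by (simp add: tuples_def all_set_conv_all_nth)
    then show ?thesis
      using assms(4)[OF that] by (auto simp: satisfies_ints_formula[OF assms(1)])
  qed
  then show "{ys \<in> tuples k R. (\<forall>y\<in>set ys. is_int y) \<and> Q ys}
      = {ys \<in> tuples k (universe LZ). satisfies LZ (\<lambda>i. ys ! i) (ints_formula k \<phi>)}"
    by auto
qed

text \<open>The conjunct \<open>True\<close> brings the domain into the form of
  \<open>pe_definable_ints\<close>.\<close>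

abbreviation int_tuples :: "(complex \<Rightarrow> complex) list set" where
  "int_tuples \<equiv> {ys \<in> tuples 1 R. (\<forall>y\<in>set ys. is_int y) \<and> True}"

lemma power_preimage_ints:
  "power_preimage (\<lambda>ys. int_val (hd ys)) int_tuples k S =
     {ys \<in> tuples k R. (\<forall>y\<in>set ys. is_int y) \<and> map int_val ys \<in> S}"
proof (intro Set.set_eqI iffI)
  fix ys
  assume "ys \<in> power_preimage (\<lambda>ys. int_val (hd ys)) int_tuples k S"
  then obtain xss where xss: "ys = concat xss" "xss \<in> tuples k int_tuples" "map (\<lambda>ys. int_val (hd ys)) xss \<in> S"
    unfolding power_preimage_def by blast
  have single: "xs = [hd xs] \<and> hd xs \<in> R \<and> is_int (hd xs)" if "xs \<in> set xss" for xs
    using xss(2) that by (cases xs) (auto simp: tuples_def)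
  then have "\<forall>xs\<in>set xss. xs = [hd xs]"
    by blast
  then have "concat xss = map hd xss"
  proof (induction xss)
    case (Cons xs xss)
    then have "concat (xs # xss) = [hd xs] @ map hd xss"
      by simp
    then show ?case
      by simp
  qed simp
  with xss single show "ys \<in> {ys \<in> tuples k R. (\<forall>y\<in>set ys. is_int y) \<and> map int_val ys \<in> S}"
    by (auto simp: tuples_def comp_def)
next
  fix ys
  assume ys: "ys \<in> {ys \<in> tuples k R. (\<forall>y\<in>set ys. is_int y) \<and> map int_val ys \<in> S}"
  have "ys = concat (map (\<lambda>y. [y]) ys)"
    by (induction ys) auto
  with ys show "ys \<in> power_preimage (\<lambda>ys. int_val (hd ys)) int_tuples k S"
    unfolding power_preimage_def
    by (intro CollectI exI[of _ "map (\<lambda>y. [y]) ys"]) (auto simp: tuples_def comp_def)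
qed

lemma tuples_Suc_iff: "(\<forall>ys\<in>tuples (Suc k) M. P ys) \<longleftrightarrow> (\<forall>y\<in>M. \<forall>ys\<in>tuples k M. P (y # ys))"
proof safe
  fix ys
  assume all: "\<forall>y\<in>M. \<forall>ys\<in>tuples k M. P (y # ys)" and "ys \<in> tuples (Suc k) M"
  then show "P ys"
    by (cases ys) (auto simp: tuples_def)
qed (auto simp: tuples_def)

lemma tuples_0_iff: "(\<forall>ys\<in>tuples 0 M. P ys) \<longleftrightarrow> P []"
  by (auto simp: tuples_def)

lemmas tuples_simps = tuples_Suc_iff tuples_0_iff

theorem pe_interpretation_ints:
  "pe_interpretation ring_arity (ring_structure \<Z>) lz_arity LZ 1 int_tuples (\<lambda>ys. int_val (hd ys))"
  unfolding pe_interpretation_def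
proof (intro conjI allI)
  have Z: "universe (ring_structure \<Z>) = UNIV"
    by (simp add: ring_structure_def)
  show "(\<lambda>ys. int_val (hd ys)) ` int_tuples = universe (ring_structure \<Z>)"
  proof -
    have "i \<in> (\<lambda>ys. int_val (hd ys)) ` int_tuples" for i
    proof -
      obtain y where "y \<in> R" "is_int y" "int_val y = i"
        using int_val_surj by blast
      then show ?thesis
        by (intro image_eqI[of _ _ "[y]"]) (auto simp: tuples_def)
    qed
    then show ?thesis
      unfolding Z by blast
  qed
  have zpoly: "\<exists>F. y = zpoly F \<and> zpoly F 1 = of_int (int_val y)" if "y \<in> R" "is_int y" for y
    using is_int_val[OF that] by auto
  have cong: "(\<exists>q\<in>R. f + (\<lambda>z. z) * q = g + q) \<longleftrightarrow> i = j"
    if "f = zpoly F" "g = zpoly G" "zpoly F 1 = of_int i" "zpoly G 1 = of_int j" for f g F G and i j :: int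
    unfolding that(1,2) cong_iff that(3,4) by simp
  have ops: "zpoly F + zpoly G = zpoly (F + G)" "zpoly F * zpoly G = zpoly (F * G)"
    "0 = zpoly 0" "1 = zpoly 1" for F G
    by (simp_all add: fun_eq_iff)
  show "pe_definable lz_arity LZ 1 int_tuples"
    by (rule pe_definable_ints[of _ "Eq tm_zero tm_zero"]) auto
  show "pe_definable lz_arity LZ (2 * 1) (power_preimage (\<lambda>ys. int_val (hd ys)) int_tuples 2
      (eq_realization (ring_structure \<Z>)))"
    unfolding power_preimage_ints mult_1_right
  proof (rule pe_definable_ints[of _ "cong_formula (Var 0) (Var 1)"])
    have "\<forall>ys\<in>tuples (Suc (Suc 0)) R. (\<forall>y\<in>set ys. is_int y) \<longrightarrow>
      satisfies LZ (\<lambda>i. ys ! i) (cong_formula (Var 0) (Var 1)) = (map int_val ys \<in> eq_realization (ring_structure \<Z>))"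
      unfolding tuples_simps
    proof (intro ballI impI)
      fix a b
      assume ab: "a \<in> R" "b \<in> R" "\<forall>y\<in>set [a, b]. is_int y"
      obtain F G where "a = zpoly F" "b = zpoly G" "zpoly F 1 = of_int (int_val a)" "zpoly G 1 = of_int (int_val b)"
        using zpoly[of a] zpoly[of b] ab by auto
      from cong[OF this]
      show "satisfies LZ (\<lambda>i. [a, b] ! i) (cong_formula (Var 0) (Var 1)) =
        (map int_val [a, b] \<in> eq_realization (ring_structure \<Z>))"
        by (auto simp: cong_formula_def eq_realization_def Z)
    qed
    then show "satisfies LZ (\<lambda>i. ys ! i) (cong_formula (Var 0) (Var 1)) =
        (map int_val ys \<in> eq_realization (ring_structure \<Z>))"
      if "ys \<in> tuples 2 R" "\<forall>y\<in>set ys. is_int y" for ys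
      using that by (simp add: numeral_2_eq_2)
  qed (auto simp: cong_formula_def)
  fix s
  \<comment> \<open>Evaluation at 1 is a ring homomorphism, so a congruence modulo
    \<open>z - 1\<close> between \<open>t\<close> and the last variable defines the graph of
    \<open>s\<close>.\<close>
  define t where "t = (case s of SZero \<Rightarrow> tm_zero | SOne \<Rightarrow> tm_one
    | SPlus \<Rightarrow> tm_plus (Var 0) (Var 1) | STimes \<Rightarrow> tm_times (Var 0) (Var 1))"
  show "pe_definable lz_arity LZ (Suc (ring_arity s) * 1)
      (power_preimage (\<lambda>ys. int_val (hd ys)) int_tuples (Suc (ring_arity s))
        (realization ring_arity (ring_structure \<Z>) s))"
    unfolding power_preimage_ints mult_1_right
  proof (rule pe_definable_ints[of _ "cong_formula t (Var (ring_arity s))"])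
    have "\<forall>ys\<in>tuples (Suc (ring_arity s)) R. (\<forall>y\<in>set ys. is_int y) \<longrightarrow>
      satisfies LZ (\<lambda>i. ys ! i) (cong_formula t (Var (ring_arity s))) =
        (map int_val ys \<in> realization ring_arity (ring_structure \<Z>) s)"
    proof (cases s)
      case SZero
      show ?thesis
        unfolding SZero ring_arity.simps tuples_simps
      proof (intro ballI impI)
        fix c
        assume c: "c \<in> R" "\<forall>y\<in>set [c]. is_int y"
        obtain H where "c = zpoly H" "zpoly H 1 = of_int (int_val c)"
          using zpoly[of c] c by auto
        from cong[OF ops(3) this(1) _ this(2), of 0]
        show "satisfies LZ (\<lambda>i. [c] ! i) (cong_formula t (Var 0)) =
          (map int_val [c] \<in> realization ring_arity (ring_structure \<Z>) SZero)"
          by (auto simp: t_def SZero cong_formula_def realization_def tuples_def ring_structure_def)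
      qed
    next
      case SOne
      show ?thesis
        unfolding SOne ring_arity.simps tuples_simps
      proof (intro ballI impI)
        fix c
        assume c: "c \<in> R" "\<forall>y\<in>set [c]. is_int y"
        obtain H where "c = zpoly H" "zpoly H 1 = of_int (int_val c)"
          using zpoly[of c] c by auto
        from cong[OF ops(4) this(1) _ this(2), of 1]
        show "satisfies LZ (\<lambda>i. [c] ! i) (cong_formula t (Var 0)) =
          (map int_val [c] \<in> realization ring_arity (ring_structure \<Z>) SOne)"
          by (auto simp: t_def SOne cong_formula_def realization_def tuples_def ring_structure_def)
      qed
    next
      case SPlus
      show ?thesis
        unfolding SPlus ring_arity.simps numeral_2_eq_2 tuples_simps
      proof (intro ballI impI)
        fix a b c
        assume abc: "a \<in> R" "b \<in> R" "c \<in> R" "\<forall>y\<in>set [a, b, c]. is_int y"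
        obtain F G H where FGH: "a = zpoly F" "b = zpoly G" "c = zpoly H" "zpoly F 1 = of_int (int_val a)"
          "zpoly G 1 = of_int (int_val b)" "zpoly H 1 = of_int (int_val c)"
          using zpoly[of a] zpoly[of b] zpoly[of c] abc by auto
        have "a + b = zpoly (F + G)"
          unfolding FGH(1,2) by (rule ops)
        from cong[OF this FGH(3) _ FGH(6), of "int_val a + int_val b"] FGH(4,5)
        show "satisfies LZ (\<lambda>i. [a, b, c] ! i) (cong_formula t (Var (Suc (Suc 0)))) =
          (map int_val [a, b, c] \<in> realization ring_arity (ring_structure \<Z>) SPlus)"
          by (auto simp: t_def SPlus cong_formula_def realization_def tuples_def ring_structure_def
              numeral_2_eq_2 intro!: exI[of _ "[int_val a, int_val b]"])
      qed
    next
      case STimes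
      show ?thesis
        unfolding STimes ring_arity.simps numeral_2_eq_2 tuples_simps
      proof (intro ballI impI)
        fix a b c
        assume abc: "a \<in> R" "b \<in> R" "c \<in> R" "\<forall>y\<in>set [a, b, c]. is_int y"
        obtain F G H where FGH: "a = zpoly F" "b = zpoly G" "c = zpoly H" "zpoly F 1 = of_int (int_val a)"
          "zpoly G 1 = of_int (int_val b)" "zpoly H 1 = of_int (int_val c)"
          using zpoly[of a] zpoly[of b] zpoly[of c] abc by auto
        have "a * b = zpoly (F * G)"
          unfolding FGH(1,2) by (rule ops)
        from cong[OF this FGH(3) _ FGH(6), of "int_val a * int_val b"] FGH(4,5)
        show "satisfies LZ (\<lambda>i. [a, b, c] ! i) (cong_formula t (Var (Suc (Suc 0)))) =
          (map int_val [a, b, c] \<in> realization ring_arity (ring_structure \<Z>) STimes)"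
          by (auto simp: t_def STimes cong_formula_def realization_def tuples_def ring_structure_def
              numeral_2_eq_2 intro!: exI[of _ "[int_val a, int_val b]"])
      qed
    qed
    then show "satisfies LZ (\<lambda>i. ys ! i) (cong_formula t (Var (ring_arity s))) =
        (map int_val ys \<in> realization ring_arity (ring_structure \<Z>) s)"
      if "ys \<in> tuples (Suc (ring_arity s)) R" "\<forall>y\<in>set ys. is_int y" for ys
      using that by blast
  qed (cases s; auto simp: cong_formula_def t_def)+
qed (auto simp: tuples_def)

end

theorem theorem1p1:
  fixes R' :: "(complex \<Rightarrow> complex) set"
  assumes "subring R' exp_poly_ring"
    and "(\<lambda>z. z) \<in> R'"
  shows "pe_interpretable ring_arity (ring_structure \<Z>)
           lz_arity (lz_structure (exp_poly_ring\<lparr>carrier := R'\<rparr>) (\<lambda>z. z))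
       \<and> \<not> hilbert10_decidable R'"
proof -
  interpret exp_poly_subring R'
    using assms by (rule exp_poly_subringI)
  show ?thesis
    using pe_interpretation_ints hilbert10_undecidable unfolding pe_interpretable_def by blast
qed

end
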